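(* Let $\mathcal{C}$ be a cluster category such that the stable category $\underline{\mathcal{C}}$ is compact or skew-symmetric. Then for any cluster-tilting subcategories $\mathcal{T},\mathcal{U}$ of $\mathcal{C}$, \[\operatorname{ind}_{\mathcal{U}}^{\mathcal{T}}\circ\beta_{\mathcal{U}}=\beta_{\mathcal{T}}\circ\underline{\overline{\mathrm{Ind}}}{}_{\mathcal{U}}^{\mathcal{T}}\qquad\text{and}\qquad \operatorname{coind}_{\mathcal{U}}^{\mathcal{T}}\circ\beta_{\mathcal{U}}=\beta_{\mathcal{T}}\circ\underline{\overline{\mathrm{Coind}}}{}_{\mathcal{U}}^{\mathcal{T}}\] as maps $\mathsf{K}_0(\operatorname{mod}\underline{\mathcal{U}})\to\mathsf{K}_0(\mathcal{T})$.
   Context: $\mathbb{K}$ is a perfect field; categories are additive and $\mathbb{K}$-linear; $\operatorname{indec}\mathcal{A}$ is a set of representatives of the isomorphism classes of indecomposable objects of $\mathcal{A}$. Cluster categories. Extriangulated categories are those of Nakaoka--Palu: they carry a bifunctor $\operatorname{Ext}^1$, and each element of $\operatorname{Ext}^1_{\mathcal{C}}(X,Y)$ is realised by a conflation $Y\to E\to X$ (an inflation followed by a deflation). Exact categories, and triangulated categories with $\operatorname{Ext}^1(X,Y)=\operatorname{Hom}(X,\Sigma Y)$, are examples. An object $P$ is projective if $\operatorname{Ext}^1(P,-)=0$ and injective if $\operatorname{Ext}^1(-,P)=0$; $\mathcal{C}$ is Frobenius if it has enough projectives and enough injectives and these coincide. For a full additively closed subcategory $\mathcal{P}$ of projective-injectives,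 the additive quotient $\mathcal{C}/\mathcal{P}$ is extriangulated with $\operatorname{Ext}^1_{\mathcal{C}/\mathcal{P}}=\operatorname{Ext}^1_{\mathcal{C}}$ and conflations the images of those of $\mathcal{C}$; $\mathcal{C}$ is algebraic if it is equivalent, as an extriangulated category, to such a quotient $\mathcal{E}/\mathcal{P}$ of an exact category $\mathcal{E}$. If $\mathcal{C}$ is Frobenius, $\underline{\mathcal{C}}$ denotes its quotient by all projectives, which is triangulated with suspension $\Sigma$. A right $\mathcal{T}$-approximation of $X$ is a map $T_0\to X$ with $T_0\in\mathcal{T}$ through which every map from an object of $\mathcal{T}$ to $X$ factors; left approximations are dual. A full subcategory $\mathcal{T}\subseteq\mathcal{C}$ is cluster-tilting if $\mathcal{T}=\{X:\operatorname{Ext}^1(T,X)=0\ \forall T\in\mathcal{T}\}=\{X:\operatorname{Ext}^1(X,T)=0\ \forall T\in\mathcal{T}\}$ and every object of $\mathcal{C}$ has a left $\mathcal{T}$-approximation which is an inflation and a right $\mathcal{T}$-approximation which is a deflation. A cluster category is an idempotent complete algebraic Frobenius extriangulated category $\mathcal{C}$ having a cluster-tilting subcategory and such that $\underline{\mathcal{C}}$ is Hom-finite and $2$-Calabi--Yau (functorially $\operatorname{Hom}(X,Y)\cong\operatorname{Hom}_{\mathbb{K}}(\operatorname{Hom}(Y,\Sigma^2X),\mathbb{K})$). $\underline{\mathcal{T}}$ is the image of $\mathcal{T}$ in $\underline{\mathcal{C}}$. Compactness. $D_X=\operatorname{End}(X)^{\mathrm{op}}/\operatorname{rad}$ and $d_X=\dim_{\mathbb{K}}D_X$.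 A topological vector space $V$ is pseudocompact if it is Hausdorff and has a system of open subspaces $U_i$ with $\dim V/U_i<\infty$ and $V\cong\varprojlim V/U_i$. A category is pseudocompact if its Hom-spaces are pseudocompact with continuous composition, and radically pseudocompact if this holds for the topology whose basic neighbourhoods of $0$ are the powers $\operatorname{rad}^n(X,Y)$ of its radical ideal. A cluster category $\mathcal{C}$ is compact if it is pseudocompact, $d_X<\infty$ for all $X$, and every cluster-tilting subcategory is radically pseudocompact; it is skew-symmetric if it is Krull--Schmidt and $d_X=1$ for all indecomposable $X$. Index and coindex. $\mathsf{K}_0(\mathcal{T})$ is the Grothendieck group of $\mathcal{T}$ with its split exact structure. For $X\in\mathcal{C}$ there are conflations $K\xrightarrow{i_R}R\xrightarrow{p_R}X$ ($\mathcal{T}$-index conflation) and $X\xrightarrow{i_L}L\xrightarrow{p_L}C$ ($\mathcal{T}$-coindex conflation) with $K,R,L,C\in\mathcal{T}$; put $\operatorname{ind}_{\mathcal{C}}^{\mathcal{T}}[X]=[R]-[K]$ and $\operatorname{coind}_{\mathcal{C}}^{\mathcal{T}}[X]=[L]-[C]$ in $\mathsf{K}_0(\mathcal{T})$ (independent of choices). For another cluster-tilting $\mathcal{U}$, $\operatorname{ind}_{\mathcal{U}}^{\mathcal{T}},\operatorname{coind}_{\mathcal{U}}^{\mathcal{T}}\colon\mathsf{K}_0(\mathcal{U})\to\mathsf{K}_0(\mathcal{T})$ are the homomorphisms sending $[U]$ to $\operatorname{ind}_{\mathcal{C}}^{\mathcal{T}}[U]$, $\operatorname{coind}_{\mathcal{C}}^{\mathcal{T}}[U]$.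 Modules and $\beta$. A $\mathcal{T}$-module is a contravariant $\mathbb{K}$-linear functor $\mathcal{T}\to\operatorname{Mod}\mathbb{K}$, and $\operatorname{mod}$ denotes finitely presented modules. $\mathsf{E}^{\mathcal{T}}X=\operatorname{Ext}^1_{\mathcal{C}}(-,X)|_{\mathcal{T}}$ is a finitely presented $\underline{\mathcal{T}}$-module and every finitely presented $\underline{\mathcal{T}}$-module is isomorphic to some $\mathsf{E}^{\mathcal{T}}X$. $\beta_{\mathcal{T}}\colon\mathsf{K}_0(\operatorname{mod}\underline{\mathcal{T}})\to\mathsf{K}_0(\mathcal{T})$ is the (well-defined) homomorphism with $\beta_{\mathcal{T}}[\mathsf{E}^{\mathcal{T}}X]=\operatorname{coind}_{\mathcal{C}}^{\mathcal{T}}[X]-\operatorname{ind}_{\mathcal{C}}^{\mathcal{T}}[X]$ for all $X\in\mathcal{C}$. The maps $\underline{\overline{\mathrm{Ind}}}$, $\underline{\overline{\mathrm{Coind}}}$. For $X\in\mathcal{C}$, choose a $\mathcal{U}$-coindex conflation $X\xrightarrow{i_L}L\xrightarrow{p_L}C$ and a $\mathcal{U}$-index conflation $K\xrightarrow{i_R}R\xrightarrow{p_R}X$ with $L,C,K,R\in\mathcal{U}$, and put $\ell^1_{\mathcal{U}}X=\ker\operatorname{Ext}^1_{\mathcal{C}}(-,i_L)$, $\ell^2_{\mathcal{U}}X=\operatorname{coker}\operatorname{Ext}^1_{\mathcal{C}}(-,p_L)$, $r^1_{\mathcal{U}}X=\ker\operatorname{Ext}^1_{\mathcal{C}}(-,i_R)$,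 $r^2_{\mathcal{U}}X=\operatorname{coker}\operatorname{Ext}^1_{\mathcal{C}}(-,p_R)$. Their restrictions to $\mathcal{T}$ are finitely presented $\underline{\mathcal{T}}$-modules, and there are well-defined homomorphisms $\mathsf{K}_0(\operatorname{mod}\underline{\mathcal{U}})\to\mathsf{K}_0(\operatorname{mod}\underline{\mathcal{T}})$ given by \[\underline{\overline{\mathrm{Ind}}}{}_{\mathcal{U}}^{\mathcal{T}}[\mathsf{E}^{\mathcal{U}}X]=[\ell^1_{\mathcal{U}}X|_{\mathcal{T}}]-[r^1_{\mathcal{U}}X|_{\mathcal{T}}],\qquad \underline{\overline{\mathrm{Coind}}}{}_{\mathcal{U}}^{\mathcal{T}}[\mathsf{E}^{\mathcal{U}}X]=[r^2_{\mathcal{U}}X|_{\mathcal{T}}]-[\ell^2_{\mathcal{U}}X|_{\mathcal{T}}].\] *)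

theory Defs
  imports
    "HOL-Computational_Algebra.Primes"
    "HOL-Algebra.AbelCoset"
    "HOL-Algebra.Module"
    "HOL-Algebra.Generated_Groups"
    "HOL-Algebra.Free_Abelian_Groups"
    "HOL-Analysis.Product_Topology"
    "HOL-Analysis.Function_Topology"
    "HOL-Analysis.T1_Spaces"
begin

section \<open>Vector spaces\<close>

text \<open>
  Vector spaces are modules of HOL-Algebra over a field \<open>K\<close>. A module record extends the ring
  record; its ring multiplication and unit are irrelevant and left undefined below.
\<close>

definition perfect_field :: "'k ring \<Rightarrow> bool" where
  "perfect_field K \<longleftrightarrow> field K \<and>
     (\<forall>p::nat. prime p \<and> [p] \<cdot>\<^bsub>K\<^esub> \<one>\<^bsub>K\<^esub> = \<zero>\<^bsub>K\<^esub> \<longrightarrow>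
        (\<forall>x\<in>carrier K. \<exists>y\<in>carrier K. y [^]\<^bsub>K\<^esub> p = x))"

definition lin_map :: "'k ring \<Rightarrow> ('k,'v) module \<Rightarrow> ('k,'w) module \<Rightarrow> ('v \<Rightarrow> 'w) \<Rightarrow> bool" where
  "lin_map K V W f \<longleftrightarrow> f \<in> carrier V \<rightarrow> carrier W \<and>
     (\<forall>x\<in>carrier V. \<forall>y\<in>carrier V. f (x \<oplus>\<^bsub>V\<^esub> y) = f x \<oplus>\<^bsub>W\<^esub> f y) \<and>
     (\<forall>k\<in>carrier K. \<forall>x\<in>carrier V. f (k \<odot>\<^bsub>V\<^esub> x) = k \<odot>\<^bsub>W\<^esub> f x)"

definition lin_bij :: "'k ring \<Rightarrow> ('k,'v) module \<Rightarrow> ('k,'w) module \<Rightarrow> ('v \<Rightarrow> 'w) \<Rightarrow> bool" where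
  "lin_bij K V W f \<longleftrightarrow> lin_map K V W f \<and> bij_betw f (carrier V) (carrier W)"

definition quot_module :: "('k,'v) module \<Rightarrow> 'v set \<Rightarrow> ('k,'v set) module" where
  "quot_module V W =
     \<lparr>carrier = a_rcosets\<^bsub>V\<^esub> W, monoid.mult = undefined, monoid.one = undefined,
      ring.zero = W, ring.add = (\<lambda>A B. A <+>\<^bsub>V\<^esub> B),
      module.smult = (\<lambda>k A. \<Union>a\<in>A. W +>\<^bsub>V\<^esub> (k \<odot>\<^bsub>V\<^esub> a))\<rparr>"

definition dual_module :: "'k ring \<Rightarrow> ('k,'v) module \<Rightarrow> ('k,'v \<Rightarrow> 'k) module" where
  "dual_module K V =
     \<lparr>carrier = {l \<in> carrier V \<rightarrow>\<^sub>E carrier K.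
         (\<forall>x\<in>carrier V. \<forall>y\<in>carrier V. l (x \<oplus>\<^bsub>V\<^esub> y) = l x \<oplus>\<^bsub>K\<^esub> l y) \<and>
         (\<forall>k\<in>carrier K. \<forall>x\<in>carrier V. l (k \<odot>\<^bsub>V\<^esub> x) = k \<otimes>\<^bsub>K\<^esub> l x)},
      monoid.mult = undefined, monoid.one = undefined,
      ring.zero = (\<lambda>x\<in>carrier V. \<zero>\<^bsub>K\<^esub>),
      ring.add = (\<lambda>l l'. \<lambda>x\<in>carrier V. l x \<oplus>\<^bsub>K\<^esub> l' x),
      module.smult = (\<lambda>k l. \<lambda>x\<in>carrier V. k \<otimes>\<^bsub>K\<^esub> l x)\<rparr>"

text \<open>\<open>V\<close> has a basis with \<open>n\<close> elements.\<close>

definition has_dim :: "'k ring \<Rightarrow> ('k,'v) module \<Rightarrow> nat \<Rightarrow> bool" where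
  "has_dim K V n \<longleftrightarrow> (\<exists>b :: nat \<Rightarrow> 'v. (\<forall>i<n. b i \<in> carrier V) \<and>
     (\<forall>x\<in>carrier V. \<exists>!c. c \<in> {..<n} \<rightarrow>\<^sub>E carrier K \<and>
        x = (\<Oplus>\<^bsub>V\<^esub>i\<in>{..<n}. c i \<odot>\<^bsub>V\<^esub> b i)))"

definition finite_dim :: "'k ring \<Rightarrow> ('k,'v) module \<Rightarrow> bool" where
  "finite_dim K V \<longleftrightarrow> (\<exists>n. has_dim K V n)"


section \<open>Linear categories\<close>

text \<open>
  \<open>Comp C X Y Z g f\<close> is the composite of \<open>f : X \<rightarrow> Y\<close> and \<open>g : Y \<rightarrow> Z\<close>. Composition takes
  the objects as arguments, so different Hom-spaces need not be disjoint.
\<close>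

record ('o,'m,'k) lincat =
  Ob :: "'o set"
  Hom :: "'o \<Rightarrow> 'o \<Rightarrow> ('k,'m) module"
  One :: "'o \<Rightarrow> 'm"
  Comp :: "'o \<Rightarrow> 'o \<Rightarrow> 'o \<Rightarrow> 'm \<Rightarrow> 'm \<Rightarrow> 'm"

abbreviation Mor :: "('o,'m,'k,'z) lincat_scheme \<Rightarrow> 'o \<Rightarrow> 'o \<Rightarrow> 'm set" where
  "Mor C X Y \<equiv> carrier (Hom C X Y)"

abbreviation Zero :: "('o,'m,'k,'z) lincat_scheme \<Rightarrow> 'o \<Rightarrow> 'o \<Rightarrow> 'm" where
  "Zero C X Y \<equiv> \<zero>\<^bsub>Hom C X Y\<^esub>"

locale linear_category =
  fixes K :: "'k ring" and C :: "('o,'m,'k,'z) lincat_scheme"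
  assumes field_K: "field K"
    and Hom_module: "\<lbrakk>X \<in> Ob C; Y \<in> Ob C\<rbrakk> \<Longrightarrow> Module.module K (Hom C X Y)"
    and One_closed: "X \<in> Ob C \<Longrightarrow> One C X \<in> Mor C X X"
    and Comp_linear_left:
      "\<lbrakk>X \<in> Ob C; Y \<in> Ob C; Z \<in> Ob C; f \<in> Mor C X Y\<rbrakk>
       \<Longrightarrow> lin_map K (Hom C Y Z) (Hom C X Z) (\<lambda>g. Comp C X Y Z g f)"
    and Comp_linear_right:
      "\<lbrakk>X \<in> Ob C; Y \<in> Ob C; Z \<in> Ob C; g \<in> Mor C Y Z\<rbrakk>
       \<Longrightarrow> lin_map K (Hom C X Y) (Hom C X Z) (\<lambda>f. Comp C X Y Z g f)"
    and Comp_assoc: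
      "\<lbrakk>W \<in> Ob C; X \<in> Ob C; Y \<in> Ob C; Z \<in> Ob C;
        f \<in> Mor C W X; g \<in> Mor C X Y; h \<in> Mor C Y Z\<rbrakk>
       \<Longrightarrow> Comp C W X Z (Comp C X Y Z h g) f = Comp C W Y Z h (Comp C W X Y g f)"
    and Comp_One_left:
      "\<lbrakk>X \<in> Ob C; Y \<in> Ob C; f \<in> Mor C X Y\<rbrakk> \<Longrightarrow> Comp C X Y Y (One C Y) f = f"
    and Comp_One_right:
      "\<lbrakk>X \<in> Ob C; Y \<in> Ob C; f \<in> Mor C X Y\<rbrakk> \<Longrightarrow> Comp C X X Y f (One C X) = f"

definition iso_mor :: "('o,'m,'k,'z) lincat_scheme \<Rightarrow> 'o \<Rightarrow> 'o \<Rightarrow> 'm \<Rightarrow> bool" where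
  "iso_mor C X Y f \<longleftrightarrow> f \<in> Mor C X Y \<and>
     (\<exists>g\<in>Mor C Y X. Comp C X Y X g f = One C X \<and> Comp C Y X Y f g = One C Y)"

definition isomorphic :: "('o,'m,'k,'z) lincat_scheme \<Rightarrow> 'o \<Rightarrow> 'o \<Rightarrow> bool" where
  "isomorphic C X Y \<longleftrightarrow> (\<exists>f. iso_mor C X Y f)"

definition zero_obj :: "('o,'m,'k,'z) lincat_scheme \<Rightarrow> 'o \<Rightarrow> bool" where
  "zero_obj C Z \<longleftrightarrow> Z \<in> Ob C \<and> One C Z = Zero C Z Z"

text \<open>\<open>S = A \<oplus> B\<close> with inclusions \<open>i, j\<close> and projections \<open>p, q\<close>.\<close>

definition biproduct ::
  "('o,'m,'k,'z) lincat_scheme \<Rightarrow> 'o \<Rightarrow> 'o \<Rightarrow> 'o \<Rightarrow> 'm \<Rightarrow> 'm \<Rightarrow> 'm \<Rightarrow> 'm \<Rightarrow> bool" where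
  "biproduct C A B S i j p q \<longleftrightarrow>
     A \<in> Ob C \<and> B \<in> Ob C \<and> S \<in> Ob C \<and>
     i \<in> Mor C A S \<and> j \<in> Mor C B S \<and> p \<in> Mor C S A \<and> q \<in> Mor C S B \<and>
     Comp C A S A p i = One C A \<and> Comp C B S B q j = One C B \<and>
     Comp C B S A p j = Zero C B A \<and> Comp C A S B q i = Zero C A B \<and>
     Comp C S A S i p \<oplus>\<^bsub>Hom C S S\<^esub> Comp C S B S j q = One C S"

locale additive_category = linear_category K C
  for K :: "'k ring" and C :: "('o,'m,'k,'z) lincat_scheme" +
  assumes ex_zero_obj: "\<exists>Z. zero_obj C Z"
    and ex_biproduct: "\<lbrakk>A \<in> Ob C; B \<in> Ob C\<rbrakk> \<Longrightarrow> \<exists>S i j p q. biproduct C A B S i j p q"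

definition full_sub :: "('o,'m,'k,'z) lincat_scheme \<Rightarrow> 'o set \<Rightarrow> ('o,'m,'k,'z) lincat_scheme" where
  "full_sub C T = C\<lparr>Ob := T\<rparr>"

definition idempotent_complete :: "('o,'m,'k,'z) lincat_scheme \<Rightarrow> bool" where
  "idempotent_complete C \<longleftrightarrow>
     (\<forall>X\<in>Ob C. \<forall>e\<in>Mor C X X. Comp C X X X e e = e \<longrightarrow>
        (\<exists>Y\<in>Ob C. \<exists>p\<in>Mor C X Y. \<exists>s\<in>Mor C Y X.
           Comp C X Y X s p = e \<and> Comp C Y X Y p s = One C Y))"

definition hom_finite :: "'k ring \<Rightarrow> ('o,'m,'k,'z) lincat_scheme \<Rightarrow> bool" where
  "hom_finite K C \<longleftrightarrow> (\<forall>X\<in>Ob C. \<forall>Y\<in>Ob C. finite_dim K (Hom C X Y))"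

text \<open>
  Full additively closed subcategories, as sets of objects: closed under finite direct sums and
  direct summands, hence under isomorphism.
\<close>

definition additively_closed :: "('o,'m,'k,'z) lincat_scheme \<Rightarrow> 'o set \<Rightarrow> bool" where
  "additively_closed C P \<longleftrightarrow> P \<subseteq> Ob C \<and> (\<forall>Z. zero_obj C Z \<longrightarrow> Z \<in> P) \<and>
     (\<forall>A B S i j p q. biproduct C A B S i j p q \<longrightarrow> (S \<in> P \<longleftrightarrow> A \<in> P \<and> B \<in> P))"

definition linear_functor ::
  "'k ring \<Rightarrow> ('o,'m,'k,'y) lincat_scheme \<Rightarrow> ('p,'n,'k,'z) lincat_scheme \<Rightarrow>
   ('o \<Rightarrow> 'p) \<Rightarrow> ('o \<Rightarrow> 'o \<Rightarrow> 'm \<Rightarrow> 'n) \<Rightarrow> bool" where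
  "linear_functor K C D F Fm \<longleftrightarrow>
     F \<in> Ob C \<rightarrow> Ob D \<and>
     (\<forall>X\<in>Ob C. \<forall>Y\<in>Ob C. lin_map K (Hom C X Y) (Hom D (F X) (F Y)) (Fm X Y)) \<and>
     (\<forall>X\<in>Ob C. Fm X X (One C X) = One D (F X)) \<and>
     (\<forall>X\<in>Ob C. \<forall>Y\<in>Ob C. \<forall>Z\<in>Ob C. \<forall>f\<in>Mor C X Y. \<forall>g\<in>Mor C Y Z.
        Fm X Z (Comp C X Y Z g f) = Comp D (F X) (F Y) (F Z) (Fm Y Z g) (Fm X Y f))"

definition equivalence_functor ::
  "'k ring \<Rightarrow> ('o,'m,'k,'y) lincat_scheme \<Rightarrow> ('p,'n,'k,'z) lincat_scheme \<Rightarrow>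
   ('o \<Rightarrow> 'p) \<Rightarrow> ('o \<Rightarrow> 'o \<Rightarrow> 'm \<Rightarrow> 'n) \<Rightarrow> bool" where
  "equivalence_functor K C D F Fm \<longleftrightarrow> linear_functor K C D F Fm \<and>
     (\<forall>X\<in>Ob C. \<forall>Y\<in>Ob C. bij_betw (Fm X Y) (Mor C X Y) (Mor D (F X) (F Y))) \<and>
     (\<forall>Y\<in>Ob D. \<exists>X\<in>Ob C. isomorphic D (F X) Y)"


section \<open>Extriangulated categories\<close>

text \<open>
  \<open>Ext C Z X\<close> is the space of extensions of \<open>Z\<close> by \<open>X\<close>.
  For \<open>a : X \<rightarrow> X'\<close>, \<open>Push C Z X X' a\<close> is the induced map from \<open>Ext C Z X\<close> to \<open>Ext C Z X'\<close>;
  for \<open>c : Z' \<rightarrow> Z\<close>, \<open>Pull C Z' Z X c\<close> is the induced map from \<open>Ext C Z X\<close> to \<open>Ext C Z' X\<close>.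
  \<open>Rlz C Z X \<delta>\<close> is the equivalence class of sequences \<open>X \<rightarrow> B \<rightarrow> Z\<close> realising \<open>\<delta>\<close>, written as
  triples of \<open>B\<close> and the two morphisms.
\<close>

record ('o,'m,'k,'e) extcat = "('o,'m,'k) lincat" +
  Ext :: "'o \<Rightarrow> 'o \<Rightarrow> ('k,'e) module"
  Push :: "'o \<Rightarrow> 'o \<Rightarrow> 'o \<Rightarrow> 'm \<Rightarrow> 'e \<Rightarrow> 'e"
  Pull :: "'o \<Rightarrow> 'o \<Rightarrow> 'o \<Rightarrow> 'm \<Rightarrow> 'e \<Rightarrow> 'e"
  Rlz :: "'o \<Rightarrow> 'o \<Rightarrow> 'e \<Rightarrow> ('o \<times> 'm \<times> 'm) set"

definition seq_equiv ::
  "('o,'m,'k,'z) lincat_scheme \<Rightarrow> 'o \<Rightarrow> 'o \<Rightarrow> 'o \<times> 'm \<times> 'm \<Rightarrow> 'o \<times> 'm \<times> 'm \<Rightarrow> bool" where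
  "seq_equiv C X Z = (\<lambda>(B,x,y) (B',x',y').
     B \<in> Ob C \<and> x \<in> Mor C X B \<and> y \<in> Mor C B Z \<and>
     B' \<in> Ob C \<and> x' \<in> Mor C X B' \<and> y' \<in> Mor C B' Z \<and>
     (\<exists>b. iso_mor C B B' b \<and> Comp C X B B' b x = x' \<and> Comp C B B' Z y' b = y))"

text \<open>The axioms of Nakaoka and Palu, in a linear setting.\<close>

locale extriangulated_category = additive_category K C
  for K :: "'k ring" and C :: "('o,'m,'k,'e) extcat" +
  assumes Ext_module: "\<lbrakk>Z \<in> Ob C; X \<in> Ob C\<rbrakk> \<Longrightarrow> Module.module K (Ext C Z X)"
    and Push_linear: "\<lbrakk>Z \<in> Ob C; X \<in> Ob C; X' \<in> Ob C; a \<in> Mor C X X'\<rbrakk>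
      \<Longrightarrow> lin_map K (Ext C Z X) (Ext C Z X') (Push C Z X X' a)"
    and Push_linear_mor: "\<lbrakk>Z \<in> Ob C; X \<in> Ob C; X' \<in> Ob C; \<delta> \<in> carrier (Ext C Z X)\<rbrakk>
      \<Longrightarrow> lin_map K (Hom C X X') (Ext C Z X') (\<lambda>a. Push C Z X X' a \<delta>)"
    and Push_One: "\<lbrakk>Z \<in> Ob C; X \<in> Ob C; \<delta> \<in> carrier (Ext C Z X)\<rbrakk>
      \<Longrightarrow> Push C Z X X (One C X) \<delta> = \<delta>"
    and Push_Comp: "\<lbrakk>Z \<in> Ob C; X \<in> Ob C; X' \<in> Ob C; X'' \<in> Ob C;
        a \<in> Mor C X X'; a' \<in> Mor C X' X''; \<delta> \<in> carrier (Ext C Z X)\<rbrakk>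
      \<Longrightarrow> Push C Z X X'' (Comp C X X' X'' a' a) \<delta> = Push C Z X' X'' a' (Push C Z X X' a \<delta>)"
    and Pull_linear: "\<lbrakk>Z \<in> Ob C; Z' \<in> Ob C; X \<in> Ob C; c \<in> Mor C Z' Z\<rbrakk>
      \<Longrightarrow> lin_map K (Ext C Z X) (Ext C Z' X) (Pull C Z' Z X c)"
    and Pull_linear_mor: "\<lbrakk>Z \<in> Ob C; Z' \<in> Ob C; X \<in> Ob C; \<delta> \<in> carrier (Ext C Z X)\<rbrakk>
      \<Longrightarrow> lin_map K (Hom C Z' Z) (Ext C Z' X) (\<lambda>c. Pull C Z' Z X c \<delta>)"
    and Pull_One: "\<lbrakk>Z \<in> Ob C; X \<in> Ob C; \<delta> \<in> carrier (Ext C Z X)\<rbrakk>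
      \<Longrightarrow> Pull C Z Z X (One C Z) \<delta> = \<delta>"
    and Pull_Comp: "\<lbrakk>Z \<in> Ob C; Z' \<in> Ob C; Z'' \<in> Ob C; X \<in> Ob C;
        c \<in> Mor C Z' Z; c' \<in> Mor C Z'' Z'; \<delta> \<in> carrier (Ext C Z X)\<rbrakk>
      \<Longrightarrow> Pull C Z'' Z X (Comp C Z'' Z' Z c c') \<delta> = Pull C Z'' Z' X c' (Pull C Z' Z X c \<delta>)"
    and Push_Pull: "\<lbrakk>Z \<in> Ob C; Z' \<in> Ob C; X \<in> Ob C; X' \<in> Ob C;
        c \<in> Mor C Z' Z; a \<in> Mor C X X'; \<delta> \<in> carrier (Ext C Z X)\<rbrakk>
      \<Longrightarrow> Push C Z' X X' a (Pull C Z' Z X c \<delta>) = Pull C Z' Z X' c (Push C Z X X' a \<delta>)"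
    and Rlz_class: "\<lbrakk>Z \<in> Ob C; X \<in> Ob C; \<delta> \<in> carrier (Ext C Z X)\<rbrakk>
      \<Longrightarrow> \<exists>B\<in>Ob C. \<exists>x\<in>Mor C X B. \<exists>y\<in>Mor C B Z.
            Rlz C Z X \<delta> = {s. seq_equiv C X Z (B,x,y) s}"
    and Rlz_mor: "\<lbrakk>Z \<in> Ob C; X \<in> Ob C; Z' \<in> Ob C; X' \<in> Ob C;
        \<delta> \<in> carrier (Ext C Z X); \<delta>' \<in> carrier (Ext C Z' X');
        (B,x,y) \<in> Rlz C Z X \<delta>; (B',x',y') \<in> Rlz C Z' X' \<delta>';
        a \<in> Mor C X X'; c \<in> Mor C Z Z'; Push C Z X X' a \<delta> = Pull C Z Z' X' c \<delta>'\<rbrakk>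
      \<Longrightarrow> \<exists>b\<in>Mor C B B'. Comp C X B B' b x = Comp C X X' B' x' a \<and>
            Comp C B B' Z' y' b = Comp C B Z Z' c y"
    and Rlz_zero: "biproduct C X Z S i j p q \<Longrightarrow> (S,i,q) \<in> Rlz C Z X \<zero>\<^bsub>Ext C Z X\<^esub>"
    and Rlz_sum: "\<lbrakk>\<delta> \<in> carrier (Ext C Z X); \<delta>' \<in> carrier (Ext C Z' X');
        (B,x,y) \<in> Rlz C Z X \<delta>; (B',x',y') \<in> Rlz C Z' X' \<delta>';
        biproduct C X X' SX iX jX pX qX; biproduct C B B' SB iB jB pB qB;
        biproduct C Z Z' SZ iZ jZ pZ qZ\<rbrakk>
      \<Longrightarrow> (SB,
           Comp C SX X SB (Comp C X B SB iB x) pX \<oplus>\<^bsub>Hom C SX SB\<^esub>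
             Comp C SX X' SB (Comp C X' B' SB jB x') qX,
           Comp C SB B SZ (Comp C B Z SZ iZ y) pB \<oplus>\<^bsub>Hom C SB SZ\<^esub>
             Comp C SB B' SZ (Comp C B' Z' SZ jZ y') qB)
          \<in> Rlz C SZ SX
              (Push C SZ X SX iX (Pull C SZ Z X pZ \<delta>) \<oplus>\<^bsub>Ext C SZ SX\<^esub>
               Push C SZ X' SX jX (Pull C SZ Z' X' qZ \<delta>'))"
    and ET3: "\<lbrakk>Z \<in> Ob C; X \<in> Ob C; Z' \<in> Ob C; X' \<in> Ob C;
        \<delta> \<in> carrier (Ext C Z X); \<delta>' \<in> carrier (Ext C Z' X');
        (B,x,y) \<in> Rlz C Z X \<delta>; (B',x',y') \<in> Rlz C Z' X' \<delta>';
        a \<in> Mor C X X'; b \<in> Mor C B B'; Comp C X B B' b x = Comp C X X' B' x' a\<rbrakk>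
      \<Longrightarrow> \<exists>c\<in>Mor C Z Z'. Comp C B Z Z' c y = Comp C B B' Z' y' b \<and>
            Push C Z X X' a \<delta> = Pull C Z Z' X' c \<delta>'"
    and ET3_op: "\<lbrakk>Z \<in> Ob C; X \<in> Ob C; Z' \<in> Ob C; X' \<in> Ob C;
        \<delta> \<in> carrier (Ext C Z X); \<delta>' \<in> carrier (Ext C Z' X');
        (B,x,y) \<in> Rlz C Z X \<delta>; (B',x',y') \<in> Rlz C Z' X' \<delta>';
        b \<in> Mor C B B'; c \<in> Mor C Z Z'; Comp C B Z Z' c y = Comp C B B' Z' y' b\<rbrakk>
      \<Longrightarrow> \<exists>a\<in>Mor C X X'. Comp C X B B' b x = Comp C X X' B' x' a \<and>
            Push C Z X X' a \<delta> = Pull C Z Z' X' c \<delta>'"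
    and ET4: "\<lbrakk>A \<in> Ob C; B \<in> Ob C; D \<in> Ob C; F \<in> Ob C;
        \<delta> \<in> carrier (Ext C D A); (B,f,f') \<in> Rlz C D A \<delta>;
        \<delta>' \<in> carrier (Ext C F B); (G,g,g') \<in> Rlz C F B \<delta>'\<rbrakk>
      \<Longrightarrow> \<exists>E\<in>Ob C. \<exists>h'\<in>Mor C G E. \<exists>d\<in>Mor C D E. \<exists>e\<in>Mor C E F.
          \<exists>\<delta>''\<in>carrier (Ext C E A).
            (G, Comp C A B G g f, h') \<in> Rlz C E A \<delta>'' \<and>
            Comp C B G E h' g = Comp C B D E d f' \<and>
            Comp C G E F e h' = g' \<and>
            (E,d,e) \<in> Rlz C F D (Push C F B D f' \<delta>') \<and>
            Pull C D E A d \<delta>'' = \<delta> \<and>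
            Push C E A B f \<delta>'' = Pull C E F B e \<delta>'"
    and ET4_op: "\<lbrakk>B \<in> Ob C; D \<in> Ob C; F \<in> Ob C; G \<in> Ob C;
        \<delta> \<in> carrier (Ext C B D); (A,f',f) \<in> Rlz C B D \<delta>;
        \<delta>' \<in> carrier (Ext C G F); (B,g',g) \<in> Rlz C G F \<delta>'\<rbrakk>
      \<Longrightarrow> \<exists>E\<in>Ob C. \<exists>h'\<in>Mor C E A. \<exists>d\<in>Mor C D E. \<exists>e\<in>Mor C E F.
          \<exists>\<delta>''\<in>carrier (Ext C G E).
            (A, h', Comp C A B G g f) \<in> Rlz C G E \<delta>'' \<and>
            Comp C D E A h' d = f' \<and>
            Comp C E A B f h' = Comp C E F B g' e \<and>
            (E,d,e) \<in> Rlz C F D (Pull C F B D g' \<delta>) \<and>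
            Push C G E F e \<delta>'' = \<delta>' \<and>
            Push C B D E d \<delta> = Pull C B G E g \<delta>''"

definition conflation ::
  "('o,'m,'k,'e) extcat \<Rightarrow> 'o \<Rightarrow> 'o \<Rightarrow> 'o \<Rightarrow> 'm \<Rightarrow> 'm \<Rightarrow> bool" where
  "conflation C X B Z x y \<longleftrightarrow> X \<in> Ob C \<and> Z \<in> Ob C \<and>
     (\<exists>\<delta>\<in>carrier (Ext C Z X). (B,x,y) \<in> Rlz C Z X \<delta>)"

definition inflation :: "('o,'m,'k,'e) extcat \<Rightarrow> 'o \<Rightarrow> 'o \<Rightarrow> 'm \<Rightarrow> bool" where
  "inflation C X B x \<longleftrightarrow> (\<exists>Z y. conflation C X B Z x y)"

definition deflation :: "('o,'m,'k,'e) extcat \<Rightarrow> 'o \<Rightarrow> 'o \<Rightarrow> 'm \<Rightarrow> bool" where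
  "deflation C B Z y \<longleftrightarrow> (\<exists>X x. conflation C X B Z x y)"

definition projectives :: "('o,'m,'k,'e) extcat \<Rightarrow> 'o set" where
  "projectives C = {P \<in> Ob C. \<forall>Y\<in>Ob C. carrier (Ext C P Y) = {\<zero>\<^bsub>Ext C P Y\<^esub>}}"

definition injectives :: "('o,'m,'k,'e) extcat \<Rightarrow> 'o set" where
  "injectives C = {I \<in> Ob C. \<forall>Y\<in>Ob C. carrier (Ext C Y I) = {\<zero>\<^bsub>Ext C Y I\<^esub>}}"

definition frobenius :: "('o,'m,'k,'e) extcat \<Rightarrow> bool" where
  "frobenius C \<longleftrightarrow>
     (\<forall>X\<in>Ob C. \<exists>P\<in>projectives C. \<exists>y. deflation C P X y) \<and>
     (\<forall>X\<in>Ob C. \<exists>I\<in>injectives C. \<exists>x. inflation C X I x) \<and>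
     projectives C = injectives C"


subsection \<open>Additive quotients\<close>

definition factor_through :: "('o,'m,'k,'z) lincat_scheme \<Rightarrow> 'o set \<Rightarrow> 'o \<Rightarrow> 'o \<Rightarrow> 'm set" where
  "factor_through C P X Y =
     {f \<in> Mor C X Y. \<exists>Q\<in>P. \<exists>g\<in>Mor C X Q. \<exists>h\<in>Mor C Q Y. f = Comp C X Q Y h g}"

definition mor_class :: "('o,'m,'k,'z) lincat_scheme \<Rightarrow> 'o set \<Rightarrow> 'o \<Rightarrow> 'o \<Rightarrow> 'm \<Rightarrow> 'm set" where
  "mor_class C P X Y f = factor_through C P X Y +>\<^bsub>Hom C X Y\<^esub> f"

definition quot_lincat :: "('o,'m,'k,'z) lincat_scheme \<Rightarrow> 'o set \<Rightarrow> ('o,'m set,'k) lincat" where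
  "quot_lincat C P =
     \<lparr>Ob = Ob C,
      Hom = (\<lambda>X Y. quot_module (Hom C X Y) (factor_through C P X Y)),
      One = (\<lambda>X. mor_class C P X X (One C X)),
      Comp = (\<lambda>X Y Z g f. \<Union>b\<in>g. \<Union>a\<in>f. mor_class C P X Z (Comp C X Y Z b a))\<rparr>"

text \<open>
  Morphisms factoring through projective-injectives act as zero on \<open>Ext\<close>, so the images under
  \<open>the_elem\<close> below are singletons when \<open>P\<close> consists of projective-injective objects.
\<close>

definition quot_extcat :: "('o,'m,'k,'e) extcat \<Rightarrow> 'o set \<Rightarrow> ('o,'m set,'k,'e) extcat" where
  "quot_extcat C P = (let Q = quot_lincat C P in
     \<lparr>Ob = Ob Q, Hom = Hom Q, One = One Q, Comp = Comp Q,
      Ext = Ext C,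
      Push = (\<lambda>Z X X' a \<delta>. the_elem ((\<lambda>a'. Push C Z X X' a' \<delta>) ` a)),
      Pull = (\<lambda>Z' Z X c \<delta>. the_elem ((\<lambda>c'. Pull C Z' Z X c' \<delta>) ` c)),
      Rlz = (\<lambda>Z X \<delta>. {s. \<exists>B x y. (B,x,y) \<in> Rlz C Z X \<delta> \<and>
        seq_equiv Q X Z (B, mor_class C P X B x, mor_class C P B Z y) s})\<rparr>)"

definition stable :: "('o,'m,'k,'e) extcat \<Rightarrow> ('o,'m set,'k,'e) extcat" where
  "stable C = quot_extcat C (projectives C)"


subsection \<open>Exact categories and algebraic extriangulated categories\<close>

definition is_kernel :: "('o,'m,'k,'z) lincat_scheme \<Rightarrow> 'o \<Rightarrow> 'o \<Rightarrow> 'o \<Rightarrow> 'm \<Rightarrow> 'm \<Rightarrow> bool" where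
  "is_kernel C X B Z x y \<longleftrightarrow> Comp C X B Z y x = Zero C X Z \<and>
     (\<forall>W\<in>Ob C. \<forall>f\<in>Mor C W B. Comp C W B Z y f = Zero C W Z \<longrightarrow>
        (\<exists>!g. g \<in> Mor C W X \<and> Comp C W X B x g = f))"

definition is_cokernel :: "('o,'m,'k,'z) lincat_scheme \<Rightarrow> 'o \<Rightarrow> 'o \<Rightarrow> 'o \<Rightarrow> 'm \<Rightarrow> 'm \<Rightarrow> bool" where
  "is_cokernel C X B Z x y \<longleftrightarrow> Comp C X B Z y x = Zero C X Z \<and>
     (\<forall>W\<in>Ob C. \<forall>f\<in>Mor C B W. Comp C X B W f x = Zero C X W \<longrightarrow>
        (\<exists>!g. g \<in> Mor C Z W \<and> Comp C B Z W g y = f))"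

text \<open>The square \<open>X \<rightarrow> B \<rightarrow> B'\<close>, \<open>X \<rightarrow> X' \<rightarrow> B'\<close> with sides \<open>x, b\<close> and \<open>a, x'\<close> is a pushout.\<close>

definition is_pushout ::
  "('o,'m,'k,'z) lincat_scheme \<Rightarrow> 'o \<Rightarrow> 'o \<Rightarrow> 'o \<Rightarrow> 'o \<Rightarrow> 'm \<Rightarrow> 'm \<Rightarrow> 'm \<Rightarrow> 'm \<Rightarrow> bool" where
  "is_pushout C X B X' B' x b a x' \<longleftrightarrow> Comp C X B B' b x = Comp C X X' B' x' a \<and>
     (\<forall>W\<in>Ob C. \<forall>f\<in>Mor C B W. \<forall>g\<in>Mor C X' W. Comp C X B W f x = Comp C X X' W g a \<longrightarrow>
        (\<exists>!h. h \<in> Mor C B' W \<and> Comp C B B' W h b = f \<and> Comp C X' B' W h x' = g))"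

text \<open>The square \<open>B' \<rightarrow> B \<rightarrow> Z\<close>, \<open>B' \<rightarrow> Z' \<rightarrow> Z\<close> with sides \<open>b, y\<close> and \<open>y', c\<close> is a pullback.\<close>

definition is_pullback ::
  "('o,'m,'k,'z) lincat_scheme \<Rightarrow> 'o \<Rightarrow> 'o \<Rightarrow> 'o \<Rightarrow> 'o \<Rightarrow> 'm \<Rightarrow> 'm \<Rightarrow> 'm \<Rightarrow> 'm \<Rightarrow> bool" where
  "is_pullback C B' B Z' Z b y y' c \<longleftrightarrow> Comp C B' B Z y b = Comp C B' Z' Z c y' \<and>
     (\<forall>W\<in>Ob C. \<forall>f\<in>Mor C W B. \<forall>g\<in>Mor C W Z'. Comp C W B Z y f = Comp C W Z' Z c g \<longrightarrow>
        (\<exists>!h. h \<in> Mor C W B' \<and> Comp C W B' B b h = f \<and> Comp C W B' Z' y' h = g))"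

text \<open>Quillen's axioms for a class \<open>S\<close> of short exact sequences.\<close>

definition quillen_exact ::
  "('o,'m,'k,'z) lincat_scheme \<Rightarrow> ('o \<Rightarrow> 'o \<Rightarrow> 'o \<Rightarrow> 'm \<Rightarrow> 'm \<Rightarrow> bool) \<Rightarrow> bool" where
  "quillen_exact C S \<longleftrightarrow>
     (let mono = (\<lambda>X B x. \<exists>Z y. S X B Z x y); epi = (\<lambda>B Z y. \<exists>X x. S X B Z x y) in
     (\<forall>X B Z x y. S X B Z x y \<longrightarrow> X \<in> Ob C \<and> B \<in> Ob C \<and> Z \<in> Ob C \<and> x \<in> Mor C X B \<and> y \<in> Mor C B Z \<and>
        is_kernel C X B Z x y \<and> is_cokernel C X B Z x y) \<and>
     (\<forall>X B Z x y X' B' Z' x' y' a b c. S X B Z x y \<and>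
        X' \<in> Ob C \<and> B' \<in> Ob C \<and> Z' \<in> Ob C \<and> x' \<in> Mor C X' B' \<and> y' \<in> Mor C B' Z' \<and>
        iso_mor C X X' a \<and> iso_mor C B B' b \<and> iso_mor C Z Z' c \<and>
        Comp C X B B' b x = Comp C X X' B' x' a \<and> Comp C B Z Z' c y = Comp C B B' Z' y' b
        \<longrightarrow> S X' B' Z' x' y') \<and>
     (\<forall>X\<in>Ob C. mono X X (One C X) \<and> epi X X (One C X)) \<and>
     (\<forall>X Y Z f g. mono X Y f \<and> mono Y Z g \<longrightarrow> mono X Z (Comp C X Y Z g f)) \<and>
     (\<forall>X Y Z f g. epi X Y f \<and> epi Y Z g \<longrightarrow> epi X Z (Comp C X Y Z g f)) \<and>
     (\<forall>X B X' x a. mono X B x \<and> X' \<in> Ob C \<and> a \<in> Mor C X X' \<longrightarrow>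
        (\<exists>B'\<in>Ob C. \<exists>b\<in>Mor C B B'. \<exists>x'\<in>Mor C X' B'.
           is_pushout C X B X' B' x b a x' \<and> mono X' B' x')) \<and>
     (\<forall>B Z Z' y c. epi B Z y \<and> Z' \<in> Ob C \<and> c \<in> Mor C Z' Z \<longrightarrow>
        (\<exists>B'\<in>Ob C. \<exists>b\<in>Mor C B' B. \<exists>y'\<in>Mor C B' Z'.
           is_pullback C B' B Z' Z b y y' c \<and> epi B' Z' y')))"

text \<open>
  An exact category carrying its standard extriangulated structure: by injectivity of the
  realisation, extensions are equivalence classes of short exact sequences, and the axioms of an
  extriangulated category then force the pushout and pullback actions and the Baer sum.
\<close>

definition exact_category :: "'k ring \<Rightarrow> ('o,'m,'k,'e) extcat \<Rightarrow> bool" where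
  "exact_category K E \<longleftrightarrow> extriangulated_category K E \<and> quillen_exact E (conflation E) \<and>
     (\<forall>Z\<in>Ob E. \<forall>X\<in>Ob E. inj_on (Rlz E Z X) (carrier (Ext E Z X)))"

definition extriangulated_equivalent ::
  "'k ring \<Rightarrow> ('o,'m,'k,'e) extcat \<Rightarrow> ('p,'n,'k,'d) extcat \<Rightarrow> bool" where
  "extriangulated_equivalent K C D \<longleftrightarrow> (\<exists>F Fm \<phi>. equivalence_functor K C D F Fm \<and>
     (\<forall>Z\<in>Ob C. \<forall>X\<in>Ob C. lin_bij K (Ext C Z X) (Ext D (F Z) (F X)) (\<phi> Z X)) \<and>
     (\<forall>Z\<in>Ob C. \<forall>X\<in>Ob C. \<forall>X'\<in>Ob C. \<forall>a\<in>Mor C X X'. \<forall>\<delta>\<in>carrier (Ext C Z X).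
        \<phi> Z X' (Push C Z X X' a \<delta>) = Push D (F Z) (F X) (F X') (Fm X X' a) (\<phi> Z X \<delta>)) \<and>
     (\<forall>Z\<in>Ob C. \<forall>Z'\<in>Ob C. \<forall>X\<in>Ob C. \<forall>c\<in>Mor C Z' Z. \<forall>\<delta>\<in>carrier (Ext C Z X).
        \<phi> Z' X (Pull C Z' Z X c \<delta>) = Pull D (F Z') (F Z) (F X) (Fm Z' Z c) (\<phi> Z X \<delta>)) \<and>
     (\<forall>Z\<in>Ob C. \<forall>X\<in>Ob C. \<forall>\<delta>\<in>carrier (Ext C Z X). \<forall>B x y. (B,x,y) \<in> Rlz C Z X \<delta> \<longrightarrow>
        (F B, Fm X B x, Fm B Z y) \<in> Rlz D (F Z) (F X) (\<phi> Z X \<delta>)))"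

text \<open>
  The first argument only names the types of objects, morphisms and extensions of the exact
  category, since HOL cannot quantify over types inside a definition.
\<close>

definition algebraic ::
  "('p \<times> 'n \<times> 'd) itself \<Rightarrow> 'k ring \<Rightarrow> ('o,'m,'k,'e) extcat \<Rightarrow> bool" where
  "algebraic ty K C \<longleftrightarrow> (\<exists>(E :: ('p,'n,'k,'d) extcat) P. exact_category K E \<and>
     additively_closed E P \<and> P \<subseteq> projectives E \<inter> injectives E \<and>
     extriangulated_equivalent K C (quot_extcat E P))"


section \<open>Cluster categories\<close>

definition cluster_tilting :: "('o,'m,'k,'e) extcat \<Rightarrow> 'o set \<Rightarrow> bool" where
  "cluster_tilting C T \<longleftrightarrow> T \<subseteq> Ob C \<and>
     T = {X \<in> Ob C. \<forall>R\<in>T. carrier (Ext C R X) = {\<zero>\<^bsub>Ext C R X\<^esub>}} \<and>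
     T = {X \<in> Ob C. \<forall>R\<in>T. carrier (Ext C X R) = {\<zero>\<^bsub>Ext C X R\<^esub>}} \<and>
     (\<forall>X\<in>Ob C. \<exists>L\<in>T. \<exists>f\<in>Mor C X L. inflation C X L f \<and>
        (\<forall>R\<in>T. \<forall>g\<in>Mor C X R. \<exists>h\<in>Mor C L R. g = Comp C X L R h f)) \<and>
     (\<forall>X\<in>Ob C. \<exists>R\<in>T. \<exists>f\<in>Mor C R X. deflation C R X f \<and>
        (\<forall>L\<in>T. \<forall>g\<in>Mor C L X. \<exists>h\<in>Mor C L R. g = Comp C L R X f h))"

text \<open>
  A suspension functor \<open>(S, Sm)\<close> of a triangulated category: \<open>\<delta> X\<close> is the extension with
  triangle \<open>X \<rightarrow> 0 \<rightarrow> S X\<close>, and the identification of \<open>Ext(Z, X)\<close> with \<open>Hom(Z, S X)\<close> by pulling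
  back \<open>\<delta> X\<close> is natural in \<open>X\<close>.
\<close>

definition suspension ::
  "'k ring \<Rightarrow> ('o,'m,'k,'e) extcat \<Rightarrow> ('o \<Rightarrow> 'o) \<Rightarrow> ('o \<Rightarrow> 'o \<Rightarrow> 'm \<Rightarrow> 'm) \<Rightarrow> bool" where
  "suspension K D S Sm \<longleftrightarrow> linear_functor K D D S Sm \<and>
     (\<exists>\<delta>. (\<forall>X\<in>Ob D. \<delta> X \<in> carrier (Ext D (S X) X) \<and>
               (\<exists>N x y. zero_obj D N \<and> (N,x,y) \<in> Rlz D (S X) X (\<delta> X))) \<and>
          (\<forall>X\<in>Ob D. \<forall>Y\<in>Ob D. \<forall>f\<in>Mor D X Y.
               Push D (S X) X Y f (\<delta> X) = Pull D (S X) (S Y) Y (Sm X Y f) (\<delta> Y)))"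

definition two_calabi_yau :: "'k ring \<Rightarrow> ('o,'m,'k,'e) extcat \<Rightarrow> bool" where
  "two_calabi_yau K D \<longleftrightarrow> (\<exists>S Sm \<phi>. suspension K D S Sm \<and>
     (\<forall>X\<in>Ob D. \<forall>Y\<in>Ob D.
        lin_bij K (Hom D X Y) (dual_module K (Hom D Y (S (S X)))) (\<phi> X Y)) \<and>
     (\<forall>X\<in>Ob D. \<forall>Y\<in>Ob D. \<forall>X'\<in>Ob D. \<forall>Y'\<in>Ob D.
      \<forall>f\<in>Mor D X' X. \<forall>u\<in>Mor D X Y. \<forall>h\<in>Mor D Y Y'. \<forall>v\<in>Mor D Y' (S (S X')).
        \<phi> X' Y' (Comp D X' Y Y' h (Comp D X' X Y u f)) v =
        \<phi> X Y u (Comp D Y (S (S X')) (S (S X)) (Sm (S X') (S X) (Sm X' X f))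
                   (Comp D Y Y' (S (S X')) v h))))"

definition cluster_category ::
  "('p \<times> 'n \<times> 'd) itself \<Rightarrow> 'k ring \<Rightarrow> ('o,'m,'k,'e) extcat \<Rightarrow> bool" where
  "cluster_category ty K C \<longleftrightarrow> extriangulated_category K C \<and> idempotent_complete C \<and>
     algebraic ty K C \<and> frobenius C \<and> (\<exists>T. cluster_tilting C T) \<and>
     hom_finite K (stable C) \<and> two_calabi_yau K (stable C)"


section \<open>Compact and skew-symmetric categories\<close>

definition rad :: "('o,'m,'k,'z) lincat_scheme \<Rightarrow> 'o \<Rightarrow> 'o \<Rightarrow> 'm set" where
  "rad C X Y = {f \<in> Mor C X Y. \<forall>g\<in>Mor C Y X.
     iso_mor C X X (One C X \<ominus>\<^bsub>Hom C X X\<^esub> Comp C X Y X g f)}"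

primrec rad_pow :: "('o,'m,'k,'z) lincat_scheme \<Rightarrow> nat \<Rightarrow> 'o \<Rightarrow> 'o \<Rightarrow> 'm set" where
  "rad_pow C 0 = (\<lambda>X Y. Mor C X Y)"
| "rad_pow C (Suc n) = (\<lambda>X Y. generate (add_monoid (Hom C X Y))
     {Comp C X Z Y g f | Z f g. Z \<in> Ob C \<and> f \<in> rad_pow C n X Z \<and> g \<in> rad C Z Y})"

text \<open>
  The underlying space of \<open>D\<^sub>X\<close> (passing to the opposite ring does not change it). The
  radical of the ring \<open>End(X)\<close> is the radical ideal of the category at \<open>(X, X)\<close>.
\<close>

definition D_space :: "('o,'m,'k,'z) lincat_scheme \<Rightarrow> 'o \<Rightarrow> ('k,'m set) module" where
  "D_space C X = quot_module (Hom C X X) (rad C X X)"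

text \<open>Topological vector spaces over \<open>K\<close> with the discrete topology.\<close>

definition topological_vs :: "'k ring \<Rightarrow> ('k,'v) module \<Rightarrow> 'v topology \<Rightarrow> bool" where
  "topological_vs K V \<tau> \<longleftrightarrow> topspace \<tau> = carrier V \<and>
     continuous_map (prod_topology \<tau> \<tau>) \<tau> (\<lambda>(x,y). x \<oplus>\<^bsub>V\<^esub> y) \<and>
     continuous_map (prod_topology (discrete_topology (carrier K)) \<tau>) \<tau> (\<lambda>(k,x). k \<odot>\<^bsub>V\<^esub> x)"

text \<open>\<open>inverse_limit V \<U>\<close> is the limit of the system of quotients \<open>V/U\<close>, \<open>U \<in> \<U>\<close>, as a space of
  compatible families of cosets.\<close>

definition inverse_limit :: "('k,'v) module \<Rightarrow> 'v set set \<Rightarrow> ('v set \<Rightarrow> 'v set) topology" where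
  "inverse_limit V \<U> = subtopology
     (product_topology (\<lambda>U. discrete_topology (a_rcosets\<^bsub>V\<^esub> U)) \<U>)
     {c. \<forall>U\<in>\<U>. \<forall>U'\<in>\<U>. U \<subseteq> U' \<longrightarrow> c U \<subseteq> c U'}"

definition pseudocompact_vs :: "'k ring \<Rightarrow> ('k,'v) module \<Rightarrow> 'v topology \<Rightarrow> bool" where
  "pseudocompact_vs K V \<tau> \<longleftrightarrow> topological_vs K V \<tau> \<and> Hausdorff_space \<tau> \<and>
     (\<exists>\<U>. \<U> \<noteq> {} \<and> (\<forall>U\<in>\<U>. \<forall>U'\<in>\<U>. \<exists>U''\<in>\<U>. U'' \<subseteq> U \<inter> U') \<and>
        (\<forall>U\<in>\<U>. submodule U K V \<and> openin \<tau> U \<and> finite_dim K (quot_module V U)) \<and>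
        homeomorphic_map \<tau> (inverse_limit V \<U>) (\<lambda>x. \<lambda>U\<in>\<U>. U +>\<^bsub>V\<^esub> x))"

definition pseudocompact_wrt ::
  "'k ring \<Rightarrow> ('o,'m,'k,'z) lincat_scheme \<Rightarrow> ('o \<Rightarrow> 'o \<Rightarrow> 'm topology) \<Rightarrow> bool" where
  "pseudocompact_wrt K C \<tau> \<longleftrightarrow>
     (\<forall>X\<in>Ob C. \<forall>Y\<in>Ob C. pseudocompact_vs K (Hom C X Y) (\<tau> X Y)) \<and>
     (\<forall>X\<in>Ob C. \<forall>Y\<in>Ob C. \<forall>Z\<in>Ob C.
        continuous_map (prod_topology (\<tau> Y Z) (\<tau> X Y)) (\<tau> X Z) (\<lambda>(g,f). Comp C X Y Z g f))"

definition pseudocompact :: "'k ring \<Rightarrow> ('o,'m,'k,'z) lincat_scheme \<Rightarrow> bool" where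
  "pseudocompact K C \<longleftrightarrow> (\<exists>\<tau>. pseudocompact_wrt K C \<tau>)"

definition rad_topology :: "('o,'m,'k,'z) lincat_scheme \<Rightarrow> 'o \<Rightarrow> 'o \<Rightarrow> 'm topology" where
  "rad_topology C X Y =
     topology_generated_by {rad_pow C n X Y +>\<^bsub>Hom C X Y\<^esub> f | n f. f \<in> Mor C X Y}"

definition radically_pseudocompact :: "'k ring \<Rightarrow> ('o,'m,'k,'z) lincat_scheme \<Rightarrow> bool" where
  "radically_pseudocompact K C \<longleftrightarrow> pseudocompact_wrt K C (rad_topology C)"

definition compact_category :: "'k ring \<Rightarrow> ('o,'m,'k,'e) extcat \<Rightarrow> bool" where
  "compact_category K C \<longleftrightarrow> pseudocompact K C \<and>
     (\<forall>X\<in>Ob C. finite_dim K (D_space C X)) \<and>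
     (\<forall>T. cluster_tilting C T \<longrightarrow> radically_pseudocompact K (full_sub C T))"

definition local_End :: "('o,'m,'k,'z) lincat_scheme \<Rightarrow> 'o \<Rightarrow> bool" where
  "local_End C X \<longleftrightarrow> One C X \<noteq> Zero C X X \<and>
     (\<forall>f\<in>Mor C X X. \<forall>g\<in>Mor C X X. \<not> iso_mor C X X f \<and> \<not> iso_mor C X X g \<longrightarrow>
        \<not> iso_mor C X X (f \<oplus>\<^bsub>Hom C X X\<^esub> g))"

definition is_direct_sum :: "('o,'m,'k,'z) lincat_scheme \<Rightarrow> 'o \<Rightarrow> 'o list \<Rightarrow> bool" where
  "is_direct_sum C X Xs \<longleftrightarrow> (\<exists>i p.
     (\<forall>a<length Xs. i a \<in> Mor C (Xs ! a) X \<and> p a \<in> Mor C X (Xs ! a)) \<and>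
     (\<forall>a<length Xs. \<forall>b<length Xs. Comp C (Xs ! b) X (Xs ! a) (p a) (i b) =
        (if a = b then One C (Xs ! a) else Zero C (Xs ! b) (Xs ! a))) \<and>
     (\<Oplus>\<^bsub>Hom C X X\<^esub>a\<in>{..<length Xs}. Comp C X (Xs ! a) X (i a) (p a)) = One C X)"

definition krull_schmidt :: "('o,'m,'k,'z) lincat_scheme \<Rightarrow> bool" where
  "krull_schmidt C \<longleftrightarrow>
     (\<forall>X\<in>Ob C. \<exists>Xs. set Xs \<subseteq> Ob C \<and> (\<forall>Y\<in>set Xs. local_End C Y) \<and> is_direct_sum C X Xs)"

definition indecomposable :: "('o,'m,'k,'z) lincat_scheme \<Rightarrow> 'o \<Rightarrow> bool" where
  "indecomposable C X \<longleftrightarrow> X \<in> Ob C \<and> \<not> zero_obj C X \<and>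
     (\<forall>A B i j p q. biproduct C A B X i j p q \<longrightarrow> zero_obj C A \<or> zero_obj C B)"

definition skew_symmetric :: "'k ring \<Rightarrow> ('o,'m,'k,'z) lincat_scheme \<Rightarrow> bool" where
  "skew_symmetric K C \<longleftrightarrow> krull_schmidt C \<and> (\<forall>X. indecomposable C X \<longrightarrow> has_dim K (D_space C X) 1)"


section \<open>Modules over a linear category\<close>

text \<open>\<open>MMor M X Y f\<close> is the map from \<open>MOb M Y\<close> to \<open>MOb M X\<close> induced by \<open>f : X \<rightarrow> Y\<close>.\<close>

record ('o,'m,'k,'v) catmod =
  MOb :: "'o \<Rightarrow> ('k,'v) module"
  MMor :: "'o \<Rightarrow> 'o \<Rightarrow> 'm \<Rightarrow> 'v \<Rightarrow> 'v"

definition is_catmod :: "'k ring \<Rightarrow> ('o,'m,'k,'z) lincat_scheme \<Rightarrow> ('o,'m,'k,'v) catmod \<Rightarrow> bool" where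
  "is_catmod K A M \<longleftrightarrow>
     (\<forall>X\<in>Ob A. Module.module K (MOb M X)) \<and>
     (\<forall>X\<in>Ob A. \<forall>Y\<in>Ob A. \<forall>f\<in>Mor A X Y. lin_map K (MOb M Y) (MOb M X) (MMor M X Y f)) \<and>
     (\<forall>X\<in>Ob A. \<forall>Y\<in>Ob A. \<forall>u\<in>carrier (MOb M Y).
        lin_map K (Hom A X Y) (MOb M X) (\<lambda>f. MMor M X Y f u)) \<and>
     (\<forall>X\<in>Ob A. \<forall>u\<in>carrier (MOb M X). MMor M X X (One A X) u = u) \<and>
     (\<forall>X\<in>Ob A. \<forall>Y\<in>Ob A. \<forall>Z\<in>Ob A. \<forall>f\<in>Mor A X Y. \<forall>g\<in>Mor A Y Z. \<forall>u\<in>carrier (MOb M Z).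
        MMor M X Z (Comp A X Y Z g f) u = MMor M X Y f (MMor M Y Z g u))"

definition catmod_hom ::
  "'k ring \<Rightarrow> ('o,'m,'k,'z) lincat_scheme \<Rightarrow> ('o,'m,'k,'v) catmod \<Rightarrow> ('o,'m,'k,'w) catmod \<Rightarrow>
   ('o \<Rightarrow> 'v \<Rightarrow> 'w) \<Rightarrow> bool" where
  "catmod_hom K A M N \<eta> \<longleftrightarrow>
     (\<forall>X\<in>Ob A. lin_map K (MOb M X) (MOb N X) (\<eta> X)) \<and>
     (\<forall>X\<in>Ob A. \<forall>Y\<in>Ob A. \<forall>f\<in>Mor A X Y. \<forall>u\<in>carrier (MOb M Y).
        \<eta> X (MMor M X Y f u) = MMor N X Y f (\<eta> Y u))"

definition catmod_iso ::
  "'k ring \<Rightarrow> ('o,'m,'k,'z) lincat_scheme \<Rightarrow> ('o,'m,'k,'v) catmod \<Rightarrow> ('o,'m,'k,'w) catmod \<Rightarrow> bool" where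
  "catmod_iso K A M N \<longleftrightarrow> (\<exists>\<eta>. catmod_hom K A M N \<eta> \<and>
     (\<forall>X\<in>Ob A. bij_betw (\<eta> X) (carrier (MOb M X)) (carrier (MOb N X))))"

definition short_exact ::
  "'k ring \<Rightarrow> ('o,'m,'k,'z) lincat_scheme \<Rightarrow> ('o,'m,'k,'u) catmod \<Rightarrow> ('o,'m,'k,'v) catmod \<Rightarrow>
   ('o,'m,'k,'w) catmod \<Rightarrow> bool" where
  "short_exact K A M' M M'' \<longleftrightarrow> (\<exists>\<eta> \<theta>. catmod_hom K A M' M \<eta> \<and> catmod_hom K A M M'' \<theta> \<and>
     (\<forall>X\<in>Ob A. inj_on (\<eta> X) (carrier (MOb M' X)) \<and>
        \<eta> X ` carrier (MOb M' X) = {u \<in> carrier (MOb M X). \<theta> X u = \<zero>\<^bsub>MOb M'' X\<^esub>} \<and>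
        \<theta> X ` carrier (MOb M X) = carrier (MOb M'' X)))"

definition representable :: "('o,'m,'k,'z) lincat_scheme \<Rightarrow> 'o \<Rightarrow> ('o,'m,'k,'m) catmod" where
  "representable A Y = \<lparr>MOb = (\<lambda>X. Hom A X Y), MMor = (\<lambda>X X' f u. Comp A X X' Y u f)\<rparr>"

text \<open>There is an exact sequence \<open>Hom(-,R') \<rightarrow> Hom(-,R) \<rightarrow> M \<rightarrow> 0\<close>, whose first map is
  composition with \<open>f\<close> by the Yoneda lemma.\<close>

definition finitely_presented ::
  "'k ring \<Rightarrow> ('o,'m,'k,'z) lincat_scheme \<Rightarrow> ('o,'m,'k,'v) catmod \<Rightarrow> bool" where
  "finitely_presented K A M \<longleftrightarrow> is_catmod K A M \<and>
     (\<exists>R'\<in>Ob A. \<exists>R\<in>Ob A. \<exists>f\<in>Mor A R' R. \<exists>\<pi>. catmod_hom K A (representable A R) M \<pi> \<and>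
        (\<forall>X\<in>Ob A. \<pi> X ` Mor A X R = carrier (MOb M X) \<and>
           {u \<in> Mor A X R. \<pi> X u = \<zero>\<^bsub>MOb M X\<^esub>} = Comp A X R' R f ` Mor A X R'))"

definition ker_catmod ::
  "('o,'m,'k,'v) catmod \<Rightarrow> ('o,'m,'k,'w) catmod \<Rightarrow> ('o \<Rightarrow> 'v \<Rightarrow> 'w) \<Rightarrow> ('o,'m,'k,'v) catmod" where
  "ker_catmod M N \<eta> =
     \<lparr>MOb = (\<lambda>X. (MOb M X)\<lparr>carrier := {u \<in> carrier (MOb M X). \<eta> X u = \<zero>\<^bsub>MOb N X\<^esub>}\<rparr>),
      MMor = MMor M\<rparr>"

definition coker_catmod ::
  "('o,'m,'k,'v) catmod \<Rightarrow> ('o,'m,'k,'w) catmod \<Rightarrow> ('o \<Rightarrow> 'v \<Rightarrow> 'w) \<Rightarrow> ('o,'m,'k,'w set) catmod" where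
  "coker_catmod M N \<eta> =
     \<lparr>MOb = (\<lambda>X. quot_module (MOb N X) (\<eta> X ` carrier (MOb M X))),
      MMor = (\<lambda>X Y f u. \<Union>a\<in>u. (\<eta> X ` carrier (MOb M X)) +>\<^bsub>MOb N X\<^esub> MMor N X Y f a)\<rparr>"


section \<open>Grothendieck groups\<close>

text \<open>The abelian group (written multiplicatively) with generators \<open>S\<close> and relators \<open>R\<close>.\<close>

definition presented_group :: "'a set \<Rightarrow> ('a \<Rightarrow>\<^sub>0 int) set \<Rightarrow> ('a \<Rightarrow>\<^sub>0 int) set monoid" where
  "presented_group S R = free_Abelian_group S Mod generate (free_Abelian_group S) R"

definition presented_class :: "'a set \<Rightarrow> ('a \<Rightarrow>\<^sub>0 int) set \<Rightarrow> 'a \<Rightarrow> ('a \<Rightarrow>\<^sub>0 int) set" where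
  "presented_class S R a = generate (free_Abelian_group S) R #>\<^bsub>free_Abelian_group S\<^esub> frag_of a"

definition group_diff :: "('a,'b) monoid_scheme \<Rightarrow> 'a \<Rightarrow> 'a \<Rightarrow> 'a" where
  "group_diff G x y = x \<otimes>\<^bsub>G\<^esub> inv\<^bsub>G\<^esub> y"

definition split_relators :: "('o,'m,'k,'z) lincat_scheme \<Rightarrow> ('o \<Rightarrow>\<^sub>0 int) set" where
  "split_relators A =
     {frag_of S - frag_of X - frag_of Y | S X Y. \<exists>i j p q. biproduct A X Y S i j p q}"

definition K0_split :: "('o,'m,'k,'z) lincat_scheme \<Rightarrow> ('o \<Rightarrow>\<^sub>0 int) set monoid" where
  "K0_split A = presented_group (Ob A) (split_relators A)"

definition obj_class :: "('o,'m,'k,'z) lincat_scheme \<Rightarrow> 'o \<Rightarrow> ('o \<Rightarrow>\<^sub>0 int) set" where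
  "obj_class A X = presented_class (Ob A) (split_relators A) X"

text \<open>
  Every finitely presented \<open>A\<close>-module, with values of any type, is isomorphic to a cokernel of a
  map between representable modules, whose elements are sets of morphisms. So the modules
  with elements of type \<open>'m set\<close> already represent all isomorphism classes in \<open>mod A\<close>.
\<close>

definition fp_modules :: "'k ring \<Rightarrow> ('o,'m,'k,'z) lincat_scheme \<Rightarrow> ('o,'m,'k,'m set) catmod set" where
  "fp_modules K A = {M. finitely_presented K A M}"

definition exact_relators ::
  "'k ring \<Rightarrow> ('o,'m,'k,'z) lincat_scheme \<Rightarrow> (('o,'m,'k,'m set) catmod \<Rightarrow>\<^sub>0 int) set" where
  "exact_relators K A =
     {frag_of M - frag_of M' - frag_of M'' | M M' M''. M \<in> fp_modules K A \<and>
        M' \<in> fp_modules K A \<and> M'' \<in> fp_modules K A \<and> short_exact K A M' M M''}"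

definition K0_mod ::
  "'k ring \<Rightarrow> ('o,'m,'k,'z) lincat_scheme \<Rightarrow> (('o,'m,'k,'m set) catmod \<Rightarrow>\<^sub>0 int) set monoid" where
  "K0_mod K A = presented_group (fp_modules K A) (exact_relators K A)"

definition mod_class ::
  "'k ring \<Rightarrow> ('o,'m,'k,'z) lincat_scheme \<Rightarrow> ('o,'m,'k,'v) catmod \<Rightarrow>
   (('o,'m,'k,'m set) catmod \<Rightarrow>\<^sub>0 int) set" where
  "mod_class K A M = presented_class (fp_modules K A) (exact_relators K A)
     (SOME N. N \<in> fp_modules K A \<and> catmod_iso K A M N)"


section \<open>Index, coindex and the associated maps\<close>

definition index_conflation :: "('o,'m,'k,'e) extcat \<Rightarrow> 'o set \<Rightarrow> 'o \<Rightarrow> 'o \<times> 'o \<times> 'm \<times> 'm" where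
  "index_conflation C T X =
     (SOME (L,R,i,p). L \<in> T \<and> R \<in> T \<and> conflation C L R X i p)"

definition coindex_conflation :: "('o,'m,'k,'e) extcat \<Rightarrow> 'o set \<Rightarrow> 'o \<Rightarrow> 'o \<times> 'o \<times> 'm \<times> 'm" where
  "coindex_conflation C T X =
     (SOME (L,R,i,p). L \<in> T \<and> R \<in> T \<and> conflation C X L R i p)"

definition ind :: "('o,'m,'k,'e) extcat \<Rightarrow> 'o set \<Rightarrow> 'o \<Rightarrow> ('o \<Rightarrow>\<^sub>0 int) set" where
  "ind C T X = (case index_conflation C T X of (L,R,i,p) \<Rightarrow>
     group_diff (K0_split (full_sub C T)) (obj_class (full_sub C T) R) (obj_class (full_sub C T) L))"

definition coind :: "('o,'m,'k,'e) extcat \<Rightarrow> 'o set \<Rightarrow> 'o \<Rightarrow> ('o \<Rightarrow>\<^sub>0 int) set" where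
  "coind C T X = (case coindex_conflation C T X of (L,R,i,p) \<Rightarrow>
     group_diff (K0_split (full_sub C T)) (obj_class (full_sub C T) L) (obj_class (full_sub C T) R))"

text \<open>The image of \<open>T\<close> in the stable category.\<close>

definition stable_sub :: "('o,'m,'k,'e) extcat \<Rightarrow> 'o set \<Rightarrow> ('o,'m set,'k,'e) extcat" where
  "stable_sub C T = full_sub (stable C) T"

text \<open>
  \<open>ext_mod C X\<close> is \<open>Ext(-,X)\<close> as a module over the stable category; read as a
  \<open>stable_sub C T\<close>-module it is \<open>E\<^sup>T X\<close>.
\<close>

definition ext_mod :: "('o,'m,'k,'e) extcat \<Rightarrow> 'o \<Rightarrow> ('o,'m set,'k,'e) catmod" where
  "ext_mod C X =
     \<lparr>MOb = (\<lambda>Y. Ext (stable C) Y X), MMor = (\<lambda>Y Y' f \<delta>. Pull (stable C) Y Y' X f \<delta>)\<rparr>"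

definition ext_map :: "('o,'m,'k,'e) extcat \<Rightarrow> 'o \<Rightarrow> 'o \<Rightarrow> 'm \<Rightarrow> 'o \<Rightarrow> 'e \<Rightarrow> 'e" where
  "ext_map C X Y f = (\<lambda>Z. Push C Z X Y f)"

definition l1 :: "('o,'m,'k,'e) extcat \<Rightarrow> 'o set \<Rightarrow> 'o \<Rightarrow> ('o,'m set,'k,'e) catmod" where
  "l1 C U X = (case coindex_conflation C U X of (L,R,i,p) \<Rightarrow>
     ker_catmod (ext_mod C X) (ext_mod C L) (ext_map C X L i))"

definition l2 :: "('o,'m,'k,'e) extcat \<Rightarrow> 'o set \<Rightarrow> 'o \<Rightarrow> ('o,'m set,'k,'e set) catmod" where
  "l2 C U X = (case coindex_conflation C U X of (L,R,i,p) \<Rightarrow>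
     coker_catmod (ext_mod C L) (ext_mod C R) (ext_map C L R p))"

definition r1 :: "('o,'m,'k,'e) extcat \<Rightarrow> 'o set \<Rightarrow> 'o \<Rightarrow> ('o,'m set,'k,'e) catmod" where
  "r1 C U X = (case index_conflation C U X of (L,R,i,p) \<Rightarrow>
     ker_catmod (ext_mod C L) (ext_mod C R) (ext_map C L R i))"

definition r2 :: "('o,'m,'k,'e) extcat \<Rightarrow> 'o set \<Rightarrow> 'o \<Rightarrow> ('o,'m set,'k,'e set) catmod" where
  "r2 C U X = (case index_conflation C U X of (L,R,i,p) \<Rightarrow>
     coker_catmod (ext_mod C R) (ext_mod C X) (ext_map C R X p))"

text \<open>
  Each of the following predicates says that a map is the homomorphism of Grothendieck groups with
  prescribed values on generators. The generators generate, so for a cluster category the map is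
  unique on the carrier of its source; off the carrier its values are arbitrary.
\<close>

definition is_ind_map ::
  "('o,'m,'k,'e) extcat \<Rightarrow> 'o set \<Rightarrow> 'o set \<Rightarrow> (('o \<Rightarrow>\<^sub>0 int) set \<Rightarrow> ('o \<Rightarrow>\<^sub>0 int) set) \<Rightarrow> bool" where
  "is_ind_map C U T h \<longleftrightarrow> h \<in> hom (K0_split (full_sub C U)) (K0_split (full_sub C T)) \<and>
     (\<forall>X\<in>U. h (obj_class (full_sub C U) X) = ind C T X)"

definition is_coind_map ::
  "('o,'m,'k,'e) extcat \<Rightarrow> 'o set \<Rightarrow> 'o set \<Rightarrow> (('o \<Rightarrow>\<^sub>0 int) set \<Rightarrow> ('o \<Rightarrow>\<^sub>0 int) set) \<Rightarrow> bool" where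
  "is_coind_map C U T h \<longleftrightarrow> h \<in> hom (K0_split (full_sub C U)) (K0_split (full_sub C T)) \<and>
     (\<forall>X\<in>U. h (obj_class (full_sub C U) X) = coind C T X)"

definition is_beta ::
  "'k ring \<Rightarrow> ('o,'m,'k,'e) extcat \<Rightarrow> 'o set \<Rightarrow>
   ((('o,'m set,'k,'m set set) catmod \<Rightarrow>\<^sub>0 int) set \<Rightarrow> ('o \<Rightarrow>\<^sub>0 int) set) \<Rightarrow> bool" where
  "is_beta K C T h \<longleftrightarrow> h \<in> hom (K0_mod K (stable_sub C T)) (K0_split (full_sub C T)) \<and>
     (\<forall>X\<in>Ob C. h (mod_class K (stable_sub C T) (ext_mod C X)) =
        group_diff (K0_split (full_sub C T)) (coind C T X) (ind C T X))"

definition is_Ind_bar ::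
  "'k ring \<Rightarrow> ('o,'m,'k,'e) extcat \<Rightarrow> 'o set \<Rightarrow> 'o set \<Rightarrow>
   ((('o,'m set,'k,'m set set) catmod \<Rightarrow>\<^sub>0 int) set \<Rightarrow>
    (('o,'m set,'k,'m set set) catmod \<Rightarrow>\<^sub>0 int) set) \<Rightarrow> bool" where
  "is_Ind_bar K C U T h \<longleftrightarrow> h \<in> hom (K0_mod K (stable_sub C U)) (K0_mod K (stable_sub C T)) \<and>
     (\<forall>X\<in>Ob C. h (mod_class K (stable_sub C U) (ext_mod C X)) =
        group_diff (K0_mod K (stable_sub C T))
          (mod_class K (stable_sub C T) (l1 C U X)) (mod_class K (stable_sub C T) (r1 C U X)))"

definition is_Coind_bar ::
  "'k ring \<Rightarrow> ('o,'m,'k,'e) extcat \<Rightarrow> 'o set \<Rightarrow> 'o set \<Rightarrow>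
   ((('o,'m set,'k,'m set set) catmod \<Rightarrow>\<^sub>0 int) set \<Rightarrow>
    (('o,'m set,'k,'m set set) catmod \<Rightarrow>\<^sub>0 int) set) \<Rightarrow> bool" where
  "is_Coind_bar K C U T h \<longleftrightarrow> h \<in> hom (K0_mod K (stable_sub C U)) (K0_mod K (stable_sub C T)) \<and>
     (\<forall>X\<in>Ob C. h (mod_class K (stable_sub C U) (ext_mod C X)) =
        group_diff (K0_mod K (stable_sub C T))
          (mod_class K (stable_sub C T) (r2 C U X)) (mod_class K (stable_sub C T) (l2 C U X)))"

end

theory Submission
  imports Defs
begin

text \<open>
  Let \<open>X \<rightarrow> Y \<rightarrow> Z\<close> be a conflation with class \<open>\<delta>\<close>. Two octahedra produce objects \<open>E\<close> and \<open>E'\<close> with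
  \<open>E\<^sup>T E\<close> isomorphic to the kernel of \<open>Ext(-,X) \<rightarrow> Ext(-,Y)\<close> on \<open>T\<close> and \<open>coind E - ind E = ind Y - ind X - ind Z\<close>,
  respectively with \<open>E\<^sup>T E'\<close> isomorphic to the cokernel of \<open>Ext(-,Y) \<rightarrow> Ext(-,Z)\<close> on \<open>T\<close> and
  \<open>coind E' - ind E' = coind X + coind Z - coind Y\<close>. So \<open>\<beta>\<^sub>T\<close> of these kernels and cokernels
  measures the failure of index and coindex to be additive. Applied to the two conflations
  defining \<open>ind\<^sub>U X\<close> and \<open>coind\<^sub>U X\<close>, whose other terms lie in \<open>U\<close>, the contributions of \<open>X\<close> itself cancel
  in the difference, which leaves the claim on the classes of the modules \<open>E\<^sup>U X\<close>; these generate.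

  For \<open>E\<close>, pull \<open>\<delta>\<close> back along a \<open>T\<close>-approximation \<open>R \<rightarrow> Z\<close>, let \<open>M\<close> realise the result, and take the kernel
  of \<open>R' \<rightarrow> M \<rightarrow> R\<close> for a \<open>T\<close>-approximation \<open>R' \<rightarrow> M\<close>. For \<open>E'\<close>, embed \<open>Y\<close> in an injective \<open>I\<close> with
  cokernel \<open>Y1\<close>, push the extension of \<open>Y1\<close> by \<open>Y\<close> forward to \<open>Z\<close>, and pull the result back along a
  \<open>T\<close>-approximation of \<open>Y1\<close>.
\<close>

section \<open>Linear maps and linear categories\<close>

text \<open>The homomorphisms on Grothendieck groups are given by their values on classes of modules
  Ext(-,E), whereas the theorem speaks of kernels and cokernels. This is why objects E and E' are
  needed at all, and why their indices are computed along with the isomorphisms. Kernels and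
  cokernels are not exchanged by duality: the opposite category turns Ext(-,X) into Ext(X,-), so the
  exact sequences and the calculus of indices dualise, but the two constructions do not. Nor is
  there an Ext^2 at hand to receive the cokernel of Ext(-,Y) -> Ext(-,Z). The injective I supplies
  the shift: if X1 completes X -> Y -> I, there is a conflation Z -> X1 -> Y1, and on T the module
  of E' is isomorphic to the image of Ext(-,Z) in Ext(-,X1). In both cases the approximation R does
  the decisive work. Maps from T to Z (or to Y1) factor through R, so pulling a class back to R
  loses no extension of an object of T, while the new conflations acquire end terms in T and index
  and coindex can be read off.\<close>

lemma lin_map_closed: "lin_map K V W f \<Longrightarrow> x \<in> carrier V \<Longrightarrow> f x \<in> carrier W"
  by (auto simp: lin_map_def)

lemma lin_map_add:
  "lin_map K V W f \<Longrightarrow> x \<in> carrier V \<Longrightarrow> y \<in> carrier V \<Longrightarrow> f (x \<oplus>\<^bsub>V\<^esub> y) = f x \<oplus>\<^bsub>W\<^esub> f y"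
  by (auto simp: lin_map_def)

lemma lin_map_smult:
  "lin_map K V W f \<Longrightarrow> k \<in> carrier K \<Longrightarrow> x \<in> carrier V \<Longrightarrow> f (k \<odot>\<^bsub>V\<^esub> x) = k \<odot>\<^bsub>W\<^esub> f x"
  by (auto simp: lin_map_def)

lemma lin_map_hom:
  assumes "Module.module K V" "Module.module K W" "lin_map K V W f"
  shows "abelian_group_hom V W f"
proof -
  interpret V: Module.module K V by fact
  interpret W: Module.module K W by fact
  show ?thesis
    by (intro abelian_group_homI V.abelian_group_axioms W.abelian_group_axioms group_hom.intro
        V.a_group W.a_group group_hom_axioms.intro homI)
      (use assms(3) in \<open>auto simp: lin_map_def\<close>)
qed

lemma lin_map_zero:
  assumes "Module.module K V" "Module.module K W" "lin_map K V W f"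
  shows "f \<zero>\<^bsub>V\<^esub> = \<zero>\<^bsub>W\<^esub>"
  using abelian_group_hom.hom_zero[OF lin_map_hom[OF assms]] .

lemma lin_map_minus:
  assumes "Module.module K V" "Module.module K W" "lin_map K V W f"
    and "x \<in> carrier V" "y \<in> carrier V"
  shows "f (x \<ominus>\<^bsub>V\<^esub> y) = f x \<ominus>\<^bsub>W\<^esub> f y"
proof -
  interpret abelian_group_hom V W f using lin_map_hom[OF assms(1-3)] .
  show ?thesis using assms(4,5) by (simp add: a_minus_def)
qed

lemma lin_map_compose:
  "lin_map K U V f \<Longrightarrow> lin_map K V W g \<Longrightarrow> lin_map K U W (\<lambda>x. g (f x))"
  by (auto simp: lin_map_def Pi_iff)

lemma (in abelian_group) minus_zero_iff:
  "x \<in> carrier G \<Longrightarrow> y \<in> carrier G \<Longrightarrow> x \<ominus> y = \<zero> \<longleftrightarrow> x = y"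
  by (metis a_minus_def add.inv_closed minus_equality minus_minus r_neg)

lemma (in abelian_group) minus_add_cancel:
  "x \<in> carrier G \<Longrightarrow> y \<in> carrier G \<Longrightarrow> (x \<ominus> y) \<oplus> y = x"
  by (simp add: a_minus_def add.m_assoc l_neg)

context linear_category
begin

lemma Hom_abelian_group: "X \<in> Ob C \<Longrightarrow> Y \<in> Ob C \<Longrightarrow> abelian_group (Hom C X Y)"
  using Hom_module by (simp add: Module.module_def)

lemma Comp_closed:
  "\<lbrakk>X \<in> Ob C; Y \<in> Ob C; Z \<in> Ob C; f \<in> Mor C X Y; g \<in> Mor C Y Z\<rbrakk> \<Longrightarrow> Comp C X Y Z g f \<in> Mor C X Z"
  using lin_map_closed[OF Comp_linear_left] by blast

lemma Zero_closed: "X \<in> Ob C \<Longrightarrow> Y \<in> Ob C \<Longrightarrow> Zero C X Y \<in> Mor C X Y"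
  by (simp add: Hom_abelian_group abelian_group.axioms(1) abelian_monoid.zero_closed)

lemma add_closed:
  "\<lbrakk>X \<in> Ob C; Y \<in> Ob C; f \<in> Mor C X Y; g \<in> Mor C X Y\<rbrakk> \<Longrightarrow> f \<oplus>\<^bsub>Hom C X Y\<^esub> g \<in> Mor C X Y"
  by (simp add: Hom_abelian_group abelian_group.axioms(1) abelian_monoid.a_closed)

lemma minus_closed:
  "\<lbrakk>X \<in> Ob C; Y \<in> Ob C; f \<in> Mor C X Y; g \<in> Mor C X Y\<rbrakk> \<Longrightarrow> f \<ominus>\<^bsub>Hom C X Y\<^esub> g \<in> Mor C X Y"
  by (simp add: Hom_abelian_group abelian_group.minus_closed)

lemma Comp_Zero_left:
  "\<lbrakk>X \<in> Ob C; Y \<in> Ob C; Z \<in> Ob C; f \<in> Mor C X Y\<rbrakk> \<Longrightarrow> Comp C X Y Z (Zero C Y Z) f = Zero C X Z"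
  by (rule lin_map_zero[OF Hom_module Hom_module Comp_linear_left])

lemma Comp_Zero_right:
  "\<lbrakk>X \<in> Ob C; Y \<in> Ob C; Z \<in> Ob C; g \<in> Mor C Y Z\<rbrakk> \<Longrightarrow> Comp C X Y Z g (Zero C X Y) = Zero C X Z"
  by (rule lin_map_zero[OF Hom_module Hom_module Comp_linear_right])

lemma Comp_add_left:
  "\<lbrakk>X \<in> Ob C; Y \<in> Ob C; Z \<in> Ob C; f \<in> Mor C X Y; g \<in> Mor C Y Z; g' \<in> Mor C Y Z\<rbrakk>
   \<Longrightarrow> Comp C X Y Z (g \<oplus>\<^bsub>Hom C Y Z\<^esub> g') f = Comp C X Y Z g f \<oplus>\<^bsub>Hom C X Z\<^esub> Comp C X Y Z g' f"
  by (rule lin_map_add[OF Comp_linear_left])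

lemma Comp_add_right:
  "\<lbrakk>X \<in> Ob C; Y \<in> Ob C; Z \<in> Ob C; g \<in> Mor C Y Z; f \<in> Mor C X Y; f' \<in> Mor C X Y\<rbrakk>
   \<Longrightarrow> Comp C X Y Z g (f \<oplus>\<^bsub>Hom C X Y\<^esub> f') = Comp C X Y Z g f \<oplus>\<^bsub>Hom C X Z\<^esub> Comp C X Y Z g f'"
  by (rule lin_map_add[OF Comp_linear_right])

lemma Comp_minus_left:
  "\<lbrakk>X \<in> Ob C; Y \<in> Ob C; Z \<in> Ob C; f \<in> Mor C X Y; g \<in> Mor C Y Z; g' \<in> Mor C Y Z\<rbrakk>
   \<Longrightarrow> Comp C X Y Z (g \<ominus>\<^bsub>Hom C Y Z\<^esub> g') f = Comp C X Y Z g f \<ominus>\<^bsub>Hom C X Z\<^esub> Comp C X Y Z g' f"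
  by (rule lin_map_minus[OF Hom_module Hom_module Comp_linear_left])

lemma Comp_minus_right:
  "\<lbrakk>X \<in> Ob C; Y \<in> Ob C; Z \<in> Ob C; g \<in> Mor C Y Z; f \<in> Mor C X Y; f' \<in> Mor C X Y\<rbrakk>
   \<Longrightarrow> Comp C X Y Z g (f \<ominus>\<^bsub>Hom C X Y\<^esub> f') = Comp C X Y Z g f \<ominus>\<^bsub>Hom C X Z\<^esub> Comp C X Y Z g f'"
  by (rule lin_map_minus[OF Hom_module Hom_module Comp_linear_right])

text \<open>This provides the conflation W -> W -> 0, through which statements about composites of
  morphisms become instances of \<open>ET3\<close> and \<open>ET3_op\<close>.\<close>

lemma biproduct_zero_right:
  assumes "zero_obj C N" "W \<in> Ob C"
  shows "biproduct C W N W (One C W) (Zero C N W) (One C W) (Zero C W N)"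
proof -
  have N: "N \<in> Ob C" "One C N = Zero C N N" using assms by (auto simp: zero_obj_def)
  interpret abelian_group "Hom C W W" by (rule Hom_abelian_group[OF assms(2,2)])
  show ?thesis unfolding biproduct_def using N assms(2)
    by (simp add: One_closed Zero_closed Comp_One_left Comp_One_right Comp_Zero_left Comp_Zero_right)
qed

lemma biproduct_swap:
  assumes "biproduct C A B S i j p q"
  shows "biproduct C B A S j i q p"
proof -
  have "A \<in> Ob C" "B \<in> Ob C" "S \<in> Ob C" "i \<in> Mor C A S" "j \<in> Mor C B S"
    "p \<in> Mor C S A" "q \<in> Mor C S B"
    using assms by (auto simp: biproduct_def)
  note mor = this
  interpret abelian_group "Hom C S S" by (rule Hom_abelian_group) fact+
  show ?thesis using assms mor unfolding biproduct_def
    by (simp add: a_comm Comp_closed)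
qed

lemma iso_mor_sym:
  assumes "iso_mor C X Y f"
  obtains g where "iso_mor C Y X g" "Comp C X Y X g f = One C X" "Comp C Y X Y f g = One C Y"
  using assms unfolding iso_mor_def by blast

lemma iso_mor_One: "X \<in> Ob C \<Longrightarrow> iso_mor C X X (One C X)"
  unfolding iso_mor_def using One_closed Comp_One_left by blast

lemma iso_mor_comp:
  assumes "X \<in> Ob C" "Y \<in> Ob C" "Z \<in> Ob C" "iso_mor C X Y f" "iso_mor C Y Z g"
  shows "iso_mor C X Z (Comp C X Y Z g f)"
proof -
  obtain f' where f': "f' \<in> Mor C Y X" "Comp C X Y X f' f = One C X" "Comp C Y X Y f f' = One C Y"
    using assms unfolding iso_mor_def by blast
  obtain g' where g': "g' \<in> Mor C Z Y" "Comp C Y Z Y g' g = One C Y" "Comp C Z Y Z g g' = One C Z"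
    using assms unfolding iso_mor_def by blast
  have fg: "f \<in> Mor C X Y" "g \<in> Mor C Y Z" using assms unfolding iso_mor_def by auto
  note o = assms(1-3)
  have 1: "Comp C X Y Y (Comp C Y Z Y g' g) f = Comp C X Z Y g' (Comp C X Y Z g f)"
    by (rule Comp_assoc) (use o fg g' in auto)
  have 2: "Comp C X Y X f' (Comp C X Z Y g' (Comp C X Y Z g f)) = Comp C X Z X (Comp C Z Y X f' g') (Comp C X Y Z g f)"
    by (rule Comp_assoc[symmetric]) (use o fg g' f' Comp_closed in auto)
  have 3: "Comp C Z Y Y (Comp C Y X Y f f') g' = Comp C Z X Y f (Comp C Z Y X f' g')"
    by (rule Comp_assoc) (use o fg g' f' in auto)
  have 4: "Comp C Z Y Z g (Comp C Z X Y f (Comp C Z Y X f' g')) = Comp C Z X Z (Comp C X Y Z g f) (Comp C Z Y X f' g')"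
    by (rule Comp_assoc[symmetric]) (use o fg g' f' Comp_closed in auto)
  show ?thesis unfolding iso_mor_def
    by (intro conjI bexI[of _ "Comp C Z Y X f' g'"])
      (use 1 2 3 4 o fg f' g' Comp_One_left[of X Y f] Comp_One_left[of Z Y g'] Comp_closed in auto)
qed

end

section \<open>Duality and exact sequences in extriangulated categories\<close>

text \<open>The axioms of an extriangulated category are self-dual, so interpreting a locale at this
  category yields the dual of each statement proved in it. All types stay the same, and the simp
  rules translate the result back.\<close>

definition op_cat :: "('o,'m,'k,'e) extcat \<Rightarrow> ('o,'m,'k,'e) extcat" where
  "op_cat C = \<lparr>Ob = Ob C, Hom = (\<lambda>X Y. Hom C Y X), One = One C,
     Comp = (\<lambda>X Y Z g f. Comp C Z Y X f g), Ext = (\<lambda>Z X. Ext C X Z),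
     Push = (\<lambda>Z X X' a \<delta>. Pull C X' X Z a \<delta>), Pull = (\<lambda>Z' Z X c \<delta>. Push C X Z Z' c \<delta>),
     Rlz = (\<lambda>Z X \<delta>. {(B,x,y). (B,y,x) \<in> Rlz C X Z \<delta>})\<rparr>"

lemma op_cat_simps [simp]:
  "Ob (op_cat C) = Ob C" "Hom (op_cat C) X Y = Hom C Y X" "One (op_cat C) = One C"
  "Comp (op_cat C) X Y Z g f = Comp C Z Y X f g" "Ext (op_cat C) Z X = Ext C X Z"
  "Push (op_cat C) Z X X' a = Pull C X' X Z a"
  "Pull (op_cat C) Z' Z X c = Push C X Z Z' c"
  "(B,x,y) \<in> Rlz (op_cat C) Z X \<delta> \<longleftrightarrow> (B,y,x) \<in> Rlz C X Z \<delta>"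
  by (auto simp: op_cat_def)

lemma biproduct_op [simp]: "biproduct (op_cat C) A B S i j p q \<longleftrightarrow> biproduct C A B S p q i j"
  by (auto simp: biproduct_def)

lemma zero_obj_op [simp]: "zero_obj (op_cat C) X \<longleftrightarrow> zero_obj C X"
  by (simp add: zero_obj_def)

lemma iso_mor_op [simp]: "iso_mor (op_cat C) X Y f \<longleftrightarrow> iso_mor C Y X f"
  by (auto simp: iso_mor_def)

section \<open>Realisations up to isomorphism, and the opposite category\<close>

context extriangulated_category
begin

lemma Rlz_ob:
  assumes "Z \<in> Ob C" "X \<in> Ob C" "\<delta> \<in> carrier (Ext C Z X)" "(B,x,y) \<in> Rlz C Z X \<delta>"
  shows "B \<in> Ob C" "x \<in> Mor C X B" "y \<in> Mor C B Z"
  using Rlz_class[OF assms(1-3)] assms(4) by (auto simp: seq_equiv_def)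

text \<open>\<open>Rlz_class\<close> compares every realisation with one fixed representative.
  Inverting the first comparison and composing with the second relates any two of them.\<close>

lemma Rlz_iso_middle:
  assumes "Z \<in> Ob C" "X \<in> Ob C" "\<delta> \<in> carrier (Ext C Z X)"
    and "(B,x,y) \<in> Rlz C Z X \<delta>" "(B',x',y') \<in> Rlz C Z X \<delta>"
  obtains b where "iso_mor C B B' b" "Comp C X B B' b x = x'" "Comp C B B' Z y' b = y"
proof -
  obtain B0 x0 y0 where 0: "B0 \<in> Ob C" "x0 \<in> Mor C X B0" "y0 \<in> Mor C B0 Z"
    "Rlz C Z X \<delta> = {s. seq_equiv C X Z (B0,x0,y0) s}"
    using Rlz_class[OF assms(1-3)] by blast
  note B = Rlz_ob[OF assms(1-3,4)] Rlz_ob[OF assms(1-3,5)]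
  obtain c where c: "iso_mor C B0 B c" "Comp C X B0 B c x0 = x" "Comp C B0 B Z y c = y0"
    using assms(4) 0 by (auto simp: seq_equiv_def)
  obtain d where d: "iso_mor C B0 B' d" "Comp C X B0 B' d x0 = x'" "Comp C B0 B' Z y' d = y0"
    using assms(5) 0 by (auto simp: seq_equiv_def)
  obtain c' where c': "iso_mor C B B0 c'" "Comp C B0 B B0 c' c = One C B0" "Comp C B B0 B c c' = One C B"
    using iso_mor_sym[OF c(1)] .
  have m: "c \<in> Mor C B0 B" "c' \<in> Mor C B B0" "d \<in> Mor C B0 B'"
    using c(1) c'(1) d(1) by (auto simp: iso_mor_def)
  have 1: "Comp C X B B0 c' x = x0"
    using c(2) Comp_assoc[of X B0 B B0 x0 c c'] B 0 m assms(2) c'(2) Comp_One_left by auto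
  have 2: "Comp C B B0 Z y0 c' = y"
    using c(3) Comp_assoc[of B B0 B Z c' c y] B 0 m assms(1) c'(3) Comp_One_right by auto
  show thesis
  proof
    show "iso_mor C B B' (Comp C B B0 B' d c')"
      by (rule iso_mor_comp[OF _ _ _ c'(1) d(1)]) (use 0 B in auto)
    show "Comp C X B B' (Comp C B B0 B' d c') x = x'"
      using 1 d(2) Comp_assoc[of X B B0 B' x c' d] B 0 m assms(2) by auto
    show "Comp C B B' Z y' (Comp C B B0 B' d c') = y"
      using 2 d(3) Comp_assoc[of B B0 B' Z c' d y'] B 0 m assms(1) by auto
  qed
qed

lemma Rlz_iso_closed:
  assumes "Z \<in> Ob C" "X \<in> Ob C" "\<delta> \<in> carrier (Ext C Z X)"
    and "(B,x,y) \<in> Rlz C Z X \<delta>" and "B' \<in> Ob C" "y' \<in> Mor C B' Z"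
    and "iso_mor C B B' b" "Comp C X B B' b x = x'" "Comp C B B' Z y' b = y"
  shows "(B',x',y') \<in> Rlz C Z X \<delta>"
proof -
  obtain B0 x0 y0 where 0: "B0 \<in> Ob C" "x0 \<in> Mor C X B0" "y0 \<in> Mor C B0 Z"
    "Rlz C Z X \<delta> = {s. seq_equiv C X Z (B0,x0,y0) s}"
    using Rlz_class[OF assms(1-3)] by blast
  note B = Rlz_ob[OF assms(1-4)]
  obtain c where c: "iso_mor C B0 B c" "Comp C X B0 B c x0 = x" "Comp C B0 B Z y c = y0"
    using assms(4) 0 by (auto simp: seq_equiv_def)
  have m: "c \<in> Mor C B0 B" "b \<in> Mor C B B'"
    using c(1) assms(7) by (auto simp: iso_mor_def)
  have "seq_equiv C X Z (B0,x0,y0) (B',x',y')"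
    unfolding seq_equiv_def using 0 B assms c m
    by (auto simp: Comp_assoc Comp_closed intro!: exI[of _ "Comp C B0 B B' b c"] iso_mor_comp[of B0 B B' c b])
  then show ?thesis using 0 by simp
qed

lemma Ext_abelian_group: "Z \<in> Ob C \<Longrightarrow> X \<in> Ob C \<Longrightarrow> abelian_group (Ext C Z X)"
  using Ext_module by (simp add: Module.module_def)

lemma Ext_zero_closed: "Z \<in> Ob C \<Longrightarrow> X \<in> Ob C \<Longrightarrow> \<zero>\<^bsub>Ext C Z X\<^esub> \<in> carrier (Ext C Z X)"
  by (simp add: Ext_abelian_group abelian_group.axioms(1) abelian_monoid.zero_closed)

lemma Push_closed:
  "\<lbrakk>Z \<in> Ob C; X \<in> Ob C; X' \<in> Ob C; a \<in> Mor C X X'; \<delta> \<in> carrier (Ext C Z X)\<rbrakk>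
   \<Longrightarrow> Push C Z X X' a \<delta> \<in> carrier (Ext C Z X')"
  by (rule lin_map_closed[OF Push_linear])

lemma Pull_closed:
  "\<lbrakk>Z \<in> Ob C; Z' \<in> Ob C; X \<in> Ob C; c \<in> Mor C Z' Z; \<delta> \<in> carrier (Ext C Z X)\<rbrakk>
   \<Longrightarrow> Pull C Z' Z X c \<delta> \<in> carrier (Ext C Z' X)"
  by (rule lin_map_closed[OF Pull_linear])

lemma Push_zero:
  "\<lbrakk>Z \<in> Ob C; X \<in> Ob C; X' \<in> Ob C; a \<in> Mor C X X'\<rbrakk>
   \<Longrightarrow> Push C Z X X' a \<zero>\<^bsub>Ext C Z X\<^esub> = \<zero>\<^bsub>Ext C Z X'\<^esub>"
  by (rule lin_map_zero[OF Ext_module Ext_module Push_linear])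

lemma Pull_zero:
  "\<lbrakk>Z \<in> Ob C; Z' \<in> Ob C; X \<in> Ob C; c \<in> Mor C Z' Z\<rbrakk>
   \<Longrightarrow> Pull C Z' Z X c \<zero>\<^bsub>Ext C Z X\<^esub> = \<zero>\<^bsub>Ext C Z' X\<^esub>"
  by (rule lin_map_zero[OF Ext_module Ext_module Pull_linear])

lemma Pull_zero_mor:
  "\<lbrakk>Z \<in> Ob C; Z' \<in> Ob C; X \<in> Ob C; \<delta> \<in> carrier (Ext C Z X)\<rbrakk>
   \<Longrightarrow> Pull C Z' Z X (Zero C Z' Z) \<delta> = \<zero>\<^bsub>Ext C Z' X\<^esub>"
  by (rule lin_map_zero[OF Hom_module Ext_module Pull_linear_mor])

lemma Pull_minus_mor:
  "\<lbrakk>Z \<in> Ob C; Z' \<in> Ob C; X \<in> Ob C; \<delta> \<in> carrier (Ext C Z X); c \<in> Mor C Z' Z; c' \<in> Mor C Z' Z\<rbrakk>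
   \<Longrightarrow> Pull C Z' Z X (c \<ominus>\<^bsub>Hom C Z' Z\<^esub> c') \<delta> = Pull C Z' Z X c \<delta> \<ominus>\<^bsub>Ext C Z' X\<^esub> Pull C Z' Z X c' \<delta>"
  by (rule lin_map_minus[OF Hom_module Ext_module Pull_linear_mor])

lemma Push_minus_mor:
  "\<lbrakk>Z \<in> Ob C; X \<in> Ob C; X' \<in> Ob C; \<delta> \<in> carrier (Ext C Z X); a \<in> Mor C X X'; a' \<in> Mor C X X'\<rbrakk>
   \<Longrightarrow> Push C Z X X' (a \<ominus>\<^bsub>Hom C X X'\<^esub> a') \<delta> = Push C Z X X' a \<delta> \<ominus>\<^bsub>Ext C Z X'\<^esub> Push C Z X X' a' \<delta>"
  by (rule lin_map_minus[OF Hom_module Ext_module Push_linear_mor])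

lemma Pull_minus:
  "\<lbrakk>Z \<in> Ob C; Z' \<in> Ob C; X \<in> Ob C; c \<in> Mor C Z' Z; \<delta> \<in> carrier (Ext C Z X); \<epsilon> \<in> carrier (Ext C Z X)\<rbrakk>
   \<Longrightarrow> Pull C Z' Z X c (\<delta> \<ominus>\<^bsub>Ext C Z X\<^esub> \<epsilon>) = Pull C Z' Z X c \<delta> \<ominus>\<^bsub>Ext C Z' X\<^esub> Pull C Z' Z X c \<epsilon>"
  by (rule lin_map_minus[OF Ext_module Ext_module Pull_linear])

text \<open>In the opposite category the comparison isomorphism runs from \<open>B'\<close> to
  \<open>B\<close>, so the two relations are matched by inverting it.\<close>

lemma seq_equiv_op:
  assumes "Z \<in> Ob C" "X \<in> Ob C"
  shows "seq_equiv C Z X (B,y,x) (B',y',x') \<longleftrightarrow> seq_equiv (op_cat C) X Z (B,x,y) (B',x',y')"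
proof -
  have 1: "\<exists>c. iso_mor D B' B c \<and> Comp D B' B X x c = x' \<and> Comp D Z B' B c y' = y"
    if D: "linear_category K D" "Z \<in> Ob D" "X \<in> Ob D" "B \<in> Ob D" "B' \<in> Ob D" "y \<in> Mor D Z B" "x \<in> Mor D B X"
      "y' \<in> Mor D Z B'" "x' \<in> Mor D B' X"
      "iso_mor D B B' b" "Comp D Z B B' b y = y'" "Comp D B B' X x' b = x"
    for D :: "('o,'m,'k,'e) extcat" and Z X B y x B' y' x' b
  proof -
    interpret D: linear_category K D by fact
    obtain c where c: "iso_mor D B' B c" "Comp D B B' B c b = One D B" "Comp D B' B B' b c = One D B'"
      using D.iso_mor_sym[OF D(10)] .
    have m: "b \<in> Mor D B B'" "c \<in> Mor D B' B" using D(10) c(1) by (auto simp: iso_mor_def)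
    show ?thesis
      using D.Comp_assoc[of B' B B' X c b x'] D.Comp_assoc[of Z B B' B y b c] c D m
        D.Comp_One_right[of B' X x'] D.Comp_One_left[of Z B y] by (intro exI[of _ c]) simp
  qed
  have D: "linear_category K C" by unfold_locales
  show ?thesis
    unfolding seq_equiv_def using 1[OF D, of Z X B B' y x y' x'] 1[OF D, of Z X B' B y' x' y x] assms by auto
qed

text \<open>Reading \<open>Rlz_sum\<close> backwards applies \<open>Push\<close> and
  \<open>Pull\<close> in the other order and brackets the composites differently. Naturality
  (\<open>Push_Pull\<close>) and associativity make up for this.\<close>

lemma Rlz_sum_op:
  assumes Z: "\<delta> \<in> carrier (Ext C X Z)" "\<delta>' \<in> carrier (Ext C X' Z')"
    "(B,y,x) \<in> Rlz C X Z \<delta>" "(B',y',x') \<in> Rlz C X' Z' \<delta>'"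
    "biproduct C X X' SX pX qX iX jX" "biproduct C B B' SB pB qB iB jB" "biproduct C Z Z' SZ pZ qZ iZ jZ"
  shows "(SB,
           Comp C SZ B SB pB (Comp C SZ Z B y iZ) \<oplus>\<^bsub>Hom C SZ SB\<^esub>
             Comp C SZ B' SB qB (Comp C SZ Z' B' y' jZ),
           Comp C SB X SX pX (Comp C SB B X x iB) \<oplus>\<^bsub>Hom C SB SX\<^esub>
             Comp C SB X' SX qX (Comp C SB B' X' x' jB))
          \<in> Rlz C SX SZ
              (Pull C SX X SZ iX (Push C X Z SZ pZ \<delta>) \<oplus>\<^bsub>Ext C SX SZ\<^esub>
               Pull C SX X' SZ jX (Push C X' Z' SZ qZ \<delta>'))"
proof -
  have o: "X \<in> Ob C" "Z \<in> Ob C" "X' \<in> Ob C" "Z' \<in> Ob C" "SX \<in> Ob C" "SZ \<in> Ob C"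
    and m: "iX \<in> Mor C SX X" "jX \<in> Mor C SX X'" "pZ \<in> Mor C Z SZ" "qZ \<in> Mor C Z' SZ"
    and b: "B \<in> Ob C" "B' \<in> Ob C" "SB \<in> Ob C" "iB \<in> Mor C SB B" "jB \<in> Mor C SB B'"
      "pB \<in> Mor C B SB" "qB \<in> Mor C B' SB"
    and z: "iZ \<in> Mor C SZ Z" "jZ \<in> Mor C SZ Z'" "pX \<in> Mor C X SX" "qX \<in> Mor C X' SX"
    using assms(5-) by (auto simp: biproduct_def)
  note r = Rlz_ob[OF o(1,2) assms(1,3)] Rlz_ob[OF o(3,4) assms(2,4)]
  show ?thesis
    using Rlz_sum[OF assms(1-4,7,6,5)]
    by (simp add: Push_Pull[symmetric] Comp_assoc o m b z r assms(1,2))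
qed

text \<open>The goals come in the order of the locale axioms: 1 to 10 concern the additive
  structure, 11 to 20 the bifunctor, 21 to 24 the realisation, and 25 to 28 are \<open>ET3\<close>,
  \<open>ET3_op\<close>, \<open>ET4\<close>, \<open>ET4_op\<close>. Each follows from its mirror
  image for \<open>C\<close>.\<close>

lemma op_extriangulated: "extriangulated_category K (op_cat C)"
proof (intro extriangulated_category.intro additive_category.intro linear_category.intro
    additive_category_axioms.intro extriangulated_category_axioms.intro, goal_cases)
  case 1
  then show ?case by (rule field_K)
next
  case 2
  then show ?case by (simp add: Hom_module)
next
  case 3
  then show ?case by (simp add: One_closed)
next
  case 4
  then show ?case by (simp add: Comp_linear_right)
next
  case 5
  then show ?case by (simp add: Comp_linear_left)
next
  case 6
  then show ?case by (simp add: Comp_assoc)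
next
  case 7
  then show ?case by (simp add: Comp_One_right)
next
  case 8
  then show ?case by (simp add: Comp_One_left)
next
  case 9
  then show ?case using ex_zero_obj by simp
next
  case 10
  then show ?case using ex_biproduct by simp blast
next
  case 11
  then show ?case by (simp add: Ext_module)
next
  case 12
  then show ?case by (simp add: Pull_linear)
next
  case 13
  then show ?case by (simp add: Pull_linear_mor)
next
  case 14
  then show ?case by (simp add: Pull_One)
next
  case 15
  then show ?case by (simp add: Pull_Comp)
next
  case 16
  then show ?case by (simp add: Push_linear)
next
  case 17
  then show ?case by (simp add: Push_linear_mor)
next
  case 18
  then show ?case by (simp add: Push_One)
next
  case 19
  then show ?case by (simp add: Push_Comp)
next
  case 20
  then show ?case by (simp add: Push_Pull)
next
  case (21 Z X \<delta>)
  then obtain B y x where B: "B \<in> Ob C" "y \<in> Mor C Z B" "x \<in> Mor C B X"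
    "Rlz C X Z \<delta> = {s. seq_equiv C Z X (B,y,x) s}"
    using Rlz_class[of X Z \<delta>] by auto
  have "seq_equiv C Z X (B,y,x) (B',y',x') \<longleftrightarrow> seq_equiv (op_cat C) X Z (B,x,y) (B',x',y')" for B' x' y'
    using seq_equiv_op[of Z X B y x B' y' x'] 21 by simp
  then have "Rlz (op_cat C) Z X \<delta> = {s. seq_equiv (op_cat C) X Z (B,x,y) s}"
    using B(4) by (auto simp: op_cat_def)
  with B(1-3) show ?case by auto
next
  case (22 Z X Z' X' \<delta> \<delta>' B x y B' x' y' a c)
  then show ?case using Rlz_mor[of X' Z' X Z \<delta>' \<delta> B' y' x' B y x c a] by auto
next
  case 23
  then show ?case using Rlz_zero[OF biproduct_swap] by simp
next
  case 24
  then show ?case using Rlz_sum_op by simp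
next
  case (25 Z X Z' X' \<delta> \<delta>' B x y B' x' y' a b)
  then show ?case using ET3_op[of X' Z' X Z \<delta>' \<delta> B' y' x' B y x b a] by simp metis
next
  case (26 Z X Z' X' \<delta> \<delta>' B x y B' x' y' b c)
  then show ?case using ET3[of X' Z' X Z \<delta>' \<delta> B' y' x' B y x c b] by simp metis
next
  case (27 A B D F \<delta> f f' \<delta>' G g g')
  then obtain E h' d e \<delta>'' where "E \<in> Ob C" "h' \<in> Mor C E G" "d \<in> Mor C F E" "e \<in> Mor C E D"
    "\<delta>'' \<in> carrier (Ext C A E)" "(G, h', Comp C G B A f g) \<in> Rlz C A E \<delta>''"
    "Comp C F E G h' d = g'" "Comp C E G B g h' = Comp C E D B f' e"
    "(E, d, e) \<in> Rlz C D F (Pull C D B F f' \<delta>')"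
    "Push C A E D e \<delta>'' = \<delta>" "Push C B F E d \<delta>' = Pull C B A E f \<delta>''"
    using ET4_op[of B F D A \<delta>' G g' g \<delta> f' f] by auto
  then show ?case
    by (simp, intro bexI[of _ E] bexI[of _ h'] bexI[of _ e] bexI[of _ d] bexI[of _ \<delta>''] conjI; simp)
next
  case (28 B D F G \<delta> A f' f \<delta>' g' g)
  then obtain E h' d e \<delta>'' where "E \<in> Ob C" "h' \<in> Mor C A E" "d \<in> Mor C F E" "e \<in> Mor C E D"
    "\<delta>'' \<in> carrier (Ext C E G)" "(A, Comp C G B A f g, h') \<in> Rlz C E G \<delta>''"
    "Comp C B A E h' f = Comp C B F E d g'" "Comp C A E D e h' = f'"
    "(E, d, e) \<in> Rlz C D F (Push C D B F g' \<delta>)"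
    "Pull C F E G d \<delta>'' = \<delta>'" "Push C E G B g \<delta>'' = Pull C E D B e \<delta>"
    using ET4[of G B F D \<delta>' g g' \<delta> A f f'] by auto
  then show ?case
    by (simp, intro bexI[of _ E] bexI[of _ h'] bexI[of _ e] bexI[of _ d] bexI[of _ \<delta>''] conjI; simp)
qed

end

text \<open>A conflation together with its class. The carrier conditions are included because
  \<open>Rlz_class\<close> speaks only of elements of the carriers; that the middle term and both
  morphisms lie in \<open>C\<close> is then a consequence (\<open>realizesD\<close>).\<close>

definition realizes :: "('o,'m,'k,'e) extcat \<Rightarrow> 'o \<Rightarrow> 'o \<Rightarrow> 'o \<Rightarrow> 'm \<Rightarrow> 'm \<Rightarrow> 'e \<Rightarrow> bool" where
  "realizes C A B Z x y \<delta> \<longleftrightarrow> A \<in> Ob C \<and> Z \<in> Ob C \<and> \<delta> \<in> carrier (Ext C Z A) \<and> (B,x,y) \<in> Rlz C Z A \<delta>"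

lemma realizes_op [simp]: "realizes (op_cat C) A B Z x y \<delta> \<longleftrightarrow> realizes C Z B A y x \<delta>"
  by (auto simp: realizes_def)

lemma conflation_iff: "conflation C A B Z x y \<longleftrightarrow> (\<exists>\<delta>. realizes C A B Z x y \<delta>)"
  by (auto simp: realizes_def conflation_def)

lemma conflation_op [simp]: "conflation (op_cat C) A B Z x y \<longleftrightarrow> conflation C Z B A y x"
  by (simp add: conflation_iff)

section \<open>Exact sequences of Hom and Ext attached to a conflation\<close>

context extriangulated_category
begin

lemma realizesD:
  assumes "realizes C A B Z x y \<delta>"
  shows "A \<in> Ob C" "B \<in> Ob C" "Z \<in> Ob C" "x \<in> Mor C A B" "y \<in> Mor C B Z"
    "\<delta> \<in> carrier (Ext C Z A)" "(B,x,y) \<in> Rlz C Z A \<delta>"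
  using assms Rlz_ob[of Z A \<delta> B x y] by (auto simp: realizes_def)

lemma ex_realization:
  assumes "A \<in> Ob C" "Z \<in> Ob C" "\<delta> \<in> carrier (Ext C Z A)"
  obtains B x y where "realizes C A B Z x y \<delta>"
proof -
  obtain B x y where B: "B \<in> Ob C" "x \<in> Mor C A B" "y \<in> Mor C B Z"
    "Rlz C Z A \<delta> = {s. seq_equiv C A Z (B,x,y) s}"
    using Rlz_class[of Z A \<delta>] assms by blast
  have "seq_equiv C A Z (B,x,y) (B,x,y)"
    unfolding seq_equiv_def using B assms
    by (auto intro!: exI[of _ "One C B"] iso_mor_One Comp_One_left Comp_One_right)
  then show thesis using that[of B x y] B assms by (simp add: realizes_def)
qed

lemma realizes_biproduct:
  assumes "biproduct C A Z S i j p q"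
  shows "realizes C A S Z i q \<zero>\<^bsub>Ext C Z A\<^esub>"
proof -
  have "A \<in> Ob C" "Z \<in> Ob C" using assms by (auto simp: biproduct_def)
  then show ?thesis unfolding realizes_def using Rlz_zero[OF assms] Ext_zero_closed by simp
qed

text \<open>A biproduct also realises the zero class, and two realisations differ by an isomorphism
  \<open>b\<close> of middle terms. Carrying the missing inclusion and projection along
  \<open>b\<close> keeps the given \<open>x\<close> and \<open>y\<close> as they are.\<close>

lemma realizes_split:
  assumes "realizes C A B Z x y \<zero>\<^bsub>Ext C Z A\<^esub>"
  obtains j p where "biproduct C A Z B x j p y"
proof -
  note B = realizesD[OF assms]
  obtain S i j p q where S: "biproduct C A Z S i j p q" using ex_biproduct B by blast
  note s = S[unfolded biproduct_def]
  obtain b where b: "iso_mor C S B b" "Comp C A S B b i = x" "Comp C S B Z y b = q"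
    using Rlz_iso_middle[OF B(3,1,6) Rlz_zero[OF S] B(7)] .
  obtain b' where b': "iso_mor C B S b'" "Comp C S B S b' b = One C S" "Comp C B S B b b' = One C B"
    using iso_mor_sym[OF b(1)] .
  have m: "b \<in> Mor C S B" "b' \<in> Mor C B S" using b(1) b'(1) by (auto simp: iso_mor_def)
  note o = B(1-6) s m Comp_closed Comp_One_left Comp_One_right
  have yb: "Comp C B S Z q b' = y"
    using Comp_assoc[of B S B Z b' b y] o b b' by simp
  have bx: "Comp C A B S b' x = i"
    using Comp_assoc[of A S B S i b b'] o b b' by simp
  have 1: "Comp C A B A (Comp C B S A p b') x = One C A"
    using Comp_assoc[of A B S A x b' p] o bx by simp
  have 2: "Comp C Z B Z y (Comp C Z S B b j) = One C Z"
    using Comp_assoc[of Z S B Z j b y] o b by simp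
  have "Comp C Z B S b' (Comp C Z S B b j) = j"
    using Comp_assoc[of Z S B S j b b'] o b' by simp
  then have 3: "Comp C Z B A (Comp C B S A p b') (Comp C Z S B b j) = Zero C Z A"
    using Comp_assoc[of Z B S A "Comp C Z S B b j" b' p] o by simp
  have 4: "Comp C A B Z y x = Zero C A Z"
    using Comp_assoc[of A S B Z i b y] o b by simp
  have e1: "Comp C B A B x (Comp C B S A p b') = Comp C B S B b (Comp C B S S (Comp C S A S i p) b')"
    using Comp_assoc[of B A S B "Comp C B S A p b'" i b] Comp_assoc[of B S A S b' p i] o b by simp
  have e2: "Comp C B Z B (Comp C Z S B b j) y = Comp C B S B b (Comp C B S S (Comp C S Z S j q) b')"
    using Comp_assoc[of B Z S B y j b] Comp_assoc[of B S Z S b' q j] o yb by simp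
  have "Comp C B A B x (Comp C B S A p b') \<oplus>\<^bsub>Hom C B B\<^esub> Comp C B Z B (Comp C Z S B b j) y
      = Comp C B S B b (Comp C B S S (Comp C S A S i p \<oplus>\<^bsub>Hom C S S\<^esub> Comp C S Z S j q) b')"
    unfolding e1 e2
    by (subst Comp_add_left) (use o in \<open>auto intro!: Comp_add_right[symmetric]\<close>)
  also have "\<dots> = One C B" using o b' by simp
  finally have "biproduct C A Z B x (Comp C Z S B b j) (Comp C B S A p b') y"
    unfolding biproduct_def using 1 2 3 4 o by simp
  then show thesis by (rule that)
qed

text \<open>Map the conflation A -> A -> 0 to the given one by the identity and \<open>x\<close>.
  The map 0 -> Z that \<open>ET3\<close> adds shows that the composite factors through a zero
  object.\<close>

lemma realizes_comp_zero:
  assumes "realizes C A B Z x y \<delta>"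
  shows "Comp C A B Z y x = Zero C A Z"
proof -
  note B = realizesD[OF assms]
  obtain N where N: "zero_obj C N" using ex_zero_obj by blast
  then have NO: "N \<in> Ob C" by (simp add: zero_obj_def)
  note S = realizesD[OF realizes_biproduct[OF biproduct_zero_right[OF N B(1)]]]
  obtain c where c: "c \<in> Mor C N Z" "Comp C A N Z c (Zero C A N) = Comp C A B Z y x"
    using ET3[OF NO B(1,3,1) S(6) B(6) S(7) B(7) One_closed[OF B(1)] B(4) refl] by metis
  then show ?thesis using Comp_Zero_right[OF B(1) NO B(3) c(1)] by simp
qed

text \<open>Map the split conflation on A and B to the given one, by the projection \<open>q\<close>
  in the middle and by \<open>y\<close> on the right. \<open>ET3_op\<close> then exhibits the pulled
  back class as the push-forward of zero.\<close>

lemma Pull_deflation_zero: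
  assumes "realizes C A B Z x y \<delta>"
  shows "Pull C B Z A y \<delta> = \<zero>\<^bsub>Ext C B A\<^esub>"
proof -
  note B = realizesD[OF assms]
  obtain S i j p q where S: "biproduct C A B S i j p q" using ex_biproduct B by blast
  note s = realizesD[OF realizes_biproduct[OF S]]
  have eq: "Comp C S B Z y q = Comp C S B Z y q" ..
  obtain a where a: "a \<in> Mor C A A" "Push C B A A a \<zero>\<^bsub>Ext C B A\<^esub> = Pull C B Z A y \<delta>"
    using ET3_op[OF B(2,1,3,1) s(6) B(6) s(7) B(7) s(5) B(5) eq] by blast
  then show ?thesis using Push_zero[OF B(2,1,1) a(1)] by simp
qed

text \<open>If the pulled back class vanishes, the identity of A and \<open>c\<close> form a
  morphism of extensions starting at the split one. Its realisation, restricted to the summand W, is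
  the lift of \<open>c\<close>. With \<open>Pull_factor_zero\<close> this is exactness of Hom(W,B)
  -> Hom(W,Z) -> Ext(W,A).\<close>

lemma Pull_zero_factor:
  assumes "realizes C A B Z x y \<delta>" "W \<in> Ob C" "c \<in> Mor C W Z" "Pull C W Z A c \<delta> = \<zero>\<^bsub>Ext C W A\<^esub>"
  obtains g where "g \<in> Mor C W B" "Comp C W B Z y g = c"
proof -
  note B = realizesD[OF assms(1)]
  obtain S i j p q where S: "biproduct C A W S i j p q" using ex_biproduct B(1) assms(2) by blast
  note s = realizesD[OF realizes_biproduct[OF S]] and b = S[unfolded biproduct_def]
  have "Push C W A A (One C A) \<zero>\<^bsub>Ext C W A\<^esub> = Pull C W Z A c \<delta>"
    using assms(4) Push_zero[OF assms(2) B(1,1) One_closed[OF B(1)]] by simp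
  then obtain f where f: "f \<in> Mor C S B" "Comp C S B Z y f = Comp C S W Z c q"
    using Rlz_mor[OF assms(2) B(1) B(3,1) s(6) B(6) s(7) B(7) One_closed[OF B(1)] assms(3)] by blast
  have "Comp C W B Z y (Comp C W S B f j) = c"
    using Comp_assoc[of W S B Z j f y] Comp_assoc[of W S W Z j q c] f b B assms(2,3)
    by (simp add: Comp_One_right)
  moreover have "Comp C W S B f j \<in> Mor C W B" using f b B assms(2) by (simp add: Comp_closed)
  ultimately show thesis using that by blast
qed

lemma Pull_factor_zero:
  assumes "realizes C A B Z x y \<delta>" "W \<in> Ob C" "g \<in> Mor C W B"
  shows "Pull C W Z A (Comp C W B Z y g) \<delta> = \<zero>\<^bsub>Ext C W A\<^esub>"
proof -
  note B = realizesD[OF assms(1)]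
  show ?thesis using Pull_Comp[of Z B W A y g \<delta>] Pull_deflation_zero[OF assms(1)] B assms
    by (simp add: Pull_zero)
qed

text \<open>Apply \<open>ET3_op\<close> to the conflation W -> W -> 0. Only a weak kernel results:
  the factorisation \<open>k\<close> need not be unique, which is why isomorphisms of middle terms
  cost some effort later.\<close>

lemma Comp_zero_factor:
  assumes "realizes C A B Z x y \<delta>" "W \<in> Ob C" "g \<in> Mor C W B" "Comp C W B Z y g = Zero C W Z"
  obtains k where "k \<in> Mor C W A" "Comp C W A B x k = g"
proof -
  note B = realizesD[OF assms(1)]
  obtain N where N: "zero_obj C N" using ex_zero_obj by blast
  then have NO: "N \<in> Ob C" by (simp add: zero_obj_def)
  note S = realizesD[OF realizes_biproduct[OF biproduct_zero_right[OF N assms(2)]]]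
  have "Comp C W N Z (Zero C N Z) (Zero C W N) = Comp C W B Z y g"
    using assms NO B by (simp add: Comp_Zero_left Zero_closed)
  then obtain a where a: "a \<in> Mor C W A" "Comp C W W B g (One C W) = Comp C W A B x a"
    using ET3_op[OF NO assms(2) B(3,1) S(6) B(6) S(7) B(7) assms(3) Zero_closed[OF NO B(3)]] by blast
  then show thesis using that[of a] Comp_One_right[OF assms(2) B(2) assms(3)] by simp
qed

lemma Push_inflation_zero:
  assumes "realizes C A B Z x y \<delta>"
  shows "Push C Z A B x \<delta> = \<zero>\<^bsub>Ext C Z B\<^esub>"
proof -
  interpret op: extriangulated_category K "op_cat C" by (rule op_extriangulated)
  show ?thesis using op.Pull_deflation_zero[of Z B A y x \<delta>] assms by simp
qed

lemma Push_zero_factor: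
  assumes "realizes C A B Z x y \<delta>" "W \<in> Ob C" "a \<in> Mor C A W" "Push C Z A W a \<delta> = \<zero>\<^bsub>Ext C Z W\<^esub>"
  obtains g where "g \<in> Mor C B W" "Comp C A B W g x = a"
proof -
  interpret op: extriangulated_category K "op_cat C" by (rule op_extriangulated)
  show thesis using op.Pull_zero_factor[of Z B A y x \<delta> W a] assms that by auto
qed

text \<open>Realise \<epsilon> by A -> D -> W. Since its push-forward along \<open>x\<close> is
  zero, \<open>x\<close> extends over D, and \<open>ET3\<close> completes this extension to a map
  from W to Z. This is exactness at Ext(W,A).\<close>

lemma Push_zero_Pull:
  assumes "realizes C A B Z x y \<delta>" "W \<in> Ob C" "\<epsilon> \<in> carrier (Ext C W A)"
    and "Push C W A B x \<epsilon> = \<zero>\<^bsub>Ext C W B\<^esub>"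
  obtains c where "c \<in> Mor C W Z" "\<epsilon> = Pull C W Z A c \<delta>"
proof -
  note B = realizesD[OF assms(1)]
  obtain D k l where D: "realizes C A D W k l \<epsilon>" using ex_realization B(1) assms(2,3) by blast
  obtain b where b: "b \<in> Mor C D B" "Comp C A D B b k = x"
    using Push_zero_factor[OF D B(2,4) assms(4)] .
  note d = realizesD[OF D]
  have "Comp C A D B b k = Comp C A A B x (One C A)" using b B by (simp add: Comp_One_right)
  then obtain c where c: "c \<in> Mor C W Z" "Push C W A A (One C A) \<epsilon> = Pull C W Z A c \<delta>"
    using ET3[OF assms(2) B(1,3,1) assms(3) B(6) d(7) B(7) One_closed[OF B(1)] b(1)] by blast
  then show thesis using that[of c] Push_One[OF assms(2) B(1) assms(3)] by simp
qed

lemma Pull_zero_Push: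
  assumes "realizes C A B Z x y \<delta>" "W \<in> Ob C" "\<epsilon> \<in> carrier (Ext C Z W)"
    and "Pull C B Z W y \<epsilon> = \<zero>\<^bsub>Ext C B W\<^esub>"
  obtains a where "a \<in> Mor C A W" "\<epsilon> = Push C Z A W a \<delta>"
proof -
  interpret op: extriangulated_category K "op_cat C" by (rule op_extriangulated)
  show thesis using op.Push_zero_Pull[of Z B A y x \<delta> W \<epsilon>] assms that by auto
qed

text \<open>Exactness at Ext(W,B), by an octahedron. If B -> G -> W realises \<epsilon>, then
  \<open>ET4\<close> for A -> B -> G gives a conflation Z -> E -> W whose class is the push-forward
  of \<epsilon> along \<open>y\<close>. This is zero, so the conflation has a section W -> E, and
  pulling the class of E back along the section gives a preimage of \<epsilon>.\<close>

lemma Push_deflation_zero: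
  assumes "realizes C A B Z x y \<delta>" "W \<in> Ob C" "\<epsilon> \<in> carrier (Ext C W B)"
    and "Push C W B Z y \<epsilon> = \<zero>\<^bsub>Ext C W Z\<^esub>"
  obtains \<eta> where "\<eta> \<in> carrier (Ext C W A)" "\<epsilon> = Push C W A B x \<eta>"
proof -
  note B = realizesD[OF assms(1)]
  obtain G g g' where G: "realizes C B G W g g' \<epsilon>" using ex_realization B(2) assms(2,3) by blast
  obtain E d e \<delta>'' where E: "E \<in> Ob C" "\<delta>'' \<in> carrier (Ext C E A)" "d \<in> Mor C Z E" "e \<in> Mor C E W"
    "(E,d,e) \<in> Rlz C W Z (Push C W B Z y \<epsilon>)" "Push C E A B x \<delta>'' = Pull C E W B e \<epsilon>"
    using ET4[OF B(1-3) assms(2) B(6,7) assms(3) realizesD(7)[OF G]] by blast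
  have "realizes C Z E W d e \<zero>\<^bsub>Ext C W Z\<^esub>"
    unfolding realizes_def using E(5) assms(2,4) B(3) Ext_zero_closed by simp
  then obtain s p where "biproduct C Z W E d s p e" by (rule realizes_split)
  then have s: "s \<in> Mor C W E" "Comp C W E W e s = One C W" by (auto simp: biproduct_def)
  have "\<epsilon> = Pull C W W B (Comp C W E W e s) \<epsilon>" using s Pull_One assms(2,3) B(2) by simp
  also have "\<dots> = Pull C W E B s (Push C E A B x \<delta>'')"
    using Pull_Comp[of W E W B e s \<epsilon>] s assms(2,3) B(2) E by simp
  also have "\<dots> = Push C W A B x (Pull C W E A s \<delta>'')"
    using Push_Pull[of E W A B s x \<delta>''] B E s assms(2) by simp
  finally show thesis using that[of "Pull C W E A s \<delta>''"] Pull_closed[OF E(1) assms(2) B(1) s(1) E(2)] by simp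
qed

lemma Ext_extension_zero:
  assumes "realizes C A B Z x y \<delta>" "W \<in> Ob C" "carrier (Ext C W A) = {\<zero>\<^bsub>Ext C W A\<^esub>}"
    and "carrier (Ext C W Z) = {\<zero>\<^bsub>Ext C W Z\<^esub>}"
  shows "carrier (Ext C W B) = {\<zero>\<^bsub>Ext C W B\<^esub>}"
proof -
  note B = realizesD[OF assms(1)]
  have "\<epsilon> = \<zero>\<^bsub>Ext C W B\<^esub>" if e: "\<epsilon> \<in> carrier (Ext C W B)" for \<epsilon>
  proof -
    have "Push C W B Z y \<epsilon> = \<zero>\<^bsub>Ext C W Z\<^esub>"
      using Push_closed[OF assms(2) B(2,3,5) e] assms(4) by simp
    then obtain \<eta> where "\<eta> \<in> carrier (Ext C W A)" "\<epsilon> = Push C W A B x \<eta>"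
      using Push_deflation_zero[OF assms(1,2) e] by blast
    then show ?thesis using assms(3) Push_zero[OF assms(2) B(1,2,4)] by simp
  qed
  then show ?thesis using Ext_zero_closed[OF assms(2) B(2)] by blast
qed

text \<open>Half of a five lemma. The map \<open>c' y\<close> lifts along \<open>y'\<close> to some
  \<open>s\<close> because the class it pulls back to is zero. The defect 1 - f s is annihilated by
  \<open>y\<close>, hence is of the form x k = f x' k, so adding x' k to \<open>s\<close> gives an
  honest section.\<close>

lemma realizes_morphism_section:
  assumes B: "realizes C A B Z x y \<delta>" and B': "realizes C A B' Z' x' y' \<delta>'"
    and c: "c \<in> Mor C Z' Z" "c' \<in> Mor C Z Z'" "Comp C Z Z' Z c c' = One C Z" "Comp C Z' Z Z' c' c = One C Z'"
    and d: "\<delta>' = Pull C Z' Z A c \<delta>"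
    and f: "f \<in> Mor C B' B" "Comp C A B' B f x' = x" "Comp C B' B Z y f = Comp C B' Z' Z c y'"
  obtains s where "s \<in> Mor C B B'" "Comp C B B' B f s = One C B"
proof -
  note b = realizesD[OF B] and b' = realizesD[OF B']
  interpret H: abelian_group "Hom C B B" using Hom_abelian_group b by simp
  have "Pull C B Z' A (Comp C B Z Z' c' y) \<delta>' = \<zero>\<^bsub>Ext C B A\<^esub>"
  proof -
    have "Pull C B Z' A (Comp C B Z Z' c' y) \<delta>' = Pull C B Z A (Comp C B Z' Z c (Comp C B Z Z' c' y)) \<delta>"
      using Pull_Comp[of Z Z' B A c "Comp C B Z Z' c' y" \<delta>] b b' c d by (simp add: Comp_closed)
    also have "Comp C B Z' Z c (Comp C B Z Z' c' y) = y"
      using Comp_assoc[of B Z Z' Z y c' c] b b' c by (simp add: Comp_One_left)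
    finally show ?thesis using Pull_deflation_zero[OF B] by simp
  qed
  then obtain s where s: "s \<in> Mor C B B'" "Comp C B B' Z' y' s = Comp C B Z Z' c' y"
    using Pull_zero_factor[OF B' b(2), of "Comp C B Z Z' c' y"] Comp_closed[of B Z Z' y c'] b b' c by blast
  let ?r = "One C B \<ominus>\<^bsub>Hom C B B\<^esub> Comp C B B' B f s"
  have fs: "Comp C B B' B f s \<in> Mor C B B" using b b' f s by (simp add: Comp_closed)
  have r: "?r \<in> Mor C B B" using fs b One_closed by (simp add: minus_closed)
  have "Comp C B B Z y (Comp C B B' B f s) = y"
    using Comp_assoc[of B B' B Z s f y] Comp_assoc[of B B' Z' Z s y' c] Comp_assoc[of B Z Z' Z y c' c]
      f s b b' c by (simp add: Comp_One_left)
  then have "Comp C B B Z y ?r = y \<ominus>\<^bsub>Hom C B Z\<^esub> y"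
    using Comp_minus_right[of B B Z y "One C B" "Comp C B B' B f s"] b fs One_closed
    by (simp add: Comp_One_right)
  also have "\<dots> = Zero C B Z"
    using abelian_group.minus_zero_iff[OF Hom_abelian_group[OF b(2,3)] b(5,5)] by simp
  finally obtain k where k: "k \<in> Mor C B A" "Comp C B A B x k = ?r"
    using Comp_zero_factor[OF B b(2) r] by blast
  let ?t = "Comp C B A B' x' k"
  have t: "?t \<in> Mor C B B'" using k b b' by (simp add: Comp_closed)
  have "Comp C B B' B f (?t \<oplus>\<^bsub>Hom C B B'\<^esub> s) = Comp C B B' B f ?t \<oplus>\<^bsub>Hom C B B\<^esub> Comp C B B' B f s"
    using Comp_add_right[of B B' B f ?t s] t s f b b' by simp
  also have "Comp C B B' B f ?t = ?r"
    using Comp_assoc[of B A B' B k x' f] f k b b' by simp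
  also have "?r \<oplus>\<^bsub>Hom C B B\<^esub> Comp C B B' B f s = One C B"
    using H.minus_add_cancel fs One_closed b by simp
  finally show thesis using that[of "?t \<oplus>\<^bsub>Hom C B B'\<^esub> s"] t s b b' by (simp add: add_closed)
qed

text \<open>The class has to be the pullback along the inverse of \<open>c\<close>, but its
  realisations are known only abstractly. One of them, \<open>B'\<close>, is compared with the given
  sequence by a map \<open>f\<close>, which is shown to have inverses on both sides; closure of
  \<open>Rlz\<close> under isomorphism then finishes.\<close>

lemma realizes_iso_right:
  assumes B: "realizes C A B Z x y \<delta>" and "iso_mor C Z Z' c" "Z' \<in> Ob C"
  obtains \<delta>' where "realizes C A B Z' x (Comp C B Z Z' c y) \<delta>'"
proof -
  note b = realizesD[OF B]
  obtain c' where c': "iso_mor C Z' Z c'" "Comp C Z Z' Z c' c = One C Z" "Comp C Z' Z Z' c c' = One C Z'"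
    using iso_mor_sym[OF assms(2)] .
  have m: "c \<in> Mor C Z Z'" "c' \<in> Mor C Z' Z" using assms(2) c'(1) by (auto simp: iso_mor_def)
  define \<delta>' where "\<delta>' = Pull C Z' Z A c' \<delta>"
  have d': "\<delta>' \<in> carrier (Ext C Z' A)" unfolding \<delta>'_def using b m assms(3) by (simp add: Pull_closed)
  obtain B' x' y' where B': "realizes C A B' Z' x' y' \<delta>'" using ex_realization[OF b(1) assms(3) d'] .
  note b' = realizesD[OF B']
  have "Push C Z' A A (One C A) \<delta>' = Pull C Z' Z A c' \<delta>" using Push_One[OF assms(3) b(1) d'] \<delta>'_def by simp
  then obtain f where f: "f \<in> Mor C B' B" "Comp C A B' B f x' = Comp C A A B x (One C A)"
    "Comp C B' B Z y f = Comp C B' Z' Z c' y'"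
    using Rlz_mor[OF assms(3) b(1,3,1) d' b(6) b'(7) b(7) One_closed[OF b(1)] m(2)] by blast
  then have fx: "Comp C A B' B f x' = x" using b by (simp add: Comp_One_right)
  obtain s where s: "s \<in> Mor C B B'" "Comp C B B' B f s = One C B"
    using realizes_morphism_section[OF B B' m(2,1) c'(2,3) \<delta>'_def f(1) fx f(3)] .
  \<comment> \<open>A comparison \<open>g\<close> in the other direction makes \<open>g f\<close> an
    endomorphism of \<open>B'\<close> over the identities of both ends. The preceding lemma, applied
    to it in the opposite category, yields a left inverse \<open>t\<close> of \<open>g f\<close>,
    and \<open>t g\<close> is then a left inverse of \<open>f\<close>.\<close>
  have sec: "\<exists>t. t \<in> Mor C B B' \<and> Comp C B' B B' t f = One C B'"
  proof -
    have "\<delta> = Pull C Z Z' A c \<delta>'" unfolding \<delta>'_def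
      using Pull_Comp[of Z Z' Z A c' c \<delta>] b m assms(3) c' by (simp add: Pull_One)
    then have "Push C Z A A (One C A) \<delta> = Pull C Z Z' A c \<delta>'" using Push_One[OF b(3,1,6)] by simp
    then obtain g where g: "g \<in> Mor C B B'" "Comp C A B B' g x = Comp C A A B' x' (One C A)"
      "Comp C B B' Z' y' g = Comp C B Z Z' c y"
      using Rlz_mor[OF b(3,1) assms(3) b(1,6) d' b(7) b'(7) One_closed[OF b(1)] m(1)] by blast
    then have gx: "Comp C A B B' g x = x'" using b b' by (simp add: Comp_One_right)
    have gf1: "Comp C B' B B' g f \<in> Mor C B' B'" using g f b b' by (simp add: Comp_closed)
    have gf2: "Comp C A B' B' (Comp C B' B B' g f) x' = x'"
      using Comp_assoc[of A B' B B' x' f g] fx gx g f b b' by simp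
    have gf3: "Comp C B' B' Z' y' (Comp C B' B B' g f) = Comp C B' Z' Z' (One C Z') y'"
      using Comp_assoc[of B' B B' Z' f g y'] Comp_assoc[of B' B Z Z' f y c] Comp_assoc[of B' Z' Z Z' y' c' c]
        f g b b' m c' by simp
    interpret op: extriangulated_category K "op_cat C" by (rule op_extriangulated)
    have 1: "realizes (op_cat C) Z' B' A y' x' \<delta>'" using B' by simp
    obtain t where t: "t \<in> Mor C B' B'" "Comp C B' B' B' t (Comp C B' B B' g f) = One C B'"
      by (rule op.realizes_morphism_section[OF 1 1, of "One C A" "One C A" "Comp C B' B B' g f"])
        (use b b' gf1 gf2 gf3 One_closed Comp_One_left Comp_One_right Push_One in auto)
    have "Comp C B' B B' (Comp C B B' B' t g) f = One C B'"
      using Comp_assoc[of B' B B' B' f g t] t f g b b' by simp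
    moreover have "Comp C B B' B' t g \<in> Mor C B B'" using t g b b' by (simp add: Comp_closed)
    ultimately show ?thesis by blast
  qed
  then obtain t where t: "t \<in> Mor C B B'" "Comp C B' B B' t f = One C B'" by blast
  have "t = Comp C B B' B' (Comp C B' B B' t f) s"
    using Comp_assoc[of B B' B B' s f t] s t f b b' by (simp add: Comp_One_right)
  also have "\<dots> = s" using t s b b' by (simp add: Comp_One_left)
  finally have "iso_mor C B' B f" unfolding iso_mor_def using f(1) s t by blast
  moreover have "Comp C B' B Z' (Comp C B Z Z' c y) f = y'"
    using Comp_assoc[of B' B Z Z' f y c] Comp_assoc[of B' Z' Z Z' y' c' c] f b b' m c' assms(3)
    by (simp add: Comp_One_left)
  ultimately have "(B, x, Comp C B Z Z' c y) \<in> Rlz C Z' A \<delta>'"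
    using Rlz_iso_closed[OF assms(3) b(1) d' b'(7) b(2), of "Comp C B Z Z' c y" f x] fx b m assms(3)
    by (simp add: Comp_closed)
  then show thesis using that[of \<delta>'] d' b(1) assms(3) by (simp add: realizes_def)
qed

end

section \<open>Pullbacks of conflations\<close>

lemma inflation_op [simp]: "inflation (op_cat C) X B x \<longleftrightarrow> deflation C B X x"
  and deflation_op [simp]: "deflation (op_cat C) B Z y \<longleftrightarrow> inflation C Z B y"
  unfolding inflation_def deflation_def conflation_op by (rule refl)+

lemma cluster_tilting_op [simp]: "cluster_tilting (op_cat C) T \<longleftrightarrow> cluster_tilting C T"
  unfolding cluster_tilting_def by (simp, blast)

context extriangulated_category
begin

text \<open>M is defined by the first conflation, and the second has to be recovered. An octahedron
  over M -> B1 -> Z gives a kernel E of M -> Z that is an extension of A1 by A2. This extension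
  splits, since its class is pulled back along y1 x1 = 0. A retraction \<open>r\<close> of E onto A2
  carries the class of M over Z to one that agrees with \<delta>2 after pulling back to B1, hence to
  \<delta>2 up to a class pushed forward from \<delta>1. Once \<open>r\<close> is corrected, a
  second octahedron, for A1 -> E -> M, has a third term realising \<delta>2, that is, B2.\<close>

lemma realizes_pullback:
  assumes B1: "realizes C A1 B1 Z x1 y1 \<delta>1" and B2: "realizes C A2 B2 Z x2 y2 \<delta>2"
  obtains M m2 e1 m1 e2 where "realizes C A2 M B1 m2 e1 (Pull C B1 Z A2 y1 \<delta>2)"
    "conflation C A1 M B2 m1 e2"
proof -
  note b1 = realizesD[OF B1] and b2 = realizesD[OF B2]
  let ?\<mu> = "Pull C B1 Z A2 y1 \<delta>2"
  have mu: "?\<mu> \<in> carrier (Ext C B1 A2)" using b1 b2 by (simp add: Pull_closed)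
  obtain M m2 e1 where M: "realizes C A2 M B1 m2 e1 ?\<mu>" using ex_realization[OF b2(1) b1(2) mu] .
  note m = realizesD[OF M]
  obtain E h d e \<delta> where E: "E \<in> Ob C" "h \<in> Mor C E M" "d \<in> Mor C A2 E" "e \<in> Mor C E A1"
      "\<delta> \<in> carrier (Ext C Z E)"
    and hR: "(M, h, Comp C M B1 Z y1 e1) \<in> Rlz C Z E \<delta>"
    and dR: "(E,d,e) \<in> Rlz C A1 A2 (Pull C A1 B1 A2 x1 ?\<mu>)"
    and e\<delta>: "Push C Z E A1 e \<delta> = \<delta>1"
    and d\<mu>: "Push C B1 A2 E d ?\<mu> = Pull C B1 Z E y1 \<delta>"
    using ET4_op[OF b1(2) b2(1) b1(1,3) mu m(7) b1(6,7)] by blast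
  have "Pull C A1 B1 A2 x1 ?\<mu> = \<zero>\<^bsub>Ext C A1 A2\<^esub>"
    using Pull_Comp[of Z B1 A1 A2 y1 x1 \<delta>2] b1 b2 realizes_comp_zero[OF B1] by (simp add: Pull_zero_mor)
  then have "realizes C A2 E A1 d e \<zero>\<^bsub>Ext C A1 A2\<^esub>"
    unfolding realizes_def using dR b1 b2 Ext_zero_closed by simp
  then obtain j r where bi: "biproduct C A2 A1 E d j r e" by (rule realizes_split)
  note s = bi[unfolded biproduct_def]
  have r\<delta>: "Push C Z E A2 r \<delta> \<in> carrier (Ext C Z A2)" using s b1 E by (simp add: Push_closed)
  have "Pull C B1 Z A2 y1 (Push C Z E A2 r \<delta>) = ?\<mu>"
  proof -
    have "Pull C B1 Z A2 y1 (Push C Z E A2 r \<delta>) = Push C B1 E A2 r (Push C B1 A2 E d ?\<mu>)"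
      unfolding d\<mu> by (rule Push_Pull[symmetric]) (use s b1 E in auto)
    also have "\<dots> = ?\<mu>"
      using Push_Comp[of B1 A2 E A2 d r ?\<mu>] Push_One[of B1 A2 ?\<mu>] s b1 mu by simp
    finally show ?thesis .
  qed
  then have "Pull C B1 Z A2 y1 (Push C Z E A2 r \<delta> \<ominus>\<^bsub>Ext C Z A2\<^esub> \<delta>2) = \<zero>\<^bsub>Ext C B1 A2\<^esub>"
    using Pull_minus[of Z B1 A2 y1 "Push C Z E A2 r \<delta>" \<delta>2] b1 b2 r\<delta> mu
      abelian_group.minus_zero_iff[OF Ext_abelian_group[of B1 A2]] by simp
  moreover have "Push C Z E A2 r \<delta> \<ominus>\<^bsub>Ext C Z A2\<^esub> \<delta>2 \<in> carrier (Ext C Z A2)"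
    using abelian_group.minus_closed[OF Ext_abelian_group] b1 b2 r\<delta> by simp
  ultimately obtain a where a: "a \<in> Mor C A1 A2"
      "Push C Z E A2 r \<delta> \<ominus>\<^bsub>Ext C Z A2\<^esub> \<delta>2 = Push C Z A1 A2 a \<delta>1"
    using Pull_zero_Push[OF B1 b2(1)] by metis
  \<comment> \<open>Correct the retraction so that it carries \<open>\<delta>\<close> to \<open>\<delta>2\<close>.\<close>
  define r' where "r' = r \<ominus>\<^bsub>Hom C E A2\<^esub> Comp C E A1 A2 a e"
  \<comment> \<open>The section has to absorb the change of retraction: with the summand d a the
    composite r' j' becomes a - a = 0, and the biproduct relations survive.\<close>
  define j' where "j' = j \<oplus>\<^bsub>Hom C A1 E\<^esub> Comp C A1 A2 E d a"
  interpret HE: abelian_group "Hom C E E" using Hom_abelian_group E by simp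
  interpret H12: abelian_group "Hom C A1 A2" using Hom_abelian_group s by simp
  interpret H22: abelian_group "Hom C A2 A2" using Hom_abelian_group s by simp
  interpret H11: abelian_group "Hom C A1 A1" using Hom_abelian_group s by simp
  interpret X2: abelian_group "Ext C Z A2" using Ext_abelian_group b1 b2 by simp
  have ae: "Comp C E A1 A2 a e \<in> Mor C E A2" and da: "Comp C A1 A2 E d a \<in> Mor C A1 E"
    using a s by (simp_all add: Comp_closed)
  have r': "r' \<in> Mor C E A2" and j': "j' \<in> Mor C A1 E"
    unfolding r'_def j'_def using s ae da by (simp_all add: minus_closed add_closed)
  have r'\<delta>: "Push C Z E A2 r' \<delta> = \<delta>2"
  proof -
    have "Push C Z E A2 r' \<delta> = Push C Z E A2 r \<delta> \<ominus>\<^bsub>Ext C Z A2\<^esub> Push C Z A1 A2 a \<delta>1"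
      unfolding r'_def using Push_minus_mor[of Z E A2 \<delta> r "Comp C E A1 A2 a e"] Push_Comp[of Z E A1 A2 e a \<delta>]
        b1 s E ae a e\<delta> by simp
    also have "\<dots> = \<delta>2"
      unfolding a(2)[symmetric] using r\<delta> b2(6)
      by (simp add: a_minus_def X2.minus_add X2.add.m_assoc[symmetric] X2.r_neg)
    finally show ?thesis .
  qed
  have e0: "Comp C A2 A1 A2 a (Comp C A2 E A1 e d) = Zero C A2 A2" using s a by (simp add: Comp_Zero_right)
  have 1: "Comp C A2 E A2 r' d = One C A2"
    unfolding r'_def using Comp_minus_left[of A2 E A2 d r "Comp C E A1 A2 a e"]
      Comp_assoc[of A2 E A1 A2 d e a] s ae a e0 One_closed by (simp add: a_minus_def)
  have ej: "Comp C A1 E A1 e j' = One C A1"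
  proof -
    have "Comp C A1 E A1 e (Comp C A1 A2 E d a) = Zero C A1 A1"
      using Comp_assoc[of A1 A2 E A1 a d e] s a by (simp add: Comp_Zero_left)
    then show ?thesis unfolding j'_def
      using Comp_add_right[of A1 E A1 e j "Comp C A1 A2 E d a"] s da One_closed by simp
  qed
  have rj: "Comp C A1 E A2 r' j' = Zero C A1 A2"
  proof -
    have "Comp C A1 E A2 r' j' = Comp C A1 E A2 r j' \<ominus>\<^bsub>Hom C A1 A2\<^esub> Comp C A1 A1 A2 a (Comp C A1 E A1 e j')"
      unfolding r'_def using Comp_minus_left[of A1 E A2 j' r "Comp C E A1 A2 a e"]
        Comp_assoc[of A1 E A1 A2 j' e a] s ae a j' by simp
    also have "Comp C A1 E A2 r j' = a"
      unfolding j'_def using Comp_add_right[of A1 E A2 r j "Comp C A1 A2 E d a"]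
        Comp_assoc[of A1 A2 E A2 a d r] s da a Comp_One_left[of A1 A2 a] by simp
    finally show ?thesis unfolding ej using a(1) s H12.minus_zero_iff by (simp add: Comp_One_right)
  qed
  have sum: "Comp C E A1 E j' e \<oplus>\<^bsub>Hom C E E\<^esub> Comp C E A2 E d r' = One C E"
  proof -
    let ?t = "Comp C E A2 E d (Comp C E A1 A2 a e)"
    have t: "?t \<in> Mor C E E" "Comp C E A1 E j e \<in> Mor C E E" "Comp C E A2 E d r \<in> Mor C E E"
      using ae s by (simp_all add: Comp_closed)
    have "Comp C E A1 E j' e = Comp C E A1 E j e \<oplus>\<^bsub>Hom C E E\<^esub> ?t"
      unfolding j'_def using Comp_add_left[of E A1 E e j "Comp C A1 A2 E d a"]
        Comp_assoc[of E A1 A2 E e a d] s da a by simp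
    moreover have "Comp C E A2 E d r' = Comp C E A2 E d r \<ominus>\<^bsub>Hom C E E\<^esub> ?t"
      unfolding r'_def using Comp_minus_right[of E A2 E d r "Comp C E A1 A2 a e"] s ae by simp
    ultimately have "Comp C E A1 E j' e \<oplus>\<^bsub>Hom C E E\<^esub> Comp C E A2 E d r'
        = Comp C E A2 E d r \<oplus>\<^bsub>Hom C E E\<^esub> Comp C E A1 E j e"
      using t by (simp add: a_minus_def HE.add.m_ac HE.r_neg)
    then show ?thesis using s by simp
  qed
  have ed: "Comp C A2 E A1 e d = Zero C A2 A1" using s by simp
  have "biproduct C A1 A2 E j' d e r'"
    unfolding biproduct_def using s r' j' 1 ej rj sum by simp
  note sp = realizesD[OF realizes_biproduct[OF this]]
  \<comment> \<open>E is now read as an extension of A2 by A1, so the octahedron divides M by A1. By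
    the choice of \<open>r'\<close> the quotient \<open>E'\<close> realises \<delta>2, and so it is
    isomorphic to B2.\<close>
  obtain E' hh d2 e2 \<epsilon> where E': "E' \<in> Ob C" "\<epsilon> \<in> carrier (Ext C E' A1)"
     "(M, Comp C A1 E M h j', hh) \<in> Rlz C E' A1 \<epsilon>" "(E',d2,e2) \<in> Rlz C Z A2 (Push C Z E A2 r' \<delta>)"
    using ET4[OF b1(1) E(1) b2(1) b1(3) sp(6,7) E(5) hR] by blast
  obtain c where c: "iso_mor C E' B2 c"
    using Rlz_iso_middle[OF b2(3,1,6) E'(4)[unfolded r'\<delta>] b2(7)] .
  have "realizes C A1 M E' (Comp C A1 E M h j') hh \<epsilon>"
    unfolding realizes_def using b1 E' by simp
  from realizes_iso_right[OF this c b2(2)] obtain \<delta>' where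
    "realizes C A1 M B2 (Comp C A1 E M h j') (Comp C M E' B2 c hh) \<delta>'" .
  then show thesis using that[OF M] conflation_iff by metis
qed

lemma conflation_pullback:
  assumes "conflation C A1 B1 Z x1 y1" "conflation C A2 B2 Z x2 y2"
  obtains M m2 e1 m1 e2 where "conflation C A2 M B1 m2 e1" "conflation C A1 M B2 m1 e2"
  using assms realizes_pullback unfolding conflation_iff by metis

lemma conflation_pushout:
  assumes "conflation C A B1 Z1 x1 y1" "conflation C A B2 Z2 x2 y2"
  obtains M m2 e1 m1 e2 where "conflation C B1 M Z2 m1 e2" "conflation C B2 M Z1 m2 e1"
proof -
  interpret op: extriangulated_category K "op_cat C" by (rule op_extriangulated)
  obtain M m2 e1 m1 e2 where "conflation (op_cat C) Z2 M B1 m2 e1" "conflation (op_cat C) Z1 M B2 m1 e2"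
    using op.conflation_pullback[of Z1 B1 A y1 x1 Z2 B2 y2 x2] assms unfolding conflation_op by blast
  then show thesis using that by simp
qed

end

section \<open>Cluster-tilting subcategories and their approximations\<close>

locale cluster_tilting_sub = extriangulated_category K C
  for K :: "'k ring" and C :: "('o,'m,'k,'e) extcat" +
  fixes T :: "'o set"
  assumes ct: "cluster_tilting C T"
begin

lemma op_ct: "cluster_tilting_sub K (op_cat C) T"
  by (simp add: cluster_tilting_sub_def cluster_tilting_sub_axioms_def op_extriangulated ct)

lemma T_Ob: "X \<in> T \<Longrightarrow> X \<in> Ob C"
  using ct by (auto simp: cluster_tilting_def)

lemma T_rigid: "X \<in> T \<Longrightarrow> Y \<in> T \<Longrightarrow> carrier (Ext C X Y) = {\<zero>\<^bsub>Ext C X Y\<^esub>}"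
  using ct unfolding cluster_tilting_def by blast

lemma T_rightI: "X \<in> Ob C \<Longrightarrow> (\<And>R. R \<in> T \<Longrightarrow> carrier (Ext C R X) = {\<zero>\<^bsub>Ext C R X\<^esub>}) \<Longrightarrow> X \<in> T"
  using ct unfolding cluster_tilting_def by blast

lemma injective_T: "I \<in> injectives C \<Longrightarrow> I \<in> T"
  by (rule T_rightI) (auto simp: injectives_def T_Ob)

lemma T_extension:
  assumes "conflation C A B Z x y" "A \<in> T" "Z \<in> T"
  shows "B \<in> T" "\<exists>j p. biproduct C A Z B x j p y"
proof -
  obtain \<delta> where \<delta>: "realizes C A B Z x y \<delta>" using assms conflation_iff by metis
  show "B \<in> T"
    by (rule T_rightI) (use Ext_extension_zero[OF \<delta>] realizesD[OF \<delta>] T_rigid assms T_Ob in auto)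
  have "\<delta> = \<zero>\<^bsub>Ext C Z A\<^esub>" using realizesD(6)[OF \<delta>] T_rigid[OF assms(3,2)] by simp
  then show "\<exists>j p. biproduct C A Z B x j p y" using \<delta> realizes_split by metis
qed

text \<open>The point is that the kernel L of an approximation R -> X lies in \<open>T\<close>. An
  extension of V in \<open>T\<close> by L dies in Ext(V,R) = 0, so it is pulled back along some V ->
  X. That map factors through R because R is an approximation, hence the extension is zero.\<close>

lemma ex_index_conflation:
  assumes X: "X \<in> Ob C"
  obtains L R i p where "L \<in> T" "R \<in> T" "conflation C L R X i p"
proof -
  have "\<exists>R\<in>T. \<exists>f\<in>Mor C R X. deflation C R X f \<and>
        (\<forall>L\<in>T. \<forall>g\<in>Mor C L X. \<exists>h\<in>Mor C L R. g = Comp C L R X f h)"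
    using ct X unfolding cluster_tilting_def by blast
  then obtain R f L i where R: "R \<in> T" "conflation C L R X i f"
    and lift: "\<And>V g. V \<in> T \<Longrightarrow> g \<in> Mor C V X \<Longrightarrow> \<exists>h\<in>Mor C V R. g = Comp C V R X f h"
    unfolding deflation_def by blast
  obtain \<delta> where \<delta>: "realizes C L R X i f \<delta>" using R conflation_iff by metis
  note d = realizesD[OF \<delta>]
  have "\<epsilon> = \<zero>\<^bsub>Ext C V L\<^esub>" if V: "V \<in> T" and e: "\<epsilon> \<in> carrier (Ext C V L)" for V \<epsilon>
  proof -
    have "Push C V L R i \<epsilon> = \<zero>\<^bsub>Ext C V R\<^esub>"
      using Push_closed[OF T_Ob[OF V] d(1,2,4) e] T_rigid[OF V R(1)] by simp
    then obtain c where c: "c \<in> Mor C V X" "\<epsilon> = Pull C V X L c \<delta>"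
      using Push_zero_Pull[OF \<delta> T_Ob[OF V] e] by blast
    then show ?thesis using lift[OF V c(1)] Pull_factor_zero[OF \<delta> T_Ob[OF V]] by auto
  qed
  then have "L \<in> T"
    using T_rightI[OF d(1)] Ext_zero_closed[OF T_Ob d(1)] by blast
  then show thesis using that R by blast
qed

lemma ex_coindex_conflation:
  assumes X: "X \<in> Ob C"
  obtains L R i p where "L \<in> T" "R \<in> T" "conflation C X L R i p"
proof -
  interpret op: cluster_tilting_sub K "op_cat C" T by (rule op_ct)
  obtain L R i p where "L \<in> T" "R \<in> T" "conflation (op_cat C) L R X i p"
    using op.ex_index_conflation[of X] X unfolding op_cat_simps by blast
  then show thesis using that unfolding conflation_op by blast
qed

end

section \<open>Presented groups, index and coindex\<close>

locale group_presentation =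
  fixes S :: "'a set" and R :: "('a \<Rightarrow>\<^sub>0 int) set"
  assumes relator_keys: "r \<in> R \<Longrightarrow> Poly_Mapping.keys r \<subseteq> S"
begin

definition H :: "('a \<Rightarrow>\<^sub>0 int) set" where "H = generate (free_Abelian_group S) R"

definition cls :: "('a \<Rightarrow>\<^sub>0 int) \<Rightarrow> ('a \<Rightarrow>\<^sub>0 int) set" where
  "cls z = H #>\<^bsub>free_Abelian_group S\<^esub> z"

text \<open>Index computations take place in the additive group of integral combinations modulo this
  congruence, where simp handles the arithmetic. They pass to cosets only at the end, by
  \<open>cls_eqI\<close>.\<close>

definition eqv :: "('a \<Rightarrow>\<^sub>0 int) \<Rightarrow> ('a \<Rightarrow>\<^sub>0 int) \<Rightarrow> bool" (infix "\<simeq>" 50) where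
  "z \<simeq> w \<longleftrightarrow> z - w \<in> H"

abbreviation frags :: "('a \<Rightarrow>\<^sub>0 int) set" where "frags \<equiv> {z. Poly_Mapping.keys z \<subseteq> S}"

sublocale F: comm_group "free_Abelian_group S"
  by (rule abelian_free_Abelian_group)

lemma H_subgroup: "subgroup H (free_Abelian_group S)"
  unfolding H_def by (rule F.generate_is_subgroup) (use relator_keys in auto)

sublocale N: normal H "free_Abelian_group S"
  using F.normal_iff_subgroup H_subgroup by blast

lemma relator_H: "r \<in> R \<Longrightarrow> r \<in> H"
  unfolding H_def by (rule generate.incl)

lemma H_zero: "0 \<in> H"
  using subgroup.one_closed[OF H_subgroup] by simp

lemma H_keys: "z \<in> H \<Longrightarrow> Poly_Mapping.keys z \<subseteq> S"
  using subgroup.mem_carrier[OF H_subgroup] by simp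

lemma H_add: "z \<in> H \<Longrightarrow> w \<in> H \<Longrightarrow> z + w \<in> H"
  using subgroup.m_closed[OF H_subgroup] by simp

lemma H_uminus: "z \<in> H \<Longrightarrow> - z \<in> H"
  using subgroup.m_inv_closed[OF H_subgroup] H_keys by simp

lemma eqv_refl: "z \<simeq> z" by (simp add: eqv_def H_zero)

lemma eqv_sym: "z \<simeq> w \<Longrightarrow> w \<simeq> z"
  unfolding eqv_def using H_uminus by fastforce

lemma eqv_trans [trans]: "z \<simeq> w \<Longrightarrow> w \<simeq> v \<Longrightarrow> z \<simeq> v"
  unfolding eqv_def using H_add by fastforce

lemma eqv_add: "z \<simeq> w \<Longrightarrow> z' \<simeq> w' \<Longrightarrow> z + z' \<simeq> w + w'"
  unfolding eqv_def using H_add[of "z - w" "z' - w'"] by (simp add: algebra_simps)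

lemma eqv_diff: "z \<simeq> w \<Longrightarrow> z' \<simeq> w' \<Longrightarrow> z - z' \<simeq> w - w'"
  unfolding eqv_def using H_add[of "z - w" "- (z' - w')"] H_uminus[of "z' - w'"]
  by (simp add: algebra_simps)

lemma cls_eqI:
  assumes "z \<in> frags" "w \<in> frags" "z \<simeq> w"
  shows "cls z = cls w"
proof -
  have "z = (z - w) \<otimes>\<^bsub>free_Abelian_group S\<^esub> w" by simp
  then have "z \<in> H #>\<^bsub>free_Abelian_group S\<^esub> w"
    using assms(3) unfolding eqv_def r_coset_def by blast
  then show ?thesis unfolding cls_def using F.repr_independence[OF _ _ H_subgroup] assms(2) by simp
qed

lemma presented_class_eq: "presented_class S R a = cls (frag_of a)"
  by (simp add: presented_class_def cls_def H_def)

lemma presented_group_eq: "presented_group S R = free_Abelian_group S Mod H"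
  by (simp add: presented_group_def H_def)

lemma carrier_presented: "carrier (presented_group S R) = cls ` frags"
  unfolding presented_group_eq carrier_FactGroup cls_def by (auto simp: free_Abelian_group_def)

lemma cls_closed: "z \<in> frags \<Longrightarrow> cls z \<in> carrier (presented_group S R)"
  by (simp add: carrier_presented)

sublocale P: comm_group "presented_group S R"
  unfolding presented_group_eq using F.abelian_FactGroup[OF H_subgroup] .

lemma cls_mult: "z \<in> frags \<Longrightarrow> w \<in> frags \<Longrightarrow> cls z \<otimes>\<^bsub>presented_group S R\<^esub> cls w = cls (z + w)"
  unfolding presented_group_eq cls_def using N.rcos_sum[of z w] by simp

lemma frags_diff: "z \<in> frags \<Longrightarrow> w \<in> frags \<Longrightarrow> z - w \<in> frags"
  using keys_diff[of z w] by auto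

lemma cls_diff:
  assumes "z \<in> frags" "w \<in> frags"
  shows "group_diff (presented_group S R) (cls z) (cls w) = cls (z - w)"
proof -
  have "cls (z - w) \<otimes>\<^bsub>presented_group S R\<^esub> cls w = cls z"
    using cls_mult[OF frags_diff[OF assms] assms(2)] by simp
  then show ?thesis unfolding group_diff_def
    using P.inv_solve_right[of "cls (z - w)" "cls z" "cls w"] cls_closed assms frags_diff by metis
qed

lemma hom_eqI:
  assumes "h \<in> hom (presented_group S R) G" "h' \<in> hom (presented_group S R) G" "group G"
    and eq: "\<And>a. a \<in> S \<Longrightarrow> h (presented_class S R a) = h' (presented_class S R a)"
    and "x \<in> carrier (presented_group S R)"
  shows "h x = h' x"
proof -
  interpret h: group_hom "presented_group S R" G h
    using assms by (simp add: group_hom_def group_hom_axioms_def)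
  interpret h': group_hom "presented_group S R" G h'
    using assms by (simp add: group_hom_def group_hom_axioms_def)
  have 0: "cls 0 = \<one>\<^bsub>presented_group S R\<^esub>"
    using cls_mult[of 0 0] cls_closed[of 0] P.r_cancel_one by simp
  have "h (cls z) = h' (cls z)" if "Poly_Mapping.keys z \<subseteq> S" for z
  proof (rule free_Abelian_group_induct[OF that])
    show "h (cls 0) = h' (cls 0)" by (simp add: 0)
  next
    fix y z :: "'a \<Rightarrow>\<^sub>0 int"
    assume yz: "Poly_Mapping.keys y \<subseteq> S" "Poly_Mapping.keys z \<subseteq> S"
      and IH: "h (cls y) = h' (cls y)" "h (cls z) = h' (cls z)"
    have "cls (y - z) = cls y \<otimes>\<^bsub>presented_group S R\<^esub> inv\<^bsub>presented_group S R\<^esub> cls z"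
      using cls_diff[of y z] yz by (simp add: group_diff_def)
    with yz IH show "h (cls (y - z)) = h' (cls (y - z))" by (simp add: cls_closed)
  next
    fix a assume "a \<in> S"
    then show "h (cls (frag_of a)) = h' (cls (frag_of a))" using eq by (simp add: presented_class_eq)
  qed
  then show ?thesis using assms(5) by (auto simp: carrier_presented)
qed

end

lemma biproduct_full_sub:
  "biproduct (full_sub C T) A B S i j p q \<longleftrightarrow> A \<in> T \<and> B \<in> T \<and> S \<in> T \<and>
     i \<in> Mor C A S \<and> j \<in> Mor C B S \<and> p \<in> Mor C S A \<and> q \<in> Mor C S B \<and>
     Comp C A S A p i = One C A \<and> Comp C B S B q j = One C B \<and>
     Comp C B S A p j = Zero C B A \<and> Comp C A S B q i = Zero C A B \<and>
     Comp C S A S i p \<oplus>\<^bsub>Hom C S S\<^esub> Comp C S B S j q = One C S"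
  by (simp add: biproduct_def full_sub_def)

text \<open>Exchanging inclusions and projections makes the relators of both categories literally
  equal, so a congruence obtained in the opposite category holds here unchanged.\<close>

lemma split_relators_op: "split_relators (full_sub (op_cat C) T) = split_relators (full_sub C T)"
proof -
  have "biproduct (full_sub (op_cat C) T) A B S i j p q \<longleftrightarrow> biproduct (full_sub C T) A B S p q i j"
    for A B S i j p q
    by (auto simp: biproduct_full_sub)
  then have "(\<exists>i j p q. biproduct (full_sub (op_cat C) T) A B S i j p q) \<longleftrightarrow>
      (\<exists>i j p q. biproduct (full_sub C T) A B S i j p q)" for A B S
    by blast
  then show ?thesis unfolding split_relators_def by simp
qed

section \<open>Index and coindex modulo the split relators\<close>

context cluster_tilting_sub
begin

sublocale G: group_presentation T "split_relators (full_sub C T)"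
proof
  fix r assume "r \<in> split_relators (full_sub C T)"
  then obtain S X Y where r: "r = frag_of S - frag_of X - frag_of Y" "S \<in> T" "X \<in> T" "Y \<in> T"
    unfolding split_relators_def biproduct_full_sub by blast
  then show "Poly_Mapping.keys r \<subseteq> T"
    using keys_diff[of "frag_of S - frag_of X" "frag_of Y"] keys_diff[of "frag_of S" "frag_of X"] by auto
qed

notation G.eqv (infix "\<simeq>" 50)

lemma K0_split_eq: "K0_split (full_sub C T) = presented_group T (split_relators (full_sub C T))"
  by (simp add: K0_split_def full_sub_def)

lemma obj_class_eq: "obj_class (full_sub C T) X = G.cls (frag_of X)"
  using G.presented_class_eq by (simp add: obj_class_def full_sub_def)

text \<open>A relation rather than a function, so that whichever conflation a construction produces
  can be used. \<open>index_unique\<close> gives independence of the conflation up to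
  \<open>\<simeq>\<close>, and \<open>ind_eq\<close> connects it with the choice made in
  \<open>ind\<close>.\<close>

definition is_index :: "'o \<Rightarrow> ('o \<Rightarrow>\<^sub>0 int) \<Rightarrow> bool" where
  "is_index X z \<longleftrightarrow> (\<exists>L\<in>T. \<exists>R\<in>T. \<exists>i p. conflation C L R X i p \<and> z = frag_of R - frag_of L)"

definition is_coindex :: "'o \<Rightarrow> ('o \<Rightarrow>\<^sub>0 int) \<Rightarrow> bool" where
  "is_coindex X z \<longleftrightarrow> (\<exists>L\<in>T. \<exists>R\<in>T. \<exists>i p. conflation C X L R i p \<and> z = frag_of L - frag_of R)"

lemma is_indexI: "L \<in> T \<Longrightarrow> R \<in> T \<Longrightarrow> conflation C L R X i p \<Longrightarrow> is_index X (frag_of R - frag_of L)"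
  by (auto simp: is_index_def)

lemma is_coindexI: "L \<in> T \<Longrightarrow> R \<in> T \<Longrightarrow> conflation C X L R i p \<Longrightarrow> is_coindex X (frag_of L - frag_of R)"
  by (auto simp: is_coindex_def)

lemma index_frags: "is_index X z \<Longrightarrow> z \<in> G.frags"
  and coindex_frags: "is_coindex X z \<Longrightarrow> z \<in> G.frags"
  unfolding is_index_def is_coindex_def using keys_diff by fastforce+

lemma ex_index: "X \<in> Ob C \<Longrightarrow> \<exists>z. is_index X z"
  using ex_index_conflation[of X] unfolding is_index_def by metis

lemma ex_coindex: "X \<in> Ob C \<Longrightarrow> \<exists>z. is_coindex X z"
  using ex_coindex_conflation[of X] unfolding is_coindex_def by metis

lemma frag_of_extension:
  assumes "conflation C A B Z x y" "A \<in> T" "Z \<in> T"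
  shows "frag_of B \<simeq> frag_of A + frag_of Z"
proof -
  have "frag_of B - frag_of A - frag_of Z \<in> split_relators (full_sub C T)"
  proof -
    obtain j p where "biproduct C A Z B x j p y" using T_extension(2)[OF assms] by blast
    note this[unfolded biproduct_def]
    then have "biproduct (full_sub C T) A Z B x j p y"
      using T_extension(1)[OF assms] assms(2,3) by (simp add: biproduct_full_sub)
    then show ?thesis unfolding split_relators_def by blast
  qed
  from G.relator_H[OF this] show ?thesis by (simp add: G.eqv_def diff_diff_eq)
qed

text \<open>Pull the index conflation L -> R -> X back along B -> X. The new middle term M is an
  extension of R by A, so it lies in \<open>T\<close> with class [A] + [R], and L -> M -> B is an
  index conflation of B.\<close>

lemma index_extension:
  assumes "conflation C A B X x y" "A \<in> T" "is_index X z"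
  shows "\<exists>w. is_index B w \<and> w \<simeq> z + frag_of A"
proof -
  obtain L R i p where R: "L \<in> T" "R \<in> T" "conflation C L R X i p" "z = frag_of R - frag_of L"
    using assms(3) by (auto simp: is_index_def)
  obtain M m2 e1 m1 e2 where M: "conflation C A M R m2 e1" "conflation C L M B m1 e2"
    using conflation_pullback[OF R(3) assms(1)] .
  have "M \<in> T" using T_extension(1)[OF M(1)] assms R by blast
  then have "is_index B (frag_of M - frag_of L)" using is_indexI M R by blast
  moreover have "frag_of M - frag_of L \<simeq> frag_of A + frag_of R - frag_of L"
    by (rule G.eqv_diff[OF frag_of_extension[OF M(1) assms(2) R(2)] G.eqv_refl])
  moreover have "frag_of A + frag_of R - frag_of L = z + frag_of A" using R(4) by simp
  ultimately show ?thesis by auto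
qed

text \<open>Schanuel's argument: the pullback of the two deflations is an extension of R by L' and
  also of R' by L. Both extensions split in \<open>T\<close>, so [L'] + [R] = [L] + [R'].\<close>

lemma index_unique:
  assumes "is_index X z" "is_index X w"
  shows "z \<simeq> w"
proof -
  obtain L R i p where R: "L \<in> T" "R \<in> T" "conflation C L R X i p" "z = frag_of R - frag_of L"
    using assms(1) by (auto simp: is_index_def)
  obtain L' R' i' p' where R': "L' \<in> T" "R' \<in> T" "conflation C L' R' X i' p'" "w = frag_of R' - frag_of L'"
    using assms(2) by (auto simp: is_index_def)
  obtain M m2 e1 m1 e2 where M: "conflation C L' M R m2 e1" "conflation C L M R' m1 e2"
    using conflation_pullback[OF R(3) R'(3)] .
  have "frag_of L' + frag_of R \<simeq> frag_of L + frag_of R'"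
    by (rule G.eqv_trans[OF G.eqv_sym[OF frag_of_extension[OF M(1)]] frag_of_extension[OF M(2)]])
      (use R R' in auto)
  from G.eqv_diff[OF this G.eqv_refl[of "frag_of L + frag_of L'"]]
  have "frag_of L' + frag_of R - (frag_of L + frag_of L') \<simeq> frag_of L + frag_of R' - (frag_of L + frag_of L')" .
  moreover have "frag_of L' + frag_of R - (frag_of L + frag_of L') = z"
    "frag_of L + frag_of R' - (frag_of L + frag_of L') = w"
    using R(4) R'(4) by simp_all
  ultimately show ?thesis by simp
qed

lemma op_is_index: "cluster_tilting_sub.is_index (op_cat C) T X z \<longleftrightarrow> is_coindex X z"
  using cluster_tilting_sub.is_index_def[OF op_ct] unfolding is_coindex_def conflation_op by blast

lemma op_eqv: "group_presentation.eqv T (split_relators (full_sub (op_cat C) T)) z w \<longleftrightarrow> z \<simeq> w"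
  by (simp add: split_relators_op)

lemma coindex_extension:
  assumes "conflation C X B A x y" "A \<in> T" "is_coindex X z"
  shows "\<exists>w. is_coindex B w \<and> w \<simeq> z + frag_of A"
  using cluster_tilting_sub.index_extension[OF op_ct, of A B X y x z] assms by (simp add: op_is_index op_eqv)

lemma coindex_unique: "is_coindex X z \<Longrightarrow> is_coindex X w \<Longrightarrow> z \<simeq> w"
  using cluster_tilting_sub.index_unique[OF op_ct, of X z w] by (simp add: op_is_index op_eqv)

text \<open>Pushing the coindex conflation X -> L -> R out along X -> I produces I -> M -> R, whose
  terms lie in \<open>T\<close>, and the index conflation L -> M -> Y. This is how coindices become
  indices one step further along.\<close>

lemma index_cosyzygy:
  assumes "conflation C X I Y x y" "I \<in> T" "is_coindex X z"
  shows "\<exists>w. is_index Y w \<and> w \<simeq> frag_of I - z"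
proof -
  obtain L R i p where R: "L \<in> T" "R \<in> T" "conflation C X L R i p" "z = frag_of L - frag_of R"
    using assms(3) by (auto simp: is_coindex_def)
  obtain M m2 e1 m1 e2 where M: "conflation C I M R m1 e2" "conflation C L M Y m2 e1"
    using conflation_pushout[OF assms(1) R(3)] .
  have "M \<in> T" using T_extension(1)[OF M(1)] assms R by blast
  then have "is_index Y (frag_of M - frag_of L)" using is_indexI M R by blast
  moreover have "frag_of M - frag_of L \<simeq> frag_of I + frag_of R - frag_of L"
    by (rule G.eqv_diff[OF frag_of_extension[OF M(1) assms(2) R(2)] G.eqv_refl])
  moreover have "frag_of I + frag_of R - frag_of L = frag_of I - z" using R(4) by simp
  ultimately show ?thesis by auto
qed

lemma ind_eq:
  assumes "X \<in> Ob C" "is_index X z"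
  shows "ind C T X = G.cls z"
proof -
  obtain L R i p where s: "index_conflation C T X = (L,R,i,p)"
    by (rule prod_cases4)
  have "\<exists>s. case s of (L,R,i,p) \<Rightarrow> L \<in> T \<and> R \<in> T \<and> conflation C L R X i p"
  proof -
    obtain L R i p where "L \<in> T" "R \<in> T" "conflation C L R X i p"
      using ex_index_conflation[OF assms(1)] .
    then show ?thesis by (intro exI[of _ "(L,R,i,p)"]) simp
  qed
  from someI_ex[OF this] have "case index_conflation C T X of (L,R,i,p) \<Rightarrow> L \<in> T \<and> R \<in> T \<and> conflation C L R X i p"
    unfolding index_conflation_def .
  then have R: "L \<in> T" "R \<in> T" "conflation C L R X i p" using s by simp_all
  note i = is_indexI[OF R]
  have "G.cls (frag_of R - frag_of L) = G.cls z"
    by (rule G.cls_eqI[OF index_frags[OF i] index_frags[OF assms(2)] index_unique[OF i assms(2)]])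
  then show ?thesis using R by (simp add: ind_def s K0_split_eq obj_class_eq G.cls_diff)
qed

lemma coind_eq:
  assumes "X \<in> Ob C" "is_coindex X z"
  shows "coind C T X = G.cls z"
proof -
  obtain L R i p where s: "coindex_conflation C T X = (L,R,i,p)"
    by (rule prod_cases4)
  have "\<exists>s. case s of (L,R,i,p) \<Rightarrow> L \<in> T \<and> R \<in> T \<and> conflation C X L R i p"
  proof -
    obtain L R i p where "L \<in> T" "R \<in> T" "conflation C X L R i p"
      using ex_coindex_conflation[OF assms(1)] .
    then show ?thesis by (intro exI[of _ "(L,R,i,p)"]) simp
  qed
  from someI_ex[OF this] have "case coindex_conflation C T X of (L,R,i,p) \<Rightarrow> L \<in> T \<and> R \<in> T \<and> conflation C X L R i p"
    unfolding coindex_conflation_def .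
  then have R: "L \<in> T" "R \<in> T" "conflation C X L R i p" using s by simp_all
  note i = is_coindexI[OF R]
  have "G.cls (frag_of L - frag_of R) = G.cls z"
    by (rule G.cls_eqI[OF coindex_frags[OF i] coindex_frags[OF assms(2)] coindex_unique[OF i assms(2)]])
  then show ?thesis using R by (simp add: coind_def s K0_split_eq obj_class_eq G.cls_diff)
qed

end

section \<open>Kernels and cokernels of Ext\<close>

context extriangulated_category
begin

lemma Push_injI:
  assumes "realizes C A B Z x y \<delta>" "W \<in> Ob C" "carrier (Ext C W A) = {\<zero>\<^bsub>Ext C W A\<^esub>}"
  shows "inj_on (Push C W B Z y) (carrier (Ext C W B))"
proof (rule inj_onI)
  note b = realizesD[OF assms(1)]
  interpret B: abelian_group "Ext C W B" using Ext_abelian_group assms(2) b by simp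
  interpret Z: abelian_group "Ext C W Z" using Ext_abelian_group assms(2) b by simp
  fix \<epsilon> \<eta> assume e: "\<epsilon> \<in> carrier (Ext C W B)" "\<eta> \<in> carrier (Ext C W B)"
    "Push C W B Z y \<epsilon> = Push C W B Z y \<eta>"
  have "Push C W B Z y (\<epsilon> \<ominus>\<^bsub>Ext C W B\<^esub> \<eta>) = \<zero>\<^bsub>Ext C W Z\<^esub>"
    using lin_map_minus[OF Ext_module Ext_module Push_linear, of W B Z y \<epsilon> \<eta>] assms(2) b e
      Z.minus_zero_iff Push_closed by simp
  then obtain \<xi> where "\<xi> \<in> carrier (Ext C W A)" "\<epsilon> \<ominus>\<^bsub>Ext C W B\<^esub> \<eta> = Push C W A B x \<xi>"
    using Push_deflation_zero[OF assms(1,2)] e B.minus_closed by metis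
  then have "\<epsilon> \<ominus>\<^bsub>Ext C W B\<^esub> \<eta> = \<zero>\<^bsub>Ext C W B\<^esub>"
    using assms(2,3) Push_zero[OF assms(2) b(1,2,4)] by simp
  then show "\<epsilon> = \<eta>" using B.minus_zero_iff e by simp
qed

end

context cluster_tilting_sub
begin

text \<open>The lifting property holds for any index conflation, whether or not it came from an
  approximation: the obstruction to lifting V -> X lies in Ext(V,L), which vanishes by
  rigidity.\<close>

lemma ex_index_realization:
  assumes "X \<in> Ob C"
  obtains L R i p \<kappa> where "L \<in> T" "R \<in> T" "realizes C L R X i p \<kappa>"
    "\<And>V c. V \<in> T \<Longrightarrow> c \<in> Mor C V X \<Longrightarrow> \<exists>g\<in>Mor C V R. Comp C V R X p g = c"
proof -
  obtain L R i p \<kappa> where R: "L \<in> T" "R \<in> T" "realizes C L R X i p \<kappa>"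
    using ex_index_conflation[OF assms] conflation_iff by metis
  have "\<exists>g\<in>Mor C V R. Comp C V R X p g = c" if V: "V \<in> T" and c: "c \<in> Mor C V X" for V c
  proof -
    have "Pull C V X L c \<kappa> = \<zero>\<^bsub>Ext C V L\<^esub>"
      using Pull_closed[OF assms T_Ob[OF V] T_Ob[OF R(1)] c realizesD(6)[OF R(3)]] T_rigid[OF V R(1)] by simp
    then show ?thesis using Pull_zero_factor[OF R(3) T_Ob[OF V] c] by metis
  qed
  then show thesis using that R by blast
qed

text \<open>Two conflations pin down E. From L' -> E -> X with L' in \<open>T\<close>, the space
  Ext(V,E) embeds into Ext(V,X). From E -> R' -> R with R' in \<open>T\<close>, each element of
  Ext(V,E) is a pullback along some V -> R, so its image in Ext(V,X) is \<delta> pulled back along V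
  -> R -> Z. As every V -> Z factors through R, these images are all the pullbacks of \<delta>,
  which by exactness make up the kernel.\<close>

lemma Ext_kernel_object:
  assumes XYZ: "realizes C X Y Z i p \<delta>"
  obtains E e where "E \<in> Ob C" "e \<in> Mor C E X"
    "\<And>V. V \<in> T \<Longrightarrow> inj_on (Push C V E X e) (carrier (Ext C V E))"
    "\<And>V. V \<in> T \<Longrightarrow> Push C V E X e ` carrier (Ext C V E) =
        {\<epsilon> \<in> carrier (Ext C V X). Push C V X Y i \<epsilon> = \<zero>\<^bsub>Ext C V Y\<^esub>}"
    "\<And>a b x y z. \<lbrakk>is_coindex E a; is_index E b; is_index X x; is_index Y y; is_index Z z\<rbrakk> \<Longrightarrow> a - b \<simeq> y - x - z"
proof -
  note o = realizesD[OF XYZ]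
  obtain L R k q \<kappa> where R: "L \<in> T" "R \<in> T" "realizes C L R Z k q \<kappa>"
    and lift: "\<And>V c. V \<in> T \<Longrightarrow> c \<in> Mor C V Z \<Longrightarrow> \<exists>g\<in>Mor C V R. Comp C V R Z q g = c"
    using ex_index_realization[OF o(3)] by metis
  note r = realizesD[OF R(3)]
  obtain M m2 e1 m1 e2 where M: "realizes C X M R m2 e1 (Pull C R Z X q \<delta>)" "conflation C L M Y m1 e2"
    using realizes_pullback[OF R(3) XYZ] .
  note m = realizesD[OF M(1)]
  obtain L' R' k' q' \<kappa>' where R': "L' \<in> T" "R' \<in> T" "realizes C L' R' M k' q' \<kappa>'"
    using ex_index_realization[OF m(2)] by metis
  note r' = realizesD[OF R'(3)]
  \<comment> \<open>Octahedron over R' -> M -> R. It makes E both the kernel of the composite and an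
    extension of X by L', and it says that the class of E over R is sent to the pullback of
    \<delta>; the computation of the image rests on this last relation.\<close>
  obtain E h d e \<delta>' where E: "E \<in> Ob C" "h \<in> Mor C E R'" "d \<in> Mor C L' E" "e \<in> Mor C E X"
      "\<delta>' \<in> carrier (Ext C R E)"
    and h: "(R', h, Comp C R' M R e1 q') \<in> Rlz C R E \<delta>'"
    and d: "(E,d,e) \<in> Rlz C X L' (Pull C X M L' m2 \<kappa>')"
    and e: "Push C R E X e \<delta>' = Pull C R Z X q \<delta>"
    using ET4_op[OF m(2) r'(1) m(1,3) r'(6,7) m(6,7)] by metis
  have h': "realizes C E R' R h (Comp C R' M R e1 q') \<delta>'" using E h r by (simp add: realizes_def)
  have d': "realizes C L' E X d e (Pull C X M L' m2 \<kappa>')"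
    using d o r' m by (simp add: realizes_def Pull_closed)
  show thesis
  proof (rule that[OF E(1,4)])
    fix V assume V: "V \<in> T"
    note VO = T_Ob[OF V]
    show "inj_on (Push C V E X e) (carrier (Ext C V E))"
      by (rule Push_injI[OF d' VO T_rigid[OF V R'(1)]])
    show "Push C V E X e ` carrier (Ext C V E) =
        {\<epsilon> \<in> carrier (Ext C V X). Push C V X Y i \<epsilon> = \<zero>\<^bsub>Ext C V Y\<^esub>}"
    proof (intro equalityI subsetI)
      fix \<eta> assume "\<eta> \<in> Push C V E X e ` carrier (Ext C V E)"
      then obtain \<epsilon> where \<epsilon>: "\<epsilon> \<in> carrier (Ext C V E)" "\<eta> = Push C V E X e \<epsilon>" by blast
      have "Push C V E R' h \<epsilon> = \<zero>\<^bsub>Ext C V R'\<^esub>"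
        using Push_closed[OF VO E(1) r'(2) E(2) \<epsilon>(1)] T_rigid[OF V R'(2)] by simp
      then obtain c where c: "c \<in> Mor C V R" "\<epsilon> = Pull C V R E c \<delta>'"
        using Push_zero_Pull[OF h' VO \<epsilon>(1)] by blast
      have qc: "Comp C V R Z q c \<in> Mor C V Z" using c r VO o by (simp add: Comp_closed)
      have "\<eta> = Pull C V Z X (Comp C V R Z q c) \<delta>"
        using Push_Pull[of R V E X c e \<delta>'] Pull_Comp[of Z R V X q c \<delta>] c \<epsilon> e E r VO o by simp
      moreover have "Push C V X Y i (Pull C V Z X (Comp C V R Z q c) \<delta>) = \<zero>\<^bsub>Ext C V Y\<^esub>"
        using Push_Pull[of Z V X Y "Comp C V R Z q c" i \<delta>] qc o VO Push_inflation_zero[OF XYZ]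
        by (simp add: Pull_zero)
      ultimately show "\<eta> \<in> {\<epsilon> \<in> carrier (Ext C V X). Push C V X Y i \<epsilon> = \<zero>\<^bsub>Ext C V Y\<^esub>}"
        using o VO qc by (simp add: Pull_closed)
    next
      fix \<epsilon> assume "\<epsilon> \<in> {\<epsilon> \<in> carrier (Ext C V X). Push C V X Y i \<epsilon> = \<zero>\<^bsub>Ext C V Y\<^esub>}"
      then have \<epsilon>: "\<epsilon> \<in> carrier (Ext C V X)" "Push C V X Y i \<epsilon> = \<zero>\<^bsub>Ext C V Y\<^esub>" by auto
      obtain c where c: "c \<in> Mor C V Z" "\<epsilon> = Pull C V Z X c \<delta>"
        using Push_zero_Pull[OF XYZ VO \<epsilon>] .
      obtain g where g: "g \<in> Mor C V R" "Comp C V R Z q g = c" using lift[OF V c(1)] by blast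
      have "\<epsilon> = Push C V E X e (Pull C V R E g \<delta>')"
        using Push_Pull[of R V E X g e \<delta>'] Pull_Comp[of Z R V X q g \<delta>] c g e E r VO o by simp
      then show "\<epsilon> \<in> Push C V E X e ` carrier (Ext C V E)"
        using g E r VO by (simp add: Pull_closed)
    qed
  next
    fix a b x y z assume ab: "is_coindex E a" "is_index E b" "is_index X x" "is_index Y y" "is_index Z z"
    have "is_coindex E (frag_of R' - frag_of R)" using is_coindexI[OF R'(2) R(2)] h' conflation_iff by metis
    then have a: "a \<simeq> frag_of R' - frag_of R" using coindex_unique ab by blast
    have "is_index Z (frag_of R - frag_of L)" using is_indexI[OF R(1,2)] R(3) conflation_iff by metis
    then have z: "z \<simeq> frag_of R - frag_of L" using index_unique ab by blast
    have M': "is_index M (frag_of R' - frag_of L')" using is_indexI[OF R'(1,2)] R'(3) conflation_iff by metis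
    obtain w where w: "is_index M w" "w \<simeq> y + frag_of L" using index_extension[OF M(2) R(1) ab(4)] by blast
    then have y: "frag_of R' - frag_of L' \<simeq> y + frag_of L" using index_unique[OF M'] G.eqv_trans by blast
    obtain v where v: "is_index E v" "v \<simeq> x + frag_of L'"
      using index_extension[of L' E X d e x] d' R' ab conflation_iff by metis
    then have b: "b \<simeq> x + frag_of L'" using index_unique[OF ab(2)] G.eqv_trans by blast
    \<comment> \<open>The conflations give a = R' - R, b = x + L', R' - L' = y + L (two ways to
      compute the index of M) and z = R - L. Eliminating the four objects leaves y - x - z.\<close>
    have "a - b \<simeq> frag_of R' - frag_of R - (x + frag_of L')" by (rule G.eqv_diff[OF a b])
    also have "\<dots> = (frag_of R' - frag_of L') - (x + frag_of R)" by simp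
    also have "\<dots> \<simeq> y + frag_of L - (x + frag_of R)" by (rule G.eqv_diff[OF y G.eqv_refl])
    also have "\<dots> = y - x - (frag_of R - frag_of L)" by simp
    also have "\<dots> \<simeq> y - x - z" by (rule G.eqv_diff[OF G.eqv_refl G.eqv_sym[OF z]])
    finally show "a - b \<simeq> y - x - z" .
  qed
qed

text \<open>From Z -> E -> R with R in \<open>T\<close>, the map Ext(V,Z) -> Ext(V,E) is onto, and
  its kernel consists of the classes pulled back along maps V -> R -> Y1 from the push-forward of
  \<theta> to Z. Every V -> Y1 factors through R, so all maps V -> Y1 occur; and since Ext(V,I) = 0,
  the pullbacks of \<theta> exhaust Ext(V,Y). Hence the kernel is the image of Ext(V,Y).\<close>

lemma Ext_cokernel_object:
  assumes XYZ: "realizes C X Y Z i p \<delta>" and YI: "conflation C Y I Y1 u v" and I: "I \<in> injectives C"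
  obtains E m where "E \<in> Ob C" "m \<in> Mor C Z E"
    "\<And>V. V \<in> T \<Longrightarrow> Push C V Z E m ` carrier (Ext C V Z) = carrier (Ext C V E)"
    "\<And>V. V \<in> T \<Longrightarrow> {\<epsilon> \<in> carrier (Ext C V Z). Push C V Z E m \<epsilon> = \<zero>\<^bsub>Ext C V E\<^esub>} =
        Push C V Y Z p ` carrier (Ext C V Y)"
    "\<And>a b x y z. \<lbrakk>is_coindex E a; is_index E b; is_coindex X x; is_coindex Y y; is_coindex Z z\<rbrakk> \<Longrightarrow> a - b \<simeq> x + z - y"
proof -
  note o = realizesD[OF XYZ]
  obtain \<theta> where \<theta>: "realizes C Y I Y1 u v \<theta>" using YI conflation_iff by metis
  note t = realizesD[OF \<theta>]
  let ?\<rho> = "Push C Y1 Y Z p \<theta>"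
  \<comment> \<open>Octahedron for X -> Y -> I. Its third term X1 is a cosyzygy of X, which gives
    access to the index of E through L -> E -> X1.\<close>
  obtain X1 h d e \<delta>' where X1: "X1 \<in> Ob C" "\<delta>' \<in> carrier (Ext C X1 X)"
      "(I, Comp C X Y I u i, h) \<in> Rlz C X1 X \<delta>'" "(X1,d,e) \<in> Rlz C Y1 Z ?\<rho>"
    using ET4[OF o(1-3) t(3) o(6,7) t(6,7)] by metis
  have XI: "conflation C X I X1 (Comp C X Y I u i) h"
    using X1 o by (auto simp: conflation_def)
  have ZX1: "realizes C Z X1 Y1 d e ?\<rho>" using X1 o t by (simp add: realizes_def Push_closed)
  obtain L R k q \<kappa> where R: "L \<in> T" "R \<in> T" "realizes C L R Y1 k q \<kappa>"
    and lift: "\<And>V c. V \<in> T \<Longrightarrow> c \<in> Mor C V Y1 \<Longrightarrow> \<exists>g\<in>Mor C V R. Comp C V R Y1 q g = c"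
    using ex_index_realization[OF t(3)] by metis
  note r = realizesD[OF R(3)]
  obtain E m e1 m1 e2 where M: "realizes C Z E R m e1 (Pull C R Y1 Z q ?\<rho>)" "conflation C L E X1 m1 e2"
    using realizes_pullback[OF R(3) ZX1] .
  note m = realizesD[OF M(1)]
  have IT: "I \<in> T" using injective_T[OF I] .
  show thesis
  proof (rule that[OF m(2,4)])
    fix V assume V: "V \<in> T"
    note VO = T_Ob[OF V]
    show "Push C V Z E m ` carrier (Ext C V Z) = carrier (Ext C V E)"
    proof (intro equalityI subsetI)
      fix \<epsilon> assume e: "\<epsilon> \<in> carrier (Ext C V E)"
      have "Push C V E R e1 \<epsilon> = \<zero>\<^bsub>Ext C V R\<^esub>"
        using Push_closed[OF VO m(2,3,5) e] T_rigid[OF V R(2)] by simp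
      then show "\<epsilon> \<in> Push C V Z E m ` carrier (Ext C V Z)"
        using Push_deflation_zero[OF M(1) VO e] by blast
    qed (use m VO Push_closed in auto)
    show "{\<epsilon> \<in> carrier (Ext C V Z). Push C V Z E m \<epsilon> = \<zero>\<^bsub>Ext C V E\<^esub>} =
        Push C V Y Z p ` carrier (Ext C V Y)"
    proof (intro equalityI subsetI)
      fix \<epsilon> assume "\<epsilon> \<in> {\<epsilon> \<in> carrier (Ext C V Z). Push C V Z E m \<epsilon> = \<zero>\<^bsub>Ext C V E\<^esub>}"
      then have \<epsilon>: "\<epsilon> \<in> carrier (Ext C V Z)" "Push C V Z E m \<epsilon> = \<zero>\<^bsub>Ext C V E\<^esub>" by auto
      obtain c where c: "c \<in> Mor C V R" "\<epsilon> = Pull C V R Z c (Pull C R Y1 Z q ?\<rho>)"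
        using Push_zero_Pull[OF M(1) VO \<epsilon>] .
      have qc: "Comp C V R Y1 q c \<in> Mor C V Y1" using c r VO by (simp add: Comp_closed)
      have "\<epsilon> = Pull C V Y1 Z (Comp C V R Y1 q c) ?\<rho>"
        using Pull_Comp[of Y1 R V Z q c ?\<rho>] c r VO o t by (simp add: Push_closed)
      also have "\<dots> = Push C V Y Z p (Pull C V Y1 Y (Comp C V R Y1 q c) \<theta>)"
        using Push_Pull[of Y1 V Y Z "Comp C V R Y1 q c" p \<theta>] qc o t VO by simp
      finally show "\<epsilon> \<in> Push C V Y Z p ` carrier (Ext C V Y)"
        using qc o t VO by (simp add: Pull_closed)
    next
      fix \<epsilon> assume "\<epsilon> \<in> Push C V Y Z p ` carrier (Ext C V Y)"
      then obtain \<xi> where \<xi>: "\<xi> \<in> carrier (Ext C V Y)" "\<epsilon> = Push C V Y Z p \<xi>" by blast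
      have "Push C V Y I u \<xi> = \<zero>\<^bsub>Ext C V I\<^esub>"
        using Push_closed[OF VO t(1,2,4) \<xi>(1)] T_rigid[OF V IT] by simp
      then obtain c where c: "c \<in> Mor C V Y1" "\<xi> = Pull C V Y1 Y c \<theta>"
        using Push_zero_Pull[OF \<theta> VO \<xi>(1)] by blast
      obtain g where g: "g \<in> Mor C V R" "Comp C V R Y1 q g = c" using lift[OF V c(1)] by blast
      have "\<epsilon> = Pull C V Y1 Z c ?\<rho>"
        using Push_Pull[of Y1 V Y Z c p \<theta>] c \<xi> o t VO by simp
      also have "\<dots> = Pull C V R Z g (Pull C R Y1 Z q ?\<rho>)"
        using Pull_Comp[of Y1 R V Z q g ?\<rho>] g r VO o t by (simp add: Push_closed)
      finally have \<epsilon>: "\<epsilon> = Pull C V R Z g (Pull C R Y1 Z q ?\<rho>)" .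
      then have "Push C V Z E m \<epsilon> = Pull C V R E g (Push C R Z E m (Pull C R Y1 Z q ?\<rho>))"
        using Push_Pull[of R V Z E g m "Pull C R Y1 Z q ?\<rho>"] m g VO by simp
      also have "\<dots> = \<zero>\<^bsub>Ext C V E\<^esub>"
        using Push_inflation_zero[OF M(1)] m g VO by (simp add: Pull_zero)
      finally show "\<epsilon> \<in> {\<epsilon> \<in> carrier (Ext C V Z). Push C V Z E m \<epsilon> = \<zero>\<^bsub>Ext C V E\<^esub>}"
        using \<xi> o VO by (simp add: Push_closed)
    qed
  next
    fix a b x y z assume ab: "is_coindex E a" "is_index E b" "is_coindex X x" "is_coindex Y y" "is_coindex Z z"
    obtain w where w: "is_coindex E w" "w \<simeq> z + frag_of R"
      using coindex_extension[of Z E R m e1 z] M(1) R(2) ab(5) conflation_iff by metis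
    then have a: "a \<simeq> z + frag_of R" using coindex_unique[OF ab(1)] G.eqv_trans by blast
    obtain s where s: "is_index X1 s" "s \<simeq> frag_of I - x" using index_cosyzygy[OF XI IT ab(3)] by blast
    obtain s' where s': "is_index Y1 s'" "s' \<simeq> frag_of I - y" using index_cosyzygy[OF YI IT ab(4)] by blast
    have "is_index Y1 (frag_of R - frag_of L)" using is_indexI[OF R(1,2)] R(3) conflation_iff by metis
    then have y: "frag_of R - frag_of L \<simeq> frag_of I - y" using index_unique s' G.eqv_trans by blast
    obtain v where v: "is_index E v" "v \<simeq> s + frag_of L" using index_extension[OF M(2) R(1) s(1)] by blast
    have "b \<simeq> v" using index_unique ab(2) v(1) by blast
    also note v(2)
    also have "s + frag_of L \<simeq> frag_of I - x + frag_of L" by (rule G.eqv_add[OF s(2) G.eqv_refl])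
    finally have "a - b \<simeq> z + frag_of R - (frag_of I - x + frag_of L)" by (rule G.eqv_diff[OF a])
    \<comment> \<open>The injective I enters through both cosyzygies, X1 with index I - x and Y1
      with index R - L = I - y, and cancels.\<close>
    also have "z + frag_of R - (frag_of I - x + frag_of L) = z + x - frag_of I + (frag_of R - frag_of L)" by simp
    also have "\<dots> \<simeq> z + x - frag_of I + (frag_of I - y)" by (rule G.eqv_add[OF G.eqv_refl y])
    also have "\<dots> = x + z - y" by simp
    finally show "a - b \<simeq> x + z - y" .
  qed
qed

end

section \<open>Modules over a linear category\<close>

text \<open>The module axioms pass to the image of a surjection that respects the operations, which
  spares a direct check for quotients and for transported structures. \<open>W\<close> is not yet
  known to be a group, so preservation of zero cannot be derived and is assumed.\<close>

lemma module_image: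
  assumes V: "Module.module K V" and f: "lin_map K V W f" and im: "f ` carrier V = carrier W"
    and zero: "f \<zero>\<^bsub>V\<^esub> = \<zero>\<^bsub>W\<^esub>"
  shows "Module.module K W"
proof -
  interpret V: Module.module K V by fact
  have add: "f x \<oplus>\<^bsub>W\<^esub> f y = f (x \<oplus>\<^bsub>V\<^esub> y)" if "x \<in> carrier V" "y \<in> carrier V" for x y
    using f that by (simp add: lin_map_def)
  have smult: "k \<odot>\<^bsub>W\<^esub> f x = f (k \<odot>\<^bsub>V\<^esub> x)" if "k \<in> carrier K" "x \<in> carrier V" for k x
    using f that by (simp add: lin_map_def)
  have ex: "\<exists>x\<in>carrier V. w = f x" if "w \<in> carrier W" for w
    using that im by blast
  have W: "abelian_group W"
  proof (rule abelian_groupI)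
    fix w1 w2 w3 assume w: "w1 \<in> carrier W" "w2 \<in> carrier W" "w3 \<in> carrier W"
    obtain x y z where "x \<in> carrier V" "w1 = f x" "y \<in> carrier V" "w2 = f y" "z \<in> carrier V" "w3 = f z"
      using ex[OF w(1)] ex[OF w(2)] ex[OF w(3)] by (elim bexE)
    then show "(w1 \<oplus>\<^bsub>W\<^esub> w2) \<oplus>\<^bsub>W\<^esub> w3 = w1 \<oplus>\<^bsub>W\<^esub> (w2 \<oplus>\<^bsub>W\<^esub> w3)"
      by (simp add: add V.a_assoc)
  next
    fix w1 w2 assume w: "w1 \<in> carrier W" "w2 \<in> carrier W"
    obtain x y where xy: "x \<in> carrier V" "w1 = f x" "y \<in> carrier V" "w2 = f y"
      using ex[OF w(1)] ex[OF w(2)] by (elim bexE)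
    have "f (x \<oplus>\<^bsub>V\<^esub> y) \<in> carrier W" using xy im by blast
    then show "w1 \<oplus>\<^bsub>W\<^esub> w2 \<in> carrier W" using xy by (simp add: add)
    show "w1 \<oplus>\<^bsub>W\<^esub> w2 = w2 \<oplus>\<^bsub>W\<^esub> w1" using xy V.a_comm[of x y] by (simp add: add)
  next
    show "\<zero>\<^bsub>W\<^esub> \<in> carrier W" using im V.zero_closed unfolding zero[symmetric] by blast
  next
    fix w assume "w \<in> carrier W"
    then obtain x where x: "x \<in> carrier V" "w = f x" using ex by blast
    then show "\<zero>\<^bsub>W\<^esub> \<oplus>\<^bsub>W\<^esub> w = w" unfolding zero[symmetric] by (simp add: add)
    have "f (\<ominus>\<^bsub>V\<^esub> x) \<in> carrier W" using x im V.a_inv_closed by blast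
    moreover have "f (\<ominus>\<^bsub>V\<^esub> x) \<oplus>\<^bsub>W\<^esub> w = \<zero>\<^bsub>W\<^esub>"
      using x unfolding zero[symmetric] by (simp add: add V.l_neg)
    ultimately show "\<exists>v\<in>carrier W. v \<oplus>\<^bsub>W\<^esub> w = \<zero>\<^bsub>W\<^esub>" by blast
  qed
  show ?thesis
  proof (rule moduleI[OF V.R.is_cring W])
    fix a w assume a: "a \<in> carrier K" "w \<in> carrier W"
    then obtain x where x: "x \<in> carrier V" "w = f x" using ex by blast
    then have "f (a \<odot>\<^bsub>V\<^esub> x) \<in> carrier W" using a im V.smult_closed by blast
    then show "a \<odot>\<^bsub>W\<^esub> w \<in> carrier W" using a x by (simp add: smult)
  next
    fix a b w assume a: "a \<in> carrier K" "b \<in> carrier K" "w \<in> carrier W"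
    then obtain x where x: "x \<in> carrier V" "w = f x" using ex by blast
    with a show "(a \<oplus>\<^bsub>K\<^esub> b) \<odot>\<^bsub>W\<^esub> w = a \<odot>\<^bsub>W\<^esub> w \<oplus>\<^bsub>W\<^esub> b \<odot>\<^bsub>W\<^esub> w"
      and "(a \<otimes>\<^bsub>K\<^esub> b) \<odot>\<^bsub>W\<^esub> w = a \<odot>\<^bsub>W\<^esub> (b \<odot>\<^bsub>W\<^esub> w)"
      by (simp_all add: smult add V.smult_l_distr V.smult_assoc1)
  next
    fix a w1 w2 assume a: "a \<in> carrier K" "w1 \<in> carrier W" "w2 \<in> carrier W"
    obtain x y where "x \<in> carrier V" "w1 = f x" "y \<in> carrier V" "w2 = f y"
      using ex[OF a(2)] ex[OF a(3)] by (elim bexE)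
    with a show "a \<odot>\<^bsub>W\<^esub> (w1 \<oplus>\<^bsub>W\<^esub> w2) = a \<odot>\<^bsub>W\<^esub> w1 \<oplus>\<^bsub>W\<^esub> a \<odot>\<^bsub>W\<^esub> w2"
      by (simp add: smult add V.smult_r_distr)
  next
    fix w assume "w \<in> carrier W"
    then obtain x where x: "x \<in> carrier V" "w = f x" using ex by blast
    then show "\<one>\<^bsub>K\<^esub> \<odot>\<^bsub>W\<^esub> w = w" by (simp add: smult)
  qed
qed

lemma lin_map_inv_into:
  assumes V: "Module.module K V" and f: "lin_map K V W f" and b: "bij_betw f (carrier V) (carrier W)"
  shows "lin_map K W V (inv_into (carrier V) f)"
proof -
  interpret V: Module.module K V by fact
  let ?g = "inv_into (carrier V) f"
  have im: "f ` carrier V = carrier W" using b by (simp add: bij_betw_def)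
  have ex: "\<exists>x\<in>carrier V. w = f x" if "w \<in> carrier W" for w
    using that im by blast
  have gf: "?g (f x) = x" if "x \<in> carrier V" for x
    using b that by (simp add: bij_betw_def)
  show ?thesis unfolding lin_map_def
  proof (intro conjI ballI Pi_I)
    show "?g w \<in> carrier V" if "w \<in> carrier W" for w
      using ex[OF that] gf by auto
    fix w1 w2 assume w: "w1 \<in> carrier W" "w2 \<in> carrier W"
    obtain x y where xy: "x \<in> carrier V" "w1 = f x" "y \<in> carrier V" "w2 = f y"
      using ex[OF w(1)] ex[OF w(2)] by (elim bexE)
    from xy show "?g (w1 \<oplus>\<^bsub>W\<^esub> w2) = ?g w1 \<oplus>\<^bsub>V\<^esub> ?g w2"
      by (simp add: gf flip: lin_map_add[OF f])
  next
    fix k w assume k: "k \<in> carrier K" "w \<in> carrier W"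
    then obtain x where "x \<in> carrier V" "w = f x" using ex by blast
    with k show "?g (k \<odot>\<^bsub>W\<^esub> w) = k \<odot>\<^bsub>V\<^esub> ?g w"
      by (simp add: gf flip: lin_map_smult[OF f])
  qed
qed

lemma is_catmodD:
  assumes "is_catmod K A M"
  shows "X \<in> Ob A \<Longrightarrow> Module.module K (MOb M X)"
    and "\<lbrakk>X \<in> Ob A; Y \<in> Ob A; f \<in> Mor A X Y\<rbrakk> \<Longrightarrow> lin_map K (MOb M Y) (MOb M X) (MMor M X Y f)"
    and "\<lbrakk>X \<in> Ob A; Y \<in> Ob A; u \<in> carrier (MOb M Y)\<rbrakk> \<Longrightarrow>
       lin_map K (Hom A X Y) (MOb M X) (\<lambda>f. MMor M X Y f u)"
    and "\<lbrakk>X \<in> Ob A; u \<in> carrier (MOb M X)\<rbrakk> \<Longrightarrow> MMor M X X (One A X) u = u"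
    and "\<lbrakk>X \<in> Ob A; Y \<in> Ob A; Z \<in> Ob A; f \<in> Mor A X Y; g \<in> Mor A Y Z; u \<in> carrier (MOb M Z)\<rbrakk> \<Longrightarrow>
       MMor M X Z (Comp A X Y Z g f) u = MMor M X Y f (MMor M Y Z g u)"
  using assms unfolding is_catmod_def by blast+

lemma MMor_closed:
  "\<lbrakk>is_catmod K A M; X \<in> Ob A; Y \<in> Ob A; f \<in> Mor A X Y; u \<in> carrier (MOb M Y)\<rbrakk>
   \<Longrightarrow> MMor M X Y f u \<in> carrier (MOb M X)"
  using lin_map_closed is_catmodD(2) by metis

lemma catmod_iso_refl: "is_catmod K A M \<Longrightarrow> catmod_iso K A M M"
  unfolding catmod_iso_def catmod_hom_def
  by (intro exI[of _ "\<lambda>X u. u"]) (auto simp: lin_map_def bij_betw_def)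

lemma catmod_iso_trans:
  assumes "catmod_iso K A M N" "catmod_iso K A N L"
  shows "catmod_iso K A M L"
proof -
  obtain \<eta> where \<eta>: "catmod_hom K A M N \<eta>" "\<And>X. X \<in> Ob A \<Longrightarrow> bij_betw (\<eta> X) (carrier (MOb M X)) (carrier (MOb N X))"
    using assms(1) unfolding catmod_iso_def by blast
  obtain \<theta> where \<theta>: "catmod_hom K A N L \<theta>" "\<And>X. X \<in> Ob A \<Longrightarrow> bij_betw (\<theta> X) (carrier (MOb N X)) (carrier (MOb L X))"
    using assms(2) unfolding catmod_iso_def by blast
  have "catmod_hom K A M L (\<lambda>X u. \<theta> X (\<eta> X u))"
    unfolding catmod_hom_def
  proof (intro conjI ballI)
    show "lin_map K (MOb M X) (MOb L X) (\<lambda>u. \<theta> X (\<eta> X u))" if "X \<in> Ob A" for X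
      using \<eta>(1) \<theta>(1) that lin_map_compose unfolding catmod_hom_def by blast
    fix X Y f u assume "X \<in> Ob A" "Y \<in> Ob A" "f \<in> Mor A X Y" "u \<in> carrier (MOb M Y)"
    moreover from this have "\<eta> Y u \<in> carrier (MOb N Y)" using \<eta>(2) bij_betwE by metis
    ultimately show "\<theta> X (\<eta> X (MMor M X Y f u)) = MMor L X Y f (\<theta> Y (\<eta> Y u))"
      using \<eta>(1) \<theta>(1) unfolding catmod_hom_def by simp
  qed
  moreover have "bij_betw (\<lambda>u. \<theta> X (\<eta> X u)) (carrier (MOb M X)) (carrier (MOb L X))" if "X \<in> Ob A" for X
    using bij_betw_trans[OF \<eta>(2) \<theta>(2)] that by (simp add: comp_def)
  ultimately show ?thesis unfolding catmod_iso_def by blast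
qed

lemma catmod_iso_sym:
  assumes M: "is_catmod K A M" and "catmod_iso K A M N"
  shows "catmod_iso K A N M"
proof -
  obtain \<eta> where \<eta>: "catmod_hom K A M N \<eta>" "\<And>X. X \<in> Ob A \<Longrightarrow> bij_betw (\<eta> X) (carrier (MOb M X)) (carrier (MOb N X))"
    using assms(2) unfolding catmod_iso_def by blast
  let ?\<theta> = "\<lambda>X. inv_into (carrier (MOb M X)) (\<eta> X)"
  have "catmod_hom K A N M ?\<theta>"
    unfolding catmod_hom_def
  proof (intro conjI ballI)
    show "lin_map K (MOb N X) (MOb M X) (?\<theta> X)" if "X \<in> Ob A" for X
      using \<eta> that lin_map_inv_into is_catmodD(1)[OF M] unfolding catmod_hom_def by blast
    fix X Y f u assume *: "X \<in> Ob A" "Y \<in> Ob A" "f \<in> Mor A X Y" "u \<in> carrier (MOb N Y)"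
    then obtain v where v: "v \<in> carrier (MOb M Y)" "u = \<eta> Y v"
      using \<eta>(2) unfolding bij_betw_def by (metis imageE)
    have "MMor N X Y f u = \<eta> X (MMor M X Y f v)" using \<eta>(1) * v unfolding catmod_hom_def by simp
    moreover have "MMor M X Y f v \<in> carrier (MOb M X)" using MMor_closed[OF M] * v by blast
    moreover have "inj_on (\<eta> X) (carrier (MOb M X))" "inj_on (\<eta> Y) (carrier (MOb M Y))"
      using \<eta>(2) * bij_betw_def by blast+
    ultimately show "?\<theta> X (MMor N X Y f u) = MMor M X Y f (?\<theta> Y u)" using v by simp
  qed
  moreover have "bij_betw (?\<theta> X) (carrier (MOb N X)) (carrier (MOb M X))" if "X \<in> Ob A" for X
    using \<eta>(2)[OF that] by (rule bij_betw_inv_into)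
  ultimately show ?thesis unfolding catmod_iso_def by blast
qed

text \<open>\<open>mod_class\<close> chooses among the representatives isomorphic to \<open>M\<close>, and these depend only on the
  isomorphism class of \<open>M\<close>, so both choices agree literally, whether or not \<open>M\<close> is finitely presented.\<close>

lemma mod_class_cong:
  fixes A :: "('o,'m,'k,'z) lincat_scheme"
  assumes "is_catmod K A M" "catmod_iso K A M N"
  shows "mod_class K A M = mod_class K A N"
proof -
  have "catmod_iso K A M L \<longleftrightarrow> catmod_iso K A N L" for L :: "('o,'m,'k,'m set) catmod"
    using catmod_iso_trans catmod_iso_sym assms by metis
  then show ?thesis unfolding mod_class_def by simp
qed

lemma finitely_presentedE:
  assumes "finitely_presented K A M"
  obtains R' R f \<pi> where "R' \<in> Ob A" "R \<in> Ob A" "f \<in> Mor A R' R" "catmod_hom K A (representable A R) M \<pi>"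
    "\<forall>X\<in>Ob A. \<pi> X ` Mor A X R = carrier (MOb M X)"
    "\<forall>X\<in>Ob A. {u \<in> Mor A X R. \<pi> X u = \<zero>\<^bsub>MOb M X\<^esub>} = Comp A X R' R f ` Mor A X R'"
proof -
  obtain R' R f \<pi> where p: "R' \<in> Ob A" "R \<in> Ob A" "f \<in> Mor A R' R" "catmod_hom K A (representable A R) M \<pi>"
    "\<forall>X\<in>Ob A. \<pi> X ` Mor A X R = carrier (MOb M X) \<and>
       {u \<in> Mor A X R. \<pi> X u = \<zero>\<^bsub>MOb M X\<^esub>} = Comp A X R' R f ` Mor A X R'"
    using assms unfolding finitely_presented_def by (elim conjE bexE exE)
  show thesis by (rule that[OF p(1-4)]) (use p(5) in auto)
qed

lemma finitely_presentedI:
  assumes "is_catmod K A M" "R' \<in> Ob A" "R \<in> Ob A" "f \<in> Mor A R' R" "catmod_hom K A (representable A R) M \<pi>"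
    "\<And>X. X \<in> Ob A \<Longrightarrow> \<pi> X ` Mor A X R = carrier (MOb M X)"
    "\<And>X. X \<in> Ob A \<Longrightarrow> {u \<in> Mor A X R. \<pi> X u = \<zero>\<^bsub>MOb M X\<^esub>} = Comp A X R' R f ` Mor A X R'"
  shows "finitely_presented K A M"
  unfolding finitely_presented_def
  by (intro conjI bexI[of _ R'] bexI[of _ R] bexI[of _ f] exI[of _ \<pi>] ballI assms)

lemma finitely_presented_iso:
  assumes M: "finitely_presented K A M" and N: "is_catmod K A N" and iso: "catmod_iso K A M N"
  shows "finitely_presented K A N"
proof -
  have cM: "is_catmod K A M" using M unfolding finitely_presented_def by blast
  obtain R' R f \<pi> where R: "R' \<in> Ob A" "R \<in> Ob A" "f \<in> Mor A R' R"
    and p: "catmod_hom K A (representable A R) M \<pi>"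
      "\<forall>X\<in>Ob A. \<pi> X ` Mor A X R = carrier (MOb M X)"
      "\<forall>X\<in>Ob A. {u \<in> Mor A X R. \<pi> X u = \<zero>\<^bsub>MOb M X\<^esub>} = Comp A X R' R f ` Mor A X R'"
    by (rule finitely_presentedE[OF M])
  note \<pi> = p(1) bspec[OF p(2)] bspec[OF p(3)]
  obtain \<eta> where \<eta>: "catmod_hom K A M N \<eta>" "\<And>X. X \<in> Ob A \<Longrightarrow> bij_betw (\<eta> X) (carrier (MOb M X)) (carrier (MOb N X))"
    using iso unfolding catmod_iso_def by blast
  have hom: "catmod_hom K A (representable A R) N (\<lambda>X u. \<eta> X (\<pi> X u))"
    unfolding catmod_hom_def
  proof (intro conjI ballI)
    show "lin_map K (MOb (representable A R) X) (MOb N X) (\<lambda>u. \<eta> X (\<pi> X u))" if "X \<in> Ob A" for X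
      using \<eta>(1) \<pi>(1) that lin_map_compose unfolding catmod_hom_def by blast
    fix X Y f u assume *: "X \<in> Ob A" "Y \<in> Ob A" "f \<in> Mor A X Y" "u \<in> carrier (MOb (representable A R) Y)"
    then have "\<pi> Y u \<in> carrier (MOb M Y)" using \<pi>(2) by (auto simp: representable_def)
    then show "\<eta> X (\<pi> X (MMor (representable A R) X Y f u)) = MMor N X Y f (\<eta> Y (\<pi> Y u))"
      using * \<eta>(1) \<pi>(1) unfolding catmod_hom_def by simp
  qed
  have zero: "\<eta> X \<zero>\<^bsub>MOb M X\<^esub> = \<zero>\<^bsub>MOb N X\<^esub>" if "X \<in> Ob A" for X
    using lin_map_zero[OF is_catmodD(1)[OF cM that] is_catmodD(1)[OF N that]] \<eta>(1) that
    unfolding catmod_hom_def by blast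
  have zM: "\<zero>\<^bsub>MOb M X\<^esub> \<in> carrier (MOb M X)" if "X \<in> Ob A" for X
    using is_catmodD(1)[OF cM that]
    by (meson Module.module.axioms(2) abelian_group.axioms(1) abelian_monoid.zero_closed)
  have 1: "(\<lambda>u. \<eta> X (\<pi> X u)) ` Mor A X R = carrier (MOb N X)" if "X \<in> Ob A" for X
    using \<pi>(2)[OF that] \<eta>(2)[OF that] by (simp add: bij_betw_def image_image[symmetric])
  have 2: "{u \<in> Mor A X R. \<eta> X (\<pi> X u) = \<zero>\<^bsub>MOb N X\<^esub>} = Comp A X R' R f ` Mor A X R'" if X: "X \<in> Ob A" for X
  proof -
    have "\<eta> X (\<pi> X u) = \<zero>\<^bsub>MOb N X\<^esub> \<longleftrightarrow> \<pi> X u = \<zero>\<^bsub>MOb M X\<^esub>" if "u \<in> Mor A X R" for u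
    proof -
      have "\<pi> X u \<in> carrier (MOb M X)" using \<pi>(2)[OF X] that by blast
      moreover have "inj_on (\<eta> X) (carrier (MOb M X))" using \<eta>(2)[OF X] by (simp add: bij_betw_def)
      ultimately show ?thesis using inj_on_eq_iff[OF _ _ zM[OF X], of "\<eta> X" "\<pi> X u"] zero[OF X] by simp
    qed
    then show ?thesis using \<pi>(3)[OF X] by blast
  qed
  show ?thesis by (rule finitely_presentedI[OF N R hom 1 2])
qed

text \<open>\<open>fp_modules\<close> admits a single type of module elements, namely sets of
  morphisms, while extension modules have elements of another type. Transport of structure along an
  injection changes the type.\<close>

definition transport_module :: "('v \<Rightarrow> 'w) \<Rightarrow> ('k,'v) module \<Rightarrow> ('k,'w) module" where
  "transport_module g V =
     \<lparr>carrier = g ` carrier V, monoid.mult = undefined, monoid.one = undefined,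
      ring.zero = g \<zero>\<^bsub>V\<^esub>,
      ring.add = (\<lambda>a b. g (inv_into (carrier V) g a \<oplus>\<^bsub>V\<^esub> inv_into (carrier V) g b)),
      module.smult = (\<lambda>k a. g (k \<odot>\<^bsub>V\<^esub> inv_into (carrier V) g a))\<rparr>"

definition transport_catmod ::
  "('o \<Rightarrow> 'v \<Rightarrow> 'w) \<Rightarrow> ('o,'m,'k,'v) catmod \<Rightarrow> ('o,'m,'k,'w) catmod" where
  "transport_catmod g M =
     \<lparr>MOb = (\<lambda>X. transport_module (g X) (MOb M X)),
      MMor = (\<lambda>X Y f u. g X (MMor M X Y f (inv_into (carrier (MOb M Y)) (g Y) u)))\<rparr>"

lemma transport_module_lin:
  "inj_on g (carrier V) \<Longrightarrow> lin_map K V (transport_module g V) g"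
  by (auto simp: lin_map_def transport_module_def)

lemma transport_module_module:
  fixes K :: "'k ring"
  assumes "Module.module K V" "inj_on g (carrier V)"
  shows "Module.module K (transport_module g V)"
  by (rule module_image[OF assms(1), where f = g])
    (simp_all add: transport_module_lin assms(2), simp_all add: transport_module_def)

lemma transport_catmod_iso:
  assumes M: "is_catmod K A M" and inj: "\<And>X. X \<in> Ob A \<Longrightarrow> inj_on (g X) (carrier (MOb M X))"
  shows "is_catmod K A (transport_catmod g M)" "catmod_iso K A M (transport_catmod g M)"
proof -
  have c: "carrier (MOb (transport_catmod g M) X) = g X ` carrier (MOb M X)" for X
    by (simp add: transport_catmod_def transport_module_def)
  have mob: "MOb (transport_catmod g M) X = transport_module (g X) (MOb M X)" for X
    by (simp add: transport_catmod_def)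
  have mm: "MMor (transport_catmod g M) X Y f (g Y u) = g X (MMor M X Y f u)"
    if "Y \<in> Ob A" "u \<in> carrier (MOb M Y)" for X Y f u
    using inj that by (simp add: transport_catmod_def)
  have lin: "lin_map K (MOb M X) (MOb (transport_catmod g M) X) (g X)" if "X \<in> Ob A" for X
    unfolding mob by (rule transport_module_lin[OF inj[OF that]])
  have ilin: "lin_map K (MOb (transport_catmod g M) X) (MOb M X) (inv_into (carrier (MOb M X)) (g X))"
    if "X \<in> Ob A" for X
    by (rule lin_map_inv_into[OF is_catmodD(1)[OF M that] lin[OF that]])
      (use inj[OF that] in \<open>auto simp: bij_betw_def c\<close>)
  show "is_catmod K A (transport_catmod g M)"
    unfolding is_catmod_def
  proof (intro conjI ballI)
    show "Module.module K (MOb (transport_catmod g M) X)" if "X \<in> Ob A" for X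
      unfolding mob by (rule transport_module_module[OF is_catmodD(1)[OF M that] inj[OF that]])
    fix X assume X: "X \<in> Ob A"
    { fix u assume "u \<in> carrier (MOb (transport_catmod g M) X)"
      then show "MMor (transport_catmod g M) X X (One A X) u = u"
        using X mm is_catmodD(4)[OF M X] by (auto simp: c) }
    fix Y assume Y: "Y \<in> Ob A"
    { fix f assume f: "f \<in> Mor A X Y"
      have "lin_map K (MOb (transport_catmod g M) Y) (MOb (transport_catmod g M) X)
          (\<lambda>u. g X (MMor M X Y f (inv_into (carrier (MOb M Y)) (g Y) u)))"
        using lin_map_compose[OF lin_map_compose[OF ilin[OF Y] is_catmodD(2)[OF M X Y f]] lin[OF X]] .
      then show "lin_map K (MOb (transport_catmod g M) Y) (MOb (transport_catmod g M) X)
          (MMor (transport_catmod g M) X Y f)"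
        by (simp add: transport_catmod_def) }
    { fix u assume "u \<in> carrier (MOb (transport_catmod g M) Y)"
      then obtain v where v: "v \<in> carrier (MOb M Y)" "u = g Y v" by (auto simp: c)
      show "lin_map K (Hom A X Y) (MOb (transport_catmod g M) X) (\<lambda>f. MMor (transport_catmod g M) X Y f u)"
        unfolding v(2) mm[OF Y v(1)] by (rule lin_map_compose[OF is_catmodD(3)[OF M X Y v(1)] lin[OF X]]) }
    fix Z f h u assume "Z \<in> Ob A" "f \<in> Mor A X Y" "h \<in> Mor A Y Z" "u \<in> carrier (MOb (transport_catmod g M) Z)"
    then show "MMor (transport_catmod g M) X Z (Comp A X Y Z h f) u =
        MMor (transport_catmod g M) X Y f (MMor (transport_catmod g M) Y Z h u)"
      using X Y mm is_catmodD(5)[OF M X Y, of Z f h] MMor_closed[OF M Y, of Z h] by (auto simp: c)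
  qed
  show "catmod_iso K A M (transport_catmod g M)"
    unfolding catmod_iso_def catmod_hom_def
    by (rule exI[of _ g]) (use lin mm inj in \<open>auto simp: c bij_betw_def\<close>)
qed

lemma ex_fp_representative:
  assumes M: "finitely_presented K A M"
  shows "\<exists>N\<in>fp_modules K A. catmod_iso K A M N"
proof -
  have cM: "is_catmod K A M" using M unfolding finitely_presented_def by blast
  obtain R \<pi> where p: "\<forall>X\<in>Ob A. \<pi> X ` Mor A X R = carrier (MOb M X)"
    by (rule finitely_presentedE[OF M])
  note \<pi> = bspec[OF p]
  \<comment> \<open>Replace an element by its fibre, a set of morphisms, to obtain values of the required type.\<close>
  define g where "g X m = {u \<in> Mor A X R. \<pi> X u = m}" for X m
  have inj: "inj_on (g X) (carrier (MOb M X))" if X: "X \<in> Ob A" for X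
  proof (rule inj_onI)
    fix m m' assume m: "m \<in> carrier (MOb M X)" "m' \<in> carrier (MOb M X)" "g X m = g X m'"
    have "m \<in> \<pi> X ` Mor A X R" using \<pi>[OF X] m(1) by simp
    then obtain u where "u \<in> Mor A X R" "\<pi> X u = m" by auto
    then have "u \<in> g X m" by (simp add: g_def)
    then have "u \<in> g X m'" by (simp only: m(3))
    then show "m = m'" using \<open>\<pi> X u = m\<close> by (simp add: g_def)
  qed
  show ?thesis
    using transport_catmod_iso[OF cM inj] finitely_presented_iso[OF M] unfolding fp_modules_def by blast
qed

text \<open>Both modules are quotients of Hom(-,R) by the same kernel. By linearity
  \<open>\<pi>\<close> and \<open>\<pi>'\<close> identify the same pairs, so sending
  \<open>\<pi> X u\<close> to \<open>\<pi>' X u\<close> does not depend on the chosen preimage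
  \<open>u\<close> and is injective.\<close>

lemma cokernel_unique:
  assumes M: "is_catmod K A M" and N: "is_catmod K A N"
    and H: "\<And>X. X \<in> Ob A \<Longrightarrow> Module.module K (Hom A X R)"
    and \<pi>: "catmod_hom K A (representable A R) M \<pi>" and \<pi>': "catmod_hom K A (representable A R) N \<pi>'"
    and onto: "\<And>X. X \<in> Ob A \<Longrightarrow> \<pi> X ` Mor A X R = carrier (MOb M X)"
    and onto': "\<And>X. X \<in> Ob A \<Longrightarrow> \<pi>' X ` Mor A X R = carrier (MOb N X)"
    and ker: "\<And>X u. X \<in> Ob A \<Longrightarrow> u \<in> Mor A X R \<Longrightarrow> \<pi> X u = \<zero>\<^bsub>MOb M X\<^esub> \<longleftrightarrow> \<pi>' X u = \<zero>\<^bsub>MOb N X\<^esub>"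
    and comp: "\<And>X Y f u. \<lbrakk>X \<in> Ob A; Y \<in> Ob A; f \<in> Mor A X Y; u \<in> Mor A Y R\<rbrakk> \<Longrightarrow> Comp A X Y R u f \<in> Mor A X R"
  shows "catmod_iso K A M N"
proof -
  have lin: "lin_map K (Hom A X R) (MOb M X) (\<pi> X)" "lin_map K (Hom A X R) (MOb N X) (\<pi>' X)" if "X \<in> Ob A" for X
    using \<pi> \<pi>' that unfolding catmod_hom_def representable_def by simp_all
  have nat: "\<pi> X (Comp A X Y R u f) = MMor M X Y f (\<pi> Y u)" "\<pi>' X (Comp A X Y R u f) = MMor N X Y f (\<pi>' Y u)"
    if "X \<in> Ob A" "Y \<in> Ob A" "f \<in> Mor A X Y" "u \<in> Mor A Y R" for X Y f u
    using \<pi> \<pi>' that unfolding catmod_hom_def representable_def by simp_all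
  have eq: "\<pi> X u = \<pi> X v \<longleftrightarrow> \<pi>' X u = \<pi>' X v" if X: "X \<in> Ob A" and u: "u \<in> Mor A X R" "v \<in> Mor A X R" for X u v
  proof -
    interpret H: Module.module K "Hom A X R" using H X .
    interpret M: Module.module K "MOb M X" using is_catmodD(1)[OF M X] .
    interpret N: Module.module K "MOb N X" using is_catmodD(1)[OF N X] .
    have "\<pi> X (u \<ominus>\<^bsub>Hom A X R\<^esub> v) = \<pi> X u \<ominus>\<^bsub>MOb M X\<^esub> \<pi> X v"
      "\<pi>' X (u \<ominus>\<^bsub>Hom A X R\<^esub> v) = \<pi>' X u \<ominus>\<^bsub>MOb N X\<^esub> \<pi>' X v"
      using lin_map_minus[OF H.module_axioms M.module_axioms lin(1)[OF X] u]
        lin_map_minus[OF H.module_axioms N.module_axioms lin(2)[OF X] u] by simp_all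
    then show ?thesis
      using ker[OF X H.minus_closed[OF u]] lin[OF X] u M.minus_zero_iff N.minus_zero_iff
      by (metis lin_map_closed)
  qed
  define \<eta> where "\<eta> X m = \<pi>' X (SOME u. u \<in> Mor A X R \<and> \<pi> X u = m)" for X m
  have \<eta>: "\<eta> X (\<pi> X u) = \<pi>' X u" if "X \<in> Ob A" "u \<in> Mor A X R" for X u
  proof -
    have "\<exists>v. v \<in> Mor A X R \<and> \<pi> X v = \<pi> X u" using that by blast
    from someI_ex[OF this] show ?thesis unfolding \<eta>_def using eq[OF that(1)] that by blast
  qed
  have "catmod_hom K A M N \<eta>" unfolding catmod_hom_def
  proof (intro conjI ballI)
    fix X assume X: "X \<in> Ob A"
    interpret H: Module.module K "Hom A X R" using H X .
    show "lin_map K (MOb M X) (MOb N X) (\<eta> X)"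
      unfolding lin_map_def onto[OF X, symmetric]
      using \<eta>[OF X] lin[OF X]
      by (auto simp: Pi_iff lin_map_closed simp flip: lin_map_add[OF lin(1)[OF X]] lin_map_smult[OF lin(1)[OF X]])
         (simp_all add: lin_map_add[OF lin(2)[OF X]] lin_map_smult[OF lin(2)[OF X]])
    fix Y f m assume Y: "Y \<in> Ob A" "f \<in> Mor A X Y" "m \<in> carrier (MOb M Y)"
    then obtain u where u: "u \<in> Mor A Y R" "m = \<pi> Y u" using onto by (metis imageE)
    show "\<eta> X (MMor M X Y f m) = MMor N X Y f (\<eta> Y m)"
      using nat[OF X Y(1,2) u(1)] \<eta>[OF X comp[OF X Y(1,2) u(1)]] \<eta>[OF Y(1) u(1)] u(2) by simp
  qed
  moreover have "bij_betw (\<eta> X) (carrier (MOb M X)) (carrier (MOb N X))" if X: "X \<in> Ob A" for X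
    unfolding bij_betw_def onto[OF X, symmetric] onto'[OF X, symmetric]
    using \<eta>[OF X] eq[OF X] by (auto simp: inj_on_def image_image)
  ultimately show ?thesis unfolding catmod_iso_def by blast
qed

lemma yoneda_hom:
  assumes M: "is_catmod K A M" and R: "R \<in> Ob A" and m: "m \<in> carrier (MOb M R)"
  shows "catmod_hom K A (representable A R) M (\<lambda>X u. MMor M X R u m)"
  unfolding catmod_hom_def representable_def
  using is_catmodD(3)[OF M _ R m] is_catmodD(5)[OF M _ _ R _ _ m] by simp

section \<open>The Grothendieck group of finitely presented modules\<close>

lemma group_presentation_K0_mod: "group_presentation (fp_modules K A) (exact_relators K A)"
proof
  fix r assume "r \<in> exact_relators K A"
  then obtain M M' M'' where r: "r = frag_of M - frag_of M' - frag_of M''"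
    "M \<in> fp_modules K A" "M' \<in> fp_modules K A" "M'' \<in> fp_modules K A"
    unfolding exact_relators_def by blast
  then show "Poly_Mapping.keys r \<subseteq> fp_modules K A"
    using keys_diff[of "frag_of M - frag_of M'" "frag_of M''"] keys_diff[of "frag_of M" "frag_of M'"] by auto
qed

text \<open>The relators come from exact sequences and do not mention isomorphism. An isomorphism
  becomes a short exact sequence with a zero module as third term, so some zero module must be
  available among the generators.\<close>

lemma presented_class_iso:
  assumes Z: "Z \<in> fp_modules K A" "\<And>X. X \<in> Ob A \<Longrightarrow> carrier (MOb Z X) = {\<zero>\<^bsub>MOb Z X\<^esub>}"
    and M: "M \<in> fp_modules K A" and N: "N \<in> fp_modules K A" and iso: "catmod_iso K A M N"
  shows "presented_class (fp_modules K A) (exact_relators K A) M =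
     presented_class (fp_modules K A) (exact_relators K A) N"
proof -
  interpret P: group_presentation "fp_modules K A" "exact_relators K A"
    by (rule group_presentation_K0_mod)
  have cat: "is_catmod K A L" if "L \<in> fp_modules K A" for L
    using that by (simp add: fp_modules_def finitely_presented_def)
  have rel: "frag_of N - frag_of L - frag_of Z \<in> P.H" if L: "L \<in> fp_modules K A" "catmod_iso K A L N" for L
  proof -
    obtain \<eta> where \<eta>: "catmod_hom K A L N \<eta>" "\<And>X. X \<in> Ob A \<Longrightarrow> bij_betw (\<eta> X) (carrier (MOb L X)) (carrier (MOb N X))"
      using L unfolding catmod_iso_def by blast
    have 0: "catmod_hom K A N Z (\<lambda>X u. \<zero>\<^bsub>MOb Z X\<^esub>)"
      unfolding catmod_hom_def
    proof (intro conjI ballI)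
      fix X assume X: "X \<in> Ob A"
      interpret Module.module K "MOb Z X" using is_catmodD(1)[OF cat[OF Z(1)] X] .
      show "lin_map K (MOb N X) (MOb Z X) (\<lambda>u. \<zero>\<^bsub>MOb Z X\<^esub>)" by (simp add: lin_map_def)
      fix Y f u assume Y: "Y \<in> Ob A" "f \<in> Mor A X Y" "u \<in> carrier (MOb N Y)"
      interpret Y: Module.module K "MOb Z Y" using is_catmodD(1)[OF cat[OF Z(1)] Y(1)] .
      show "\<zero>\<^bsub>MOb Z X\<^esub> = MMor Z X Y f \<zero>\<^bsub>MOb Z Y\<^esub>"
        using MMor_closed[OF cat[OF Z(1)] X Y(1,2) Y.zero_closed] Z(2)[OF X] by simp
    qed
    have "\<zero>\<^bsub>MOb N X\<^esub> \<in> carrier (MOb N X)" if "X \<in> Ob A" for X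
    proof -
      interpret Module.module K "MOb N X" using is_catmodD(1)[OF cat[OF N] that] .
      show ?thesis by simp
    qed
    then have "short_exact K A L N Z"
      unfolding short_exact_def
      by (intro exI[of _ \<eta>] exI[of _ "\<lambda>X u. \<zero>\<^bsub>MOb Z X\<^esub>"] conjI \<eta>(1) 0)
        (use \<eta>(2) Z(2) in \<open>auto simp: bij_betw_def\<close>)
    then show ?thesis
      by (intro P.relator_H) (use L N Z in \<open>auto simp: exact_relators_def\<close>)
  qed
  \<comment> \<open>The relators of \<open>M \<rightarrow> N \<rightarrow> Z\<close> and \<open>N \<rightarrow> N \<rightarrow> Z\<close> cancel \<open>Z\<close>.\<close>
  have "frag_of N - frag_of M - frag_of Z + - (frag_of N - frag_of N - frag_of Z) \<in> P.H"
    by (intro P.H_add P.H_uminus rel M N iso catmod_iso_refl cat)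
  then have "P.eqv (frag_of N) (frag_of M)" by (simp add: P.eqv_def)
  then show ?thesis
    unfolding P.presented_class_eq using M N by (intro P.cls_eqI[symmetric]) auto
qed

section \<open>The stable category\<close>

lemma quot_module_cosets:
  assumes V: "Module.module K V" and W: "submodule W K V"
  shows "carrier (quot_module V W) = (\<lambda>v. W +>\<^bsub>V\<^esub> v) ` carrier V"
    and "lin_map K V (quot_module V W) (\<lambda>v. W +>\<^bsub>V\<^esub> v)"
    and "\<zero>\<^bsub>quot_module V W\<^esub> = W +>\<^bsub>V\<^esub> \<zero>\<^bsub>V\<^esub>"
    and "\<lbrakk>v \<in> carrier V; w \<in> carrier V\<rbrakk> \<Longrightarrow> W +>\<^bsub>V\<^esub> v = W +>\<^bsub>V\<^esub> w \<longleftrightarrow> v \<ominus>\<^bsub>V\<^esub> w \<in> W"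
    and "v \<in> carrier V \<Longrightarrow> v \<in> W +>\<^bsub>V\<^esub> v"
    and "\<lbrakk>v \<in> carrier V; w \<in> W +>\<^bsub>V\<^esub> v\<rbrakk> \<Longrightarrow> w \<in> carrier V \<and> W +>\<^bsub>V\<^esub> w = W +>\<^bsub>V\<^esub> v"
proof -
  interpret V: Module.module K V by fact
  interpret W: submodule W K V by fact
  interpret S: abelian_subgroup W V
    by (rule abelian_subgroupI3) (unfold_locales, simp add: additive_subgroup_def W.subgroup_axioms)
  have sub: "x \<in> carrier V" if "x \<in> W" for x using S.a_Hcarr that .
  show c: "carrier (quot_module V W) = (\<lambda>v. W +>\<^bsub>V\<^esub> v) ` carrier V"
    by (auto simp: quot_module_def A_RCOSETS_def')
  show self: "v \<in> W +>\<^bsub>V\<^esub> v" if "v \<in> carrier V" for v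
    using S.a_rcos_self that .
  show rep: "w \<in> carrier V \<and> W +>\<^bsub>V\<^esub> w = W +>\<^bsub>V\<^esub> v" if "v \<in> carrier V" "w \<in> W +>\<^bsub>V\<^esub> v" for v w
    using V.a_repr_independence[OF that(2,1) W.subgroup_axioms] S.a_elemrcos_carrier[OF that] by simp
  show eq: "W +>\<^bsub>V\<^esub> v = W +>\<^bsub>V\<^esub> w \<longleftrightarrow> v \<ominus>\<^bsub>V\<^esub> w \<in> W" if vw: "v \<in> carrier V" "w \<in> carrier V" for v w
  proof
    assume "W +>\<^bsub>V\<^esub> v = W +>\<^bsub>V\<^esub> w"
    then have "v \<in> W +>\<^bsub>V\<^esub> w" using self vw by blast
    then obtain h where h: "h \<in> W" "v = h \<oplus>\<^bsub>V\<^esub> w" by (auto simp: a_r_coset_def')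
    then have "v \<ominus>\<^bsub>V\<^esub> w = h" using sub vw by (simp add: a_minus_def V.a_assoc V.r_neg)
    then show "v \<ominus>\<^bsub>V\<^esub> w \<in> W" using h by simp
  next
    assume h: "v \<ominus>\<^bsub>V\<^esub> w \<in> W"
    have "v = (v \<ominus>\<^bsub>V\<^esub> w) \<oplus>\<^bsub>V\<^esub> w" using V.minus_add_cancel vw by simp
    then have "v \<in> W +>\<^bsub>V\<^esub> w" using h by (auto simp: a_r_coset_def')
    then show "W +>\<^bsub>V\<^esub> v = W +>\<^bsub>V\<^esub> w" using rep vw by blast
  qed
  show "\<zero>\<^bsub>quot_module V W\<^esub> = W +>\<^bsub>V\<^esub> \<zero>\<^bsub>V\<^esub>"
    using S.a_rcos_const[OF S.zero_closed] by (simp add: quot_module_def)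
  \<comment> \<open>\<open>quot_module\<close> forms a union over all representatives of the coset;
    it is a single coset because they all give the same one.\<close>
  have smult: "(\<Union>a\<in>W +>\<^bsub>V\<^esub> v. W +>\<^bsub>V\<^esub> (k \<odot>\<^bsub>V\<^esub> a)) = W +>\<^bsub>V\<^esub> (k \<odot>\<^bsub>V\<^esub> v)"
    if k: "k \<in> carrier K" and v: "v \<in> carrier V" for k v
  proof -
    have "W +>\<^bsub>V\<^esub> (k \<odot>\<^bsub>V\<^esub> a) = W +>\<^bsub>V\<^esub> (k \<odot>\<^bsub>V\<^esub> v)" if a: "a \<in> W +>\<^bsub>V\<^esub> v" for a
    proof -
      have ac: "a \<in> carrier V" and "a \<ominus>\<^bsub>V\<^esub> v \<in> W" using rep[OF v a] eq v by auto
      then have "k \<odot>\<^bsub>V\<^esub> (a \<ominus>\<^bsub>V\<^esub> v) \<in> W" using k by simp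
      then have "k \<odot>\<^bsub>V\<^esub> a \<ominus>\<^bsub>V\<^esub> k \<odot>\<^bsub>V\<^esub> v \<in> W"
        using k v ac by (simp add: a_minus_def V.smult_r_distr V.smult_r_minus)
      then show ?thesis using eq k v ac by simp
    qed
    then show ?thesis using self[OF v] by blast
  qed
  show "lin_map K V (quot_module V W) (\<lambda>v. W +>\<^bsub>V\<^esub> v)"
    unfolding lin_map_def c
  proof (intro conjI ballI Pi_I)
    fix x y assume xy: "x \<in> carrier V" "y \<in> carrier V"
    show "W +>\<^bsub>V\<^esub> (x \<oplus>\<^bsub>V\<^esub> y) = (W +>\<^bsub>V\<^esub> x) \<oplus>\<^bsub>quot_module V W\<^esub> (W +>\<^bsub>V\<^esub> y)"
      using S.a_rcos_sum[OF xy] by (simp add: quot_module_def)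
  next
    fix k x assume kx: "k \<in> carrier K" "x \<in> carrier V"
    show "W +>\<^bsub>V\<^esub> (k \<odot>\<^bsub>V\<^esub> x) = k \<odot>\<^bsub>quot_module V W\<^esub> (W +>\<^bsub>V\<^esub> x)"
      using smult[OF kx] by (simp add: quot_module_def)
  qed simp
qed

lemma quot_module_module:
  fixes K :: "'k ring"
  assumes V: "Module.module K V" and W: "submodule W K V"
  shows "Module.module K (quot_module V W)"
  by (rule module_image[OF V quot_module_cosets(2)[OF V W]
        quot_module_cosets(1)[OF V W, symmetric] quot_module_cosets(3)[OF V W, symmetric]])

lemma quot_module_lin_map:
  assumes V: "Module.module K V" and W: "submodule W K V" and \<phi>: "lin_map K V U \<phi>"
    and F: "\<And>v. v \<in> carrier V \<Longrightarrow> F (W +>\<^bsub>V\<^esub> v) = \<phi> v"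
  shows "lin_map K (quot_module V W) U F"
proof -
  interpret V: Module.module K V by fact
  note q = quot_module_cosets[OF V W]
  show ?thesis
    unfolding lin_map_def q(1)
  proof (intro conjI ballI Pi_I)
    fix a assume "a \<in> (\<lambda>v. W +>\<^bsub>V\<^esub> v) ` carrier V"
    then obtain x where x: "x \<in> carrier V" "a = W +>\<^bsub>V\<^esub> x" by blast
    show "F a \<in> carrier U" using lin_map_closed[OF \<phi> x(1)] F[OF x(1)] x(2) by simp
    fix b assume "b \<in> (\<lambda>v. W +>\<^bsub>V\<^esub> v) ` carrier V"
    then obtain y where y: "y \<in> carrier V" "b = W +>\<^bsub>V\<^esub> y" by blast
    show "F (a \<oplus>\<^bsub>quot_module V W\<^esub> b) = F a \<oplus>\<^bsub>U\<^esub> F b"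
      using F[OF V.add.m_closed[OF x(1) y(1)]] lin_map_add[OF q(2) x(1) y(1)] lin_map_add[OF \<phi> x(1) y(1)]
        F[OF x(1)] F[OF y(1)] x(2) y(2) by simp
  next
    fix k a assume k: "k \<in> carrier K" and "a \<in> (\<lambda>v. W +>\<^bsub>V\<^esub> v) ` carrier V"
    then obtain x where x: "x \<in> carrier V" "a = W +>\<^bsub>V\<^esub> x" by blast
    show "F (k \<odot>\<^bsub>quot_module V W\<^esub> a) = k \<odot>\<^bsub>U\<^esub> F a"
      using F[OF V.smult_closed[OF k x(1)]] lin_map_smult[OF q(2) k x(1)] lin_map_smult[OF \<phi> k x(1)]
        F[OF x(1)] x(2) by simp
  qed
qed

section \<open>The ideal of morphisms through projectives\<close>

locale frobenius_category = extriangulated_category K C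
  for K :: "'k ring" and C :: "('o,'m,'k,'e) extcat" +
  assumes frob: "frobenius C"
begin

abbreviation "through_proj \<equiv> factor_through C (projectives C)"

definition stable_mor :: "'o \<Rightarrow> 'o \<Rightarrow> 'm \<Rightarrow> 'm set" where
  "stable_mor X Y f = mor_class C (projectives C) X Y f"

lemma stable_mor_coset: "stable_mor X Y f = through_proj X Y +>\<^bsub>Hom C X Y\<^esub> f"
  by (simp add: stable_mor_def mor_class_def)

lemma stable_simps:
  "Ob (stable C) = Ob C" "Hom (stable C) X Y = quot_module (Hom C X Y) (through_proj X Y)"
  "One (stable C) X = stable_mor X X (One C X)"
  "Comp (stable C) X Y Z b a = (\<Union>g\<in>b. \<Union>f\<in>a. stable_mor X Z (Comp C X Y Z g f))"
  "Ext (stable C) = Ext C"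
  "Pull (stable C) Z' Z X c \<delta> = the_elem ((\<lambda>c'. Pull C Z' Z X c' \<delta>) ` c)"
  by (simp_all add: stable_def quot_extcat_def quot_lincat_def stable_mor_def)

lemma ex_projective_realization:
  assumes "Y \<in> Ob C"
  obtains L P k q \<kappa> where "P \<in> projectives C" "realizes C L P Y k q \<kappa>"
  using frob assms conflation_iff unfolding frobenius_def deflation_def by metis

lemma ex_injective_conflation:
  assumes "X \<in> Ob C"
  obtains I Y x y where "I \<in> injectives C" "conflation C X I Y x y"
  using frob assms unfolding frobenius_def inflation_def by metis

lemma factor_Pull_zero:
  assumes "X \<in> Ob C" "Y \<in> Ob C" "A \<in> Ob C" "f \<in> through_proj X Y" "\<delta> \<in> carrier (Ext C Y A)"
  shows "Pull C X Y A f \<delta> = \<zero>\<^bsub>Ext C X A\<^esub>"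
proof -
  obtain Q g h where Q: "Q \<in> projectives C" "g \<in> Mor C X Q" "h \<in> Mor C Q Y" "f = Comp C X Q Y h g"
    using assms(4) unfolding factor_through_def by blast
  have QO: "Q \<in> Ob C" using Q(1) by (simp add: projectives_def)
  have "Pull C Q Y A h \<delta> = \<zero>\<^bsub>Ext C Q A\<^esub>"
    using Pull_closed[OF assms(2) QO assms(3) Q(3) assms(5)] Q(1) assms(3) by (simp add: projectives_def)
  then show ?thesis using Pull_Comp[of Y Q X A h g \<delta>] Q QO assms by (simp add: Pull_zero)
qed

text \<open>Hence the ideal is the kernel of a linear map, so that it is a submodule.\<close>

lemma factor_iff:
  assumes "realizes C L P Y k q \<kappa>" "P \<in> projectives C" "X \<in> Ob C"
  shows "f \<in> through_proj X Y \<longleftrightarrow> f \<in> Mor C X Y \<and> Pull C X Y L f \<kappa> = \<zero>\<^bsub>Ext C X L\<^esub>"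
proof
  note d = realizesD[OF assms(1)]
  show "f \<in> Mor C X Y \<and> Pull C X Y L f \<kappa> = \<zero>\<^bsub>Ext C X L\<^esub>" if "f \<in> through_proj X Y"
    using factor_Pull_zero[OF assms(3) d(3,1) that d(6)] that by (simp add: factor_through_def)
  assume f: "f \<in> Mor C X Y \<and> Pull C X Y L f \<kappa> = \<zero>\<^bsub>Ext C X L\<^esub>"
  then obtain g where "g \<in> Mor C X P" "Comp C X P Y q g = f"
    using Pull_zero_factor[OF assms(1,3)] by metis
  then show "f \<in> through_proj X Y" using f assms(2) d unfolding factor_through_def by blast
qed

lemma factor_submodule:
  assumes X: "X \<in> Ob C" and Y: "Y \<in> Ob C"
  shows "submodule (through_proj X Y) K (Hom C X Y)"
proof -
  obtain L P k q \<kappa> where P: "P \<in> projectives C" "realizes C L P Y k q \<kappa>"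
    using ex_projective_realization[OF Y] .
  note d = realizesD[OF P(2)]
  interpret H: Module.module K "Hom C X Y" using Hom_module X Y .
  interpret E: Module.module K "Ext C X L" using Ext_module X d(1) .
  have lin: "lin_map K (Hom C X Y) (Ext C X L) (\<lambda>f. Pull C X Y L f \<kappa>)"
    using Pull_linear_mor Y X d(1,6) .
  interpret h: abelian_group_hom "Hom C X Y" "Ext C X L" "\<lambda>f. Pull C X Y L f \<kappa>"
    using lin_map_hom[OF H.module_axioms E.module_axioms lin] .
  show ?thesis
    by (rule H.submoduleI) (auto simp: factor_iff[OF P(2,1) X] lin_map_smult[OF lin])
qed

lemma factor_comp_left:
  assumes "X \<in> Ob C" "Y \<in> Ob C" "Z \<in> Ob C" "f \<in> through_proj X Y" "g \<in> Mor C Y Z"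
  shows "Comp C X Y Z g f \<in> through_proj X Z"
proof -
  obtain Q a b where Q: "Q \<in> projectives C" "a \<in> Mor C X Q" "b \<in> Mor C Q Y" "f = Comp C X Q Y b a"
    and f: "f \<in> Mor C X Y"
    using assms(4) unfolding factor_through_def by blast
  have QO: "Q \<in> Ob C" using Q(1) by (simp add: projectives_def)
  have "Comp C X Y Z g f = Comp C X Q Z (Comp C Q Y Z g b) a"
    using Comp_assoc[of X Q Y Z a b g] Q QO assms by simp
  then show ?thesis unfolding factor_through_def
    using Q QO f assms Comp_closed[of Q Y Z b g] Comp_closed[of X Y Z f g] by blast
qed

lemma factor_comp_right:
  assumes "X \<in> Ob C" "Y \<in> Ob C" "Z \<in> Ob C" "f \<in> Mor C X Y" "g \<in> through_proj Y Z"
  shows "Comp C X Y Z g f \<in> through_proj X Z"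
proof -
  obtain Q a b where Q: "Q \<in> projectives C" "a \<in> Mor C Y Q" "b \<in> Mor C Q Z" "g = Comp C Y Q Z b a"
    and g: "g \<in> Mor C Y Z"
    using assms(5) unfolding factor_through_def by blast
  have QO: "Q \<in> Ob C" using Q(1) by (simp add: projectives_def)
  have "Comp C X Y Z g f = Comp C X Q Z b (Comp C X Y Q a f)"
    using Comp_assoc[of X Y Q Z f a b] Q QO assms by simp
  then show ?thesis unfolding factor_through_def
    using Q QO g assms Comp_closed[of X Y Q f a] Comp_closed[of X Y Z f g] by blast
qed

context
  fixes X Y assumes X: "X \<in> Ob C" and Y: "Y \<in> Ob C"
begin

lemmas stable_mor_cosets = quot_module_cosets[OF Hom_module[OF X Y] factor_submodule[OF X Y], folded stable_mor_coset]

lemma stable_Mor: "Mor (stable C) X Y = stable_mor X Y ` Mor C X Y"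
  using stable_mor_cosets(1) by (simp add: stable_simps)

lemma stable_Hom_module: "Module.module K (Hom (stable C) X Y)"
  using quot_module_module[OF Hom_module[OF X Y] factor_submodule[OF X Y]] by (simp add: stable_simps)

lemma stable_mor_eq_iff: "f \<in> Mor C X Y \<Longrightarrow> g \<in> Mor C X Y \<Longrightarrow> stable_mor X Y f = stable_mor X Y g \<longleftrightarrow> f \<ominus>\<^bsub>Hom C X Y\<^esub> g \<in> through_proj X Y"
  by (rule stable_mor_cosets(4))

lemma Pull_stable_mor_eq:
  assumes "f \<in> Mor C X Y" "g \<in> Mor C X Y" "stable_mor X Y f = stable_mor X Y g" "A \<in> Ob C" "\<delta> \<in> carrier (Ext C Y A)"
  shows "Pull C X Y A f \<delta> = Pull C X Y A g \<delta>"
proof -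
  interpret abelian_group "Ext C X A" using Ext_abelian_group X assms(4) .
  have "Pull C X Y A (f \<ominus>\<^bsub>Hom C X Y\<^esub> g) \<delta> = \<zero>\<^bsub>Ext C X A\<^esub>"
    using factor_Pull_zero[OF X Y assms(4) _ assms(5)] stable_mor_eq_iff assms by blast
  then show ?thesis
    using Pull_minus_mor[OF Y X assms(4,5,1,2)] minus_zero_iff Pull_closed[OF Y X assms(4)] assms by simp
qed

text \<open>The stable action is \<open>the_elem\<close> of an image set. By
  \<open>Pull_stable_mor_eq\<close> all representatives of a stable morphism act alike, so this set
  is a singleton.\<close>

lemma stable_Pull:
  assumes f: "f \<in> Mor C X Y" and A: "A \<in> Ob C" and d: "\<delta> \<in> carrier (Ext C Y A)"
  shows "Pull (stable C) X Y A (stable_mor X Y f) \<delta> = Pull C X Y A f \<delta>"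
proof -
  have "(\<lambda>c'. Pull C X Y A c' \<delta>) ` stable_mor X Y f = {Pull C X Y A f \<delta>}"
    using Pull_stable_mor_eq[OF _ f _ A d] stable_mor_cosets(5)[OF f] stable_mor_cosets(6)[OF f] by blast
  then show ?thesis by (simp add: stable_simps)
qed

end

text \<open>Stable composition is a union over pairs of representatives. Replacing first
  \<open>b\<close> by \<open>g\<close> and then \<open>a\<close> by \<open>f\<close> changes the
  composite only within the ideal.\<close>

lemma stable_Comp:
  assumes o: "X \<in> Ob C" "Y \<in> Ob C" "Z \<in> Ob C" and f: "f \<in> Mor C X Y" and g: "g \<in> Mor C Y Z"
  shows "Comp (stable C) X Y Z (stable_mor Y Z g) (stable_mor X Y f) = stable_mor X Z (Comp C X Y Z g f)"
proof -
  interpret H: abelian_group "Hom C X Z" using Hom_abelian_group o by simp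
  have "stable_mor X Z (Comp C X Y Z b a) = stable_mor X Z (Comp C X Y Z g f)" if b: "b \<in> stable_mor Y Z g" and a: "a \<in> stable_mor X Y f" for a b
  proof -
    have b': "b \<in> Mor C Y Z" "b \<ominus>\<^bsub>Hom C Y Z\<^esub> g \<in> through_proj Y Z"
      using stable_mor_cosets(6)[OF o(2,3) g b] stable_mor_eq_iff[OF o(2,3) _ g] by auto
    have a': "a \<in> Mor C X Y" "a \<ominus>\<^bsub>Hom C X Y\<^esub> f \<in> through_proj X Y"
      using stable_mor_cosets(6)[OF o(1,2) f a] stable_mor_eq_iff[OF o(1,2) _ f] by auto
    have "Comp C X Y Z b a \<ominus>\<^bsub>Hom C X Z\<^esub> Comp C X Y Z g a \<in> through_proj X Z"
      using factor_comp_right[OF o a'(1) b'(2)] Comp_minus_left[OF o a'(1) b'(1) g] by simp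
    then have 1: "stable_mor X Z (Comp C X Y Z b a) = stable_mor X Z (Comp C X Y Z g a)"
      using stable_mor_eq_iff[OF o(1,3)] Comp_closed o a' b' g by simp
    have "Comp C X Y Z g a \<ominus>\<^bsub>Hom C X Z\<^esub> Comp C X Y Z g f \<in> through_proj X Z"
      using factor_comp_left[OF o a'(2) g] Comp_minus_right[OF o g a'(1) f] by simp
    then show ?thesis unfolding 1 using stable_mor_eq_iff[OF o(1,3)] Comp_closed o a' f g by simp
  qed
  moreover have "g \<in> stable_mor Y Z g" "f \<in> stable_mor X Y f" using stable_mor_cosets(5) o f g by blast+
  ultimately show ?thesis unfolding stable_simps by blast
qed

lemma stable_sub_simps:
  "Ob (stable_sub C T) = T" "Hom (stable_sub C T) = Hom (stable C)"
  "One (stable_sub C T) = One (stable C)" "Comp (stable_sub C T) = Comp (stable C)"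
  by (simp_all add: stable_sub_def full_sub_def)

lemma ext_mod_simps:
  "MOb (ext_mod C X) Y = Ext C Y X" "MMor (ext_mod C X) Y Y' f \<delta> = Pull (stable C) Y Y' X f \<delta>"
  by (simp_all add: ext_mod_def stable_simps)

lemma ext_mod_catmod:
  assumes T: "T \<subseteq> Ob C" and X: "X \<in> Ob C"
  shows "is_catmod K (stable_sub C T) (ext_mod C X)"
  unfolding is_catmod_def stable_sub_simps ext_mod_simps
proof (intro conjI ballI)
  fix Y assume Y: "Y \<in> T"
  then have YO: "Y \<in> Ob C" using T by blast
  show "Module.module K (Ext C Y X)" using Ext_module YO X .
  { fix u assume "u \<in> carrier (Ext C Y X)"
    then show "Pull (stable C) Y Y X (One (stable C) Y) u = u"
      using stable_Pull[OF YO YO One_closed[OF YO] X] Pull_One[OF YO X] by (simp add: stable_simps) }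
  fix Z assume Z: "Z \<in> T"
  then have ZO: "Z \<in> Ob C" using T by blast
  { fix f assume "f \<in> Mor (stable C) Y Z"
    then obtain f0 where f0: "f0 \<in> Mor C Y Z" "f = stable_mor Y Z f0" using stable_Mor[OF YO ZO] by blast
    show "lin_map K (Ext C Z X) (Ext C Y X) (Pull (stable C) Y Z X f)"
      using Pull_linear[OF ZO YO X f0(1)] stable_Pull[OF YO ZO f0(1) X] f0(2)
      unfolding lin_map_def ext_mod_simps
      using abelian_monoid.a_closed[OF abelian_group.axioms(1)[OF Ext_abelian_group[OF ZO X]]]
        Module.module.smult_closed[OF Ext_module[OF ZO X]]
      by (auto simp: Pi_iff) }
  { fix u assume u: "u \<in> carrier (Ext C Z X)"
    show "lin_map K (Hom (stable C) Y Z) (Ext C Y X) (\<lambda>f. Pull (stable C) Y Z X f u)"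
      unfolding stable_simps(2)
      by (rule quot_module_lin_map[OF Hom_module[OF YO ZO] factor_submodule[OF YO ZO] Pull_linear_mor[OF ZO YO X u]])
        (use stable_Pull[OF YO ZO _ X u] in \<open>simp add: stable_mor_coset\<close>) }
  fix W f g u assume W: "W \<in> T" "f \<in> Mor (stable C) Y Z" "g \<in> Mor (stable C) Z W" "u \<in> carrier (Ext C W X)"
  then have WO: "W \<in> Ob C" using T by blast
  obtain f0 where f0: "f0 \<in> Mor C Y Z" "f = stable_mor Y Z f0" using stable_Mor[OF YO ZO] W by blast
  obtain g0 where g0: "g0 \<in> Mor C Z W" "g = stable_mor Z W g0" using stable_Mor[OF ZO WO] W by blast
  show "Pull (stable C) Y W X (Comp (stable C) Y Z W g f) u =
      Pull (stable C) Y Z X f (Pull (stable C) Z W X g u)"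
    using stable_Comp[OF YO ZO WO f0(1) g0(1)] stable_Pull f0 g0 YO ZO WO X W(4)
      Pull_Comp[OF WO ZO YO X g0(1) f0(1) W(4)] by (simp add: Comp_closed Pull_closed)
qed

end

section \<open>Modules of extensions\<close>

locale cluster_tilting_frobenius = cluster_tilting_sub K C T + frobenius_category K C
  for K :: "'k ring" and C :: "('o,'m,'k,'e) extcat" and T :: "'o set"
begin

abbreviation "stable_T \<equiv> stable_sub C T"

lemma T_sub: "T \<subseteq> Ob C" using T_Ob by blast

lemma ext_mod_stable_T: "X \<in> Ob C \<Longrightarrow> is_catmod K stable_T (ext_mod C X)"
  by (rule ext_mod_catmod[OF T_sub])

text \<open>A coindex conflation X -> L -> R is a presentation: on \<open>T\<close> the sequence
  Hom(-,L) -> Hom(-,R) -> Ext(-,X) is exact, and the last map is onto because Ext(-,L) vanishes. It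
  descends to stable morphisms since the projectives act as zero on Ext.\<close>

lemma ext_mod_fp:
  assumes X: "X \<in> Ob C"
  shows "finitely_presented K stable_T (ext_mod C X)"
proof -
  obtain L R i p \<delta> where R: "L \<in> T" "R \<in> T" "realizes C X L R i p \<delta>"
    using ex_coindex_conflation[OF X] conflation_iff by metis
  note d = realizesD[OF R(3)]
  have val: "Pull (stable C) V R X (stable_mor V R c) \<delta> = Pull C V R X c \<delta>" if "V \<in> T" "c \<in> Mor C V R" for V c
    by (rule stable_Pull[OF T_Ob[OF that(1)] d(3) that(2) d(1,6)])
  show ?thesis
  proof (rule finitely_presentedI[OF ext_mod_stable_T[OF X], unfolded stable_sub_simps, OF R(1,2)])
    show "stable_mor L R p \<in> Mor (stable C) L R" unfolding stable_Mor[OF d(2,3)] using d(5) by blast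
    show "catmod_hom K stable_T (representable stable_T R) (ext_mod C X) (\<lambda>V u. MMor (ext_mod C X) V R u \<delta>)"
      by (rule yoneda_hom[OF ext_mod_stable_T[OF X]]) (use R d in \<open>simp_all add: stable_sub_simps ext_mod_simps\<close>)
    fix V assume V: "V \<in> T"
    note VO = T_Ob[OF V]
    show "(\<lambda>u. MMor (ext_mod C X) V R u \<delta>) ` Mor (stable C) V R = carrier (MOb (ext_mod C X) V)"
    proof (intro equalityI subsetI)
      fix \<epsilon> assume "\<epsilon> \<in> (\<lambda>u. MMor (ext_mod C X) V R u \<delta>) ` Mor (stable C) V R"
      then obtain c where c: "c \<in> Mor C V R" "\<epsilon> = Pull (stable C) V R X (stable_mor V R c) \<delta>"
        unfolding stable_Mor[OF VO d(3)] ext_mod_simps by blast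
      show "\<epsilon> \<in> carrier (MOb (ext_mod C X) V)"
        unfolding c(2) val[OF V c(1)] ext_mod_simps by (rule Pull_closed[OF d(3) VO d(1) c(1) d(6)])
    next
      fix \<epsilon> assume "\<epsilon> \<in> carrier (MOb (ext_mod C X) V)"
      then have e: "\<epsilon> \<in> carrier (Ext C V X)" by (simp add: ext_mod_simps)
      have "Push C V X L i \<epsilon> = \<zero>\<^bsub>Ext C V L\<^esub>"
        using Push_closed[OF VO d(1,2,4) e] T_rigid[OF V R(1)] by simp
      then obtain c where c: "c \<in> Mor C V R" "\<epsilon> = Pull C V R X c \<delta>"
        using Push_zero_Pull[OF R(3) VO e] by blast
      then have "\<epsilon> = MMor (ext_mod C X) V R (stable_mor V R c) \<delta>"
        unfolding ext_mod_simps val[OF V c(1)] by simp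
      then show "\<epsilon> \<in> (\<lambda>u. MMor (ext_mod C X) V R u \<delta>) ` Mor (stable C) V R"
        unfolding stable_Mor[OF VO d(3)] using c(1) by blast
    qed
    show "{u \<in> Mor (stable C) V R. MMor (ext_mod C X) V R u \<delta> = \<zero>\<^bsub>MOb (ext_mod C X) V\<^esub>} =
        Comp (stable C) V L R (stable_mor L R p) ` Mor (stable C) V L"
    proof (intro equalityI subsetI)
      fix u assume "u \<in> {u \<in> Mor (stable C) V R. MMor (ext_mod C X) V R u \<delta> = \<zero>\<^bsub>MOb (ext_mod C X) V\<^esub>}"
      then obtain c where c: "c \<in> Mor C V R" "u = stable_mor V R c"
          "Pull (stable C) V R X (stable_mor V R c) \<delta> = \<zero>\<^bsub>Ext C V X\<^esub>"
        unfolding stable_Mor[OF VO d(3)] ext_mod_simps by blast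
      note c3 = c(3)[unfolded val[OF V c(1)]]
      obtain g where g: "g \<in> Mor C V L" "Comp C V L R p g = c"
        using Pull_zero_factor[OF R(3) VO c(1) c3] .
      then have "u = Comp (stable C) V L R (stable_mor L R p) (stable_mor V L g)"
        using stable_Comp[OF VO d(2,3) g(1) d(5)] c(2) by simp
      then show "u \<in> Comp (stable C) V L R (stable_mor L R p) ` Mor (stable C) V L"
        unfolding stable_Mor[OF VO d(2)] using g(1) by blast
    next
      fix u assume "u \<in> Comp (stable C) V L R (stable_mor L R p) ` Mor (stable C) V L"
      then obtain g where g: "g \<in> Mor C V L" "u = Comp (stable C) V L R (stable_mor L R p) (stable_mor V L g)"
        unfolding stable_Mor[OF VO d(2)] by blast
      then have u: "u = stable_mor V R (Comp C V L R p g)" using stable_Comp[OF VO d(2,3) g(1) d(5)] by simp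
      have pg: "Comp C V L R p g \<in> Mor C V R" using Comp_closed[OF VO d(2,3) g(1) d(5)] .
      show "u \<in> {u \<in> Mor (stable C) V R. MMor (ext_mod C X) V R u \<delta> = \<zero>\<^bsub>MOb (ext_mod C X) V\<^esub>}"
        unfolding u stable_Mor[OF VO d(3)] ext_mod_simps
        using pg val[OF V pg] Pull_factor_zero[OF R(3) VO g(1)] by simp
    qed
  qed
qed

text \<open>Choose a conflation L -> P -> R with P projective, hence in \<open>T\<close>. On
  \<open>T\<close>, stable Hom(-,R) is then Ext(-,L), by pulling back \<kappa>. If M is presented by
  R' -> R, lift that map to \<open>f0\<close> and let L -> X -> R' realise the pullback of \<kappa>
  along \<open>f0\<close>. As Ext(-,R') vanishes on \<open>T\<close>, Ext(-,X) is the cokernel of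
  Hom(-,R') -> Ext(-,L), which is the presentation of M again.\<close>

lemma fp_iso_ext_mod:
  assumes M: "finitely_presented K stable_T M"
  shows "\<exists>X\<in>Ob C. catmod_iso K stable_T M (ext_mod C X)"
proof -
  have cM: "is_catmod K stable_T M" using M unfolding finitely_presented_def by blast
  obtain R' R f \<pi> where R: "R' \<in> Ob stable_T" "R \<in> Ob stable_T" "f \<in> Mor stable_T R' R" "catmod_hom K stable_T (representable stable_T R) M \<pi>"
    and onto: "\<forall>V\<in>Ob stable_T. \<pi> V ` Mor stable_T V R = carrier (MOb M V)"
    and ker: "\<forall>V\<in>Ob stable_T. {u \<in> Mor stable_T V R. \<pi> V u = \<zero>\<^bsub>MOb M V\<^esub>} = Comp stable_T V R' R f ` Mor stable_T V R'"
    by (rule finitely_presentedE[OF M])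
  have RT: "R' \<in> T" "R \<in> T" using R by (simp_all add: stable_sub_simps)
  note RO = RT[THEN T_Ob]
  obtain f0 where f0: "f0 \<in> Mor C R' R" "f = stable_mor R' R f0"
    using R(3) unfolding stable_sub_simps stable_Mor[OF RO] by blast
  obtain L P k q \<kappa> where P: "P \<in> projectives C" "realizes C L P R k q \<kappa>"
    using ex_projective_realization[OF RO(2)] .
  note d = realizesD[OF P(2)]
  have PT: "P \<in> T" using P(1) frob injective_T by (auto simp: frobenius_def)
  obtain X x y where X: "realizes C L X R' x y (Pull C R' R L f0 \<kappa>)"
    using ex_realization[OF d(1) RO(1) Pull_closed[OF d(3) RO(1) d(1) f0(1) d(6)]] .
  note e = realizesD[OF X]
  \<comment> \<open>By the Yoneda lemma a map from the module represented by R to Ext(-,X) is an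
    element of Ext(R,X); this one corresponds to pulling back \<kappa> and then pushing forward
    along L -> X.\<close>
  let ?m = "Push C R L X x \<kappa>"
  have m: "?m \<in> carrier (Ext C R X)" using Push_closed[OF d(3) d(1) e(2,4) d(6)] .
  let ?\<pi> = "\<lambda>V u. MMor (ext_mod C X) V R u ?m"
  have val: "?\<pi> V (stable_mor V R c) = Push C V L X x (Pull C V R L c \<kappa>)" if "V \<in> T" "c \<in> Mor C V R" for V c
    using stable_Pull[OF T_Ob[OF that(1)] d(3) that(2) e(2) m]
      Push_Pull[OF d(3) T_Ob[OF that(1)] d(1) e(2) that(2) e(4) d(6)] by (simp add: ext_mod_simps)
  have "catmod_iso K stable_T M (ext_mod C X)"
  proof (rule cokernel_unique[OF cM ext_mod_stable_T[OF e(2)] _ R(4), unfolded stable_sub_simps])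
    show "Module.module K (Hom (stable C) V R)" if "V \<in> T" for V
      by (rule stable_Hom_module[OF T_Ob[OF that] RO(2)])
    show "catmod_hom K stable_T (representable stable_T R) (ext_mod C X) ?\<pi>"
      by (rule yoneda_hom[OF ext_mod_stable_T[OF e(2)] R(2)]) (simp add: ext_mod_simps m)
    show "\<pi> V ` Mor (stable C) V R = carrier (MOb M V)" if "V \<in> T" for V
      using onto that by (simp add: stable_sub_simps)
    fix V assume V: "V \<in> T"
    note VO = T_Ob[OF V]
    show "?\<pi> V ` Mor (stable C) V R = carrier (MOb (ext_mod C X) V)"
    proof (intro equalityI subsetI)
      fix \<epsilon> assume "\<epsilon> \<in> ?\<pi> V ` Mor (stable C) V R"
      then obtain c where c: "c \<in> Mor C V R" "\<epsilon> = ?\<pi> V (stable_mor V R c)" unfolding stable_Mor[OF VO RO(2)] by blast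
      have "\<epsilon> = Push C V L X x (Pull C V R L c \<kappa>)" unfolding c(2) by (rule val[OF V c(1)])
      then show "\<epsilon> \<in> carrier (MOb (ext_mod C X) V)"
        using Push_closed[OF VO d(1) e(2,4) Pull_closed[OF d(3) VO d(1) c(1) d(6)]] by (simp add: ext_mod_simps)
    next
      fix \<epsilon> assume "\<epsilon> \<in> carrier (MOb (ext_mod C X) V)"
      then have \<epsilon>: "\<epsilon> \<in> carrier (Ext C V X)" by (simp add: ext_mod_simps)
      have "Push C V X R' y \<epsilon> = \<zero>\<^bsub>Ext C V R'\<^esub>"
        using Push_closed[OF VO e(2,3,5) \<epsilon>] T_rigid[OF V RT(1)] by simp
      then obtain \<eta> where \<eta>: "\<eta> \<in> carrier (Ext C V L)" "\<epsilon> = Push C V L X x \<eta>"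
        using Push_deflation_zero[OF X VO \<epsilon>] by blast
      have "Push C V L P k \<eta> = \<zero>\<^bsub>Ext C V P\<^esub>"
        using Push_closed[OF VO d(1,2,4) \<eta>(1)] T_rigid[OF V PT] by simp
      then obtain c where c: "c \<in> Mor C V R" "\<eta> = Pull C V R L c \<kappa>"
        using Push_zero_Pull[OF P(2) VO \<eta>(1)] by blast
      have "stable_mor V R c \<in> Mor (stable C) V R" unfolding stable_Mor[OF VO RO(2)] using c(1) by blast
      moreover have "\<epsilon> = ?\<pi> V (stable_mor V R c)" unfolding val[OF V c(1)] using \<eta> c by simp
      ultimately show "\<epsilon> \<in> ?\<pi> V ` Mor (stable C) V R" by blast
    qed
    show "Comp (stable C) V W R u g \<in> Mor (stable C) V R"
      if W: "W \<in> T" and g: "g \<in> Mor (stable C) V W" and u: "u \<in> Mor (stable C) W R" for W g u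
    proof -
      obtain g0 where g0: "g0 \<in> Mor C V W" "g = stable_mor V W g0"
        using g unfolding stable_Mor[OF VO T_Ob[OF W]] by blast
      obtain u0 where u0: "u0 \<in> Mor C W R" "u = stable_mor W R u0"
        using u unfolding stable_Mor[OF T_Ob[OF W] RO(2)] by blast
      show ?thesis
        unfolding g0(2) u0(2) stable_Comp[OF VO T_Ob[OF W] RO(2) g0(1) u0(1)] stable_Mor[OF VO RO(2)]
        by (rule imageI[OF Comp_closed[OF VO T_Ob[OF W] RO(2) g0(1) u0(1)]])
    qed
    fix u assume u: "u \<in> Mor (stable C) V R"
    then obtain c where c: "c \<in> Mor C V R" "u = stable_mor V R c" unfolding stable_Mor[OF VO RO(2)] by blast
    \<comment> \<open>Both kernels are brought to one condition: the pullback of \<kappa> along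
      \<open>c\<close> is also a pullback of its restriction to R'. For M this uses that stable
      morphisms to R are detected by \<kappa>, for Ext(-,X) exactness at Ext(V,L).\<close>
    have "\<pi> V u = \<zero>\<^bsub>MOb M V\<^esub> \<longleftrightarrow> u \<in> {u \<in> Mor (stable C) V R. \<pi> V u = \<zero>\<^bsub>MOb M V\<^esub>}"
      using u by simp
    also have "\<dots> \<longleftrightarrow> u \<in> Comp (stable C) V R' R f ` Mor (stable C) V R'"
      using ker V by (simp add: stable_sub_simps)
    also have "\<dots> \<longleftrightarrow> (\<exists>b\<in>Mor C V R'. stable_mor V R c = stable_mor V R (Comp C V R' R f0 b))"
    proof -
      have "Comp (stable C) V R' R f (stable_mor V R' b) = stable_mor V R (Comp C V R' R f0 b)" if "b \<in> Mor C V R'" for b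
        unfolding f0(2) by (rule stable_Comp[OF VO RO that f0(1)])
      then show ?thesis unfolding c(2) stable_Mor[OF VO RO(1)] by (auto simp: image_iff)
    qed
    also have "\<dots> \<longleftrightarrow> (\<exists>b\<in>Mor C V R'. Pull C V R L c \<kappa> = Pull C V R' L b (Pull C R' R L f0 \<kappa>))"
    proof -
      have "stable_mor V R c = stable_mor V R (Comp C V R' R f0 b) \<longleftrightarrow> Pull C V R L c \<kappa> = Pull C V R' L b (Pull C R' R L f0 \<kappa>)"
        if b: "b \<in> Mor C V R'" for b
      proof -
        interpret E: abelian_group "Ext C V L" using Ext_abelian_group VO d(1) .
        have fb: "Comp C V R' R f0 b \<in> Mor C V R" using Comp_closed[OF VO RO b f0(1)] .
        have "stable_mor V R c = stable_mor V R (Comp C V R' R f0 b) \<longleftrightarrow>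
            Pull C V R L (c \<ominus>\<^bsub>Hom C V R\<^esub> Comp C V R' R f0 b) \<kappa> = \<zero>\<^bsub>Ext C V L\<^esub>"
          using stable_mor_eq_iff[OF VO RO(2) c(1) fb] factor_iff[OF P(2,1) VO] minus_closed[OF VO RO(2) c(1) fb] by simp
        also have "\<dots> \<longleftrightarrow> Pull C V R L c \<kappa> = Pull C V R L (Comp C V R' R f0 b) \<kappa>"
          using Pull_minus_mor[OF d(3) VO d(1,6) c(1) fb]
            E.minus_zero_iff[OF Pull_closed[OF d(3) VO d(1) c(1) d(6)] Pull_closed[OF d(3) VO d(1) fb d(6)]] by simp
        also have "Pull C V R L (Comp C V R' R f0 b) \<kappa> = Pull C V R' L b (Pull C R' R L f0 \<kappa>)"
          by (rule Pull_Comp[OF d(3) RO(1) VO d(1) f0(1) b d(6)])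
        finally show ?thesis .
      qed
      then show ?thesis by blast
    qed
    also have "\<dots> \<longleftrightarrow> Push C V L X x (Pull C V R L c \<kappa>) = \<zero>\<^bsub>Ext C V X\<^esub>"
    proof
      assume "\<exists>b\<in>Mor C V R'. Pull C V R L c \<kappa> = Pull C V R' L b (Pull C R' R L f0 \<kappa>)"
      then obtain b where b: "b \<in> Mor C V R'" "Pull C V R L c \<kappa> = Pull C V R' L b (Pull C R' R L f0 \<kappa>)" by blast
      show "Push C V L X x (Pull C V R L c \<kappa>) = \<zero>\<^bsub>Ext C V X\<^esub>"
        using Push_Pull[OF e(3) VO d(1) e(2) b(1) e(4) e(6)] b(2) Push_inflation_zero[OF X]
          Pull_zero[OF e(3) VO e(2) b(1)] by simp
    next
      assume "Push C V L X x (Pull C V R L c \<kappa>) = \<zero>\<^bsub>Ext C V X\<^esub>"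
      then show "\<exists>b\<in>Mor C V R'. Pull C V R L c \<kappa> = Pull C V R' L b (Pull C R' R L f0 \<kappa>)"
        using Push_zero_Pull[OF X VO Pull_closed[OF d(3) VO d(1) c(1) d(6)]] by metis
    qed
    also have "\<dots> \<longleftrightarrow> ?\<pi> V u = \<zero>\<^bsub>MOb (ext_mod C X) V\<^esub>"
      unfolding c(2) val[OF V c(1)] by (simp add: ext_mod_simps)
    finally show "\<pi> V u = \<zero>\<^bsub>MOb M V\<^esub> \<longleftrightarrow> ?\<pi> V u = \<zero>\<^bsub>MOb (ext_mod C X) V\<^esub>" .
  qed
  then show ?thesis using e(2) by blast
qed

text \<open>Extensions by an injective object vanish, so a representative of such an extension
  module is the zero module that \<open>presented_class_iso\<close> asks for.\<close>

lemma ex_zero_fp: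
  obtains Z where "Z \<in> fp_modules K stable_T" "\<forall>V\<in>Ob stable_T. carrier (MOb Z V) = {\<zero>\<^bsub>MOb Z V\<^esub>}"
proof -
  obtain N where "zero_obj C N" using ex_zero_obj by blast
  then have "N \<in> Ob C" by (simp add: zero_obj_def)
  then obtain I where I: "I \<in> injectives C" using ex_injective_conflation by metis
  then have IO: "I \<in> Ob C" by (simp add: injectives_def)
  obtain Z where Z: "Z \<in> fp_modules K stable_T" "catmod_iso K stable_T (ext_mod C I) Z"
    using ex_fp_representative[OF ext_mod_fp[OF IO]] by blast
  have cZ: "is_catmod K stable_T Z" using Z(1) by (simp add: fp_modules_def finitely_presented_def)
  have "carrier (MOb Z V) = {\<zero>\<^bsub>MOb Z V\<^esub>}" if V: "V \<in> Ob stable_T" for V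
  proof -
    interpret Module.module K "MOb Z V" using is_catmodD(1)[OF cZ V] .
    obtain \<eta> where "bij_betw (\<eta> V) (carrier (Ext C V I)) (carrier (MOb Z V))"
      using Z(2) V unfolding catmod_iso_def ext_mod_simps by blast
    moreover have "carrier (Ext C V I) = {\<zero>\<^bsub>Ext C V I\<^esub>}"
      using I V T_Ob by (simp add: injectives_def stable_sub_simps)
    ultimately have "carrier (MOb Z V) = {\<eta> V \<zero>\<^bsub>Ext C V I\<^esub>}" by (simp add: bij_betw_def)
    then show ?thesis using zero_closed by auto
  qed
  then show thesis using that Z(1) by blast
qed

lemma mod_class_ext_mod:
  assumes X: "X \<in> Ob C"
  obtains N where "N \<in> fp_modules K stable_T" "catmod_iso K stable_T (ext_mod C X) N"
    "mod_class K stable_T (ext_mod C X) = presented_class (fp_modules K stable_T) (exact_relators K stable_T) N"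
proof -
  let ?N = "SOME N. N \<in> fp_modules K stable_T \<and> catmod_iso K stable_T (ext_mod C X) N"
  have "\<exists>N. N \<in> fp_modules K stable_T \<and> catmod_iso K stable_T (ext_mod C X) N"
    using ex_fp_representative[OF ext_mod_fp[OF X]] by blast
  from someI_ex[OF this] show thesis using that[of ?N] by (simp add: mod_class_def)
qed

lemma mod_class_closed:
  assumes "X \<in> Ob C"
  shows "mod_class K stable_T (ext_mod C X) \<in> carrier (K0_mod K stable_T)"
proof -
  interpret P: group_presentation "fp_modules K stable_T" "exact_relators K stable_T"
    by (rule group_presentation_K0_mod)
  obtain N where N: "N \<in> fp_modules K stable_T"
    "mod_class K stable_T (ext_mod C X) = presented_class (fp_modules K stable_T) (exact_relators K stable_T) N"
    using mod_class_ext_mod[OF assms] by metis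
  show ?thesis unfolding N(2) K0_mod_def P.presented_class_eq by (rule P.cls_closed) (use N(1) in simp)
qed

text \<open>This lets homomorphisms out of the Grothendieck group be compared on the classes of
  extension modules, where their values are prescribed: every generator is such a class.\<close>

lemma presented_class_ext_mod:
  assumes M: "M \<in> fp_modules K stable_T"
  shows "\<exists>X\<in>Ob C. presented_class (fp_modules K stable_T) (exact_relators K stable_T) M = mod_class K stable_T (ext_mod C X)"
proof -
  obtain X where X: "X \<in> Ob C" "catmod_iso K stable_T M (ext_mod C X)"
    using fp_iso_ext_mod M unfolding fp_modules_def by blast
  obtain N where N: "N \<in> fp_modules K stable_T" "catmod_iso K stable_T (ext_mod C X) N"
    "mod_class K stable_T (ext_mod C X) = presented_class (fp_modules K stable_T) (exact_relators K stable_T) N"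
    using mod_class_ext_mod[OF X(1)] .
  obtain Z where Z: "Z \<in> fp_modules K stable_T" "\<forall>V\<in>Ob stable_T. carrier (MOb Z V) = {\<zero>\<^bsub>MOb Z V\<^esub>}"
    by (rule ex_zero_fp)
  show ?thesis
    using presented_class_iso[OF Z(1) bspec[OF Z(2)] M N(1) catmod_iso_trans[OF X(2) N(2)]] N(3) X(1) by metis
qed

section \<open>Kernels and cokernels as modules of extensions\<close>

lemma ker_iso_ext_mod:
  assumes XYZ: "realizes C X Y Z i p \<delta>"
  obtains E where "E \<in> Ob C"
    "catmod_iso K stable_T (ext_mod C E) (ker_catmod (ext_mod C X) (ext_mod C Y) (ext_map C X Y i))"
    "\<And>a b x y z. \<lbrakk>is_coindex E a; is_index E b; is_index X x; is_index Y y; is_index Z z\<rbrakk> \<Longrightarrow> a - b \<simeq> y - x - z"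
proof -
  note o = realizesD[OF XYZ]
  obtain E e where E: "E \<in> Ob C" "e \<in> Mor C E X"
    and inj: "\<And>V. V \<in> T \<Longrightarrow> inj_on (Push C V E X e) (carrier (Ext C V E))"
    and im: "\<And>V. V \<in> T \<Longrightarrow> Push C V E X e ` carrier (Ext C V E) =
        {\<epsilon> \<in> carrier (Ext C V X). Push C V X Y i \<epsilon> = \<zero>\<^bsub>Ext C V Y\<^esub>}"
    and c: "\<And>a b x y z. \<lbrakk>is_coindex E a; is_index E b; is_index X x; is_index Y y; is_index Z z\<rbrakk> \<Longrightarrow> a - b \<simeq> y - x - z"
    using Ext_kernel_object[OF XYZ] by blast
  let ?N = "ker_catmod (ext_mod C X) (ext_mod C Y) (ext_map C X Y i)"
  have N: "MOb ?N V = (Ext C V X)\<lparr>carrier := Push C V E X e ` carrier (Ext C V E)\<rparr>" if "V \<in> T" for V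
    using im[OF that] by (simp add: ker_catmod_def ext_mod_simps ext_map_def)
  have "catmod_iso K stable_T (ext_mod C E) ?N"
    unfolding catmod_iso_def catmod_hom_def
  proof (intro exI[of _ "\<lambda>V. Push C V E X e"] conjI ballI, unfold stable_sub_simps)
    fix V assume V: "V \<in> T"
    show "lin_map K (MOb (ext_mod C E) V) (MOb ?N V) (Push C V E X e)"
      using Push_linear[OF T_Ob[OF V] E(1) o(1) E(2)]
      unfolding N[OF V] ext_mod_simps lin_map_def by simp
    show "bij_betw (Push C V E X e) (carrier (MOb (ext_mod C E) V)) (carrier (MOb ?N V))"
      unfolding N[OF V] ext_mod_simps using inj[OF V] by (simp add: bij_betw_def)
    fix W f u assume W: "W \<in> T" and f: "f \<in> Mor (stable C) V W" and u: "u \<in> carrier (MOb (ext_mod C E) W)"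
    then obtain f0 where f0: "f0 \<in> Mor C V W" "f = stable_mor V W f0"
      unfolding stable_Mor[OF T_Ob[OF V] T_Ob[OF W]] by blast
    have u': "u \<in> carrier (Ext C W E)" using u by (simp add: ext_mod_simps)
    show "Push C V E X e (MMor (ext_mod C E) V W f u) = MMor ?N V W f (Push C W E X e u)"
      using stable_Pull[OF T_Ob[OF V] T_Ob[OF W] f0(1) E(1) u'] f0(2)
        stable_Pull[OF T_Ob[OF V] T_Ob[OF W] f0(1) o(1) Push_closed[OF T_Ob[OF W] E(1) o(1) E(2) u']]
        Push_Pull[OF T_Ob[OF W] T_Ob[OF V] E(1) o(1) f0(1) E(2) u']
      by (simp add: ker_catmod_def ext_mod_simps)
  qed
  then show thesis using that E(1) c by blast
qed

lemma coker_iso_ext_mod: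
  assumes XYZ: "realizes C X Y Z i p \<delta>"
  obtains E where "E \<in> Ob C"
    "catmod_iso K stable_T (ext_mod C E) (coker_catmod (ext_mod C Y) (ext_mod C Z) (ext_map C Y Z p))"
    "\<And>a b x y z. \<lbrakk>is_coindex E a; is_index E b; is_coindex X x; is_coindex Y y; is_coindex Z z\<rbrakk> \<Longrightarrow> a - b \<simeq> x + z - y"
proof -
  note o = realizesD[OF XYZ]
  obtain I Y1 u v where I: "I \<in> injectives C" "conflation C Y I Y1 u v"
    using ex_injective_conflation[OF o(2)] .
  obtain E m where E: "E \<in> Ob C" "m \<in> Mor C Z E"
    and im: "\<And>V. V \<in> T \<Longrightarrow> Push C V Z E m ` carrier (Ext C V Z) = carrier (Ext C V E)"
    and ker: "\<And>V. V \<in> T \<Longrightarrow> {\<epsilon> \<in> carrier (Ext C V Z). Push C V Z E m \<epsilon> = \<zero>\<^bsub>Ext C V E\<^esub>} =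
        Push C V Y Z p ` carrier (Ext C V Y)"
    and c: "\<And>a b x y z. \<lbrakk>is_coindex E a; is_index E b; is_coindex X x; is_coindex Y y; is_coindex Z z\<rbrakk> \<Longrightarrow> a - b \<simeq> x + z - y"
    using Ext_cokernel_object[OF XYZ I(2,1)] by blast
  let ?N = "coker_catmod (ext_mod C Y) (ext_mod C Z) (ext_map C Y Z p)"
  \<comment> \<open>By \<open>ker\<close> this is the image by which \<open>coker_catmod\<close>
    divides. Written as the kernel of the map to Ext(V,E), it reduces the claim to the first
    isomorphism theorem.\<close>
  let ?W = "\<lambda>V. {\<epsilon> \<in> carrier (Ext C V Z). Push C V Z E m \<epsilon> = \<zero>\<^bsub>Ext C V E\<^esub>}"
  have N: "MOb ?N V = quot_module (Ext C V Z) (?W V)"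
    "MMor ?N V V' f a = (\<Union>b\<in>a. ?W V +>\<^bsub>Ext C V Z\<^esub> Pull (stable C) V V' Z f b)" if "V \<in> T" for V V' f a
    using ker[OF that] by (simp_all add: coker_catmod_def ext_mod_simps ext_map_def)
  have lin: "lin_map K (Ext C V Z) (Ext C V E) (Push C V Z E m)" if "V \<in> T" for V
    by (rule Push_linear[OF T_Ob[OF that] o(3) E])
  have EM: "Module.module K (Ext C V Z)" "Module.module K (Ext C V E)" if "V \<in> T" for V
    using Ext_module T_Ob[OF that] o(3) E(1) by simp_all
  have W: "submodule (?W V) K (Ext C V Z)" if V: "V \<in> T" for V
  proof -
    interpret Z: Module.module K "Ext C V Z" using EM(1)[OF V] .
    interpret E: Module.module K "Ext C V E" using EM(2)[OF V] .
    interpret h: abelian_group_hom "Ext C V Z" "Ext C V E" "Push C V Z E m"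
      using lin_map_hom[OF EM[OF V] lin[OF V]] .
    show ?thesis by (rule Z.submoduleI) (auto simp: lin_map_smult[OF lin[OF V]])
  qed
  note coset = quot_module_cosets[OF EM(1) W]
  have eq: "?W V +>\<^bsub>Ext C V Z\<^esub> a = ?W V +>\<^bsub>Ext C V Z\<^esub> b \<longleftrightarrow> Push C V Z E m a = Push C V Z E m b"
    if V: "V \<in> T" and ab: "a \<in> carrier (Ext C V Z)" "b \<in> carrier (Ext C V Z)" for V a b
  proof -
    interpret Z: Module.module K "Ext C V Z" using EM(1)[OF V] .
    interpret E: Module.module K "Ext C V E" using EM(2)[OF V] .
    show ?thesis
      using coset(4)[OF V V ab] Z.minus_closed[OF ab] lin_map_minus[OF EM[OF V] lin[OF V] ab]
        E.minus_zero_iff[OF lin_map_closed[OF lin[OF V] ab(1)] lin_map_closed[OF lin[OF V] ab(2)]] by simp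
  qed
  \<comment> \<open>The induced map on cosets, evaluated at an arbitrary representative;
    \<open>eq\<close> makes the choice immaterial.\<close>
  define F where "F V a = Push C V Z E m (SOME b. b \<in> a)" for V a
  have F: "F V (?W V +>\<^bsub>Ext C V Z\<^esub> b) = Push C V Z E m b" if V: "V \<in> T" and b: "b \<in> carrier (Ext C V Z)" for V b
  proof -
    let ?s = "SOME b'. b' \<in> ?W V +>\<^bsub>Ext C V Z\<^esub> b"
    have "?s \<in> ?W V +>\<^bsub>Ext C V Z\<^esub> b" using coset(5)[OF V V b] by (rule someI)
    from coset(6)[OF V V b this] show ?thesis unfolding F_def using eq[OF V _ b] by blast
  qed
  have Flin: "lin_map K (MOb ?N V) (Ext C V E) (F V)" if V: "V \<in> T" for V
    unfolding N(1)[OF V] by (rule quot_module_lin_map[OF EM(1)[OF V] W[OF V] lin[OF V] F[OF V]])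
  have Nc: "carrier (MOb ?N V) = (\<lambda>b. ?W V +>\<^bsub>Ext C V Z\<^esub> b) ` carrier (Ext C V Z)" if V: "V \<in> T" for V
    unfolding N(1)[OF V] by (rule coset(1)[OF V V])
  have Fb: "bij_betw (F V) (carrier (MOb ?N V)) (carrier (Ext C V E))" if V: "V \<in> T" for V
    unfolding bij_betw_def Nc[OF V]
  proof
    show "inj_on (F V) ((\<lambda>b. ?W V +>\<^bsub>Ext C V Z\<^esub> b) ` carrier (Ext C V Z))"
    proof (rule inj_onI, elim imageE)
      fix a b a' b' assume h: "F V a = F V b" "a = ?W V +>\<^bsub>Ext C V Z\<^esub> a'" "a' \<in> carrier (Ext C V Z)"
        "b = ?W V +>\<^bsub>Ext C V Z\<^esub> b'" "b' \<in> carrier (Ext C V Z)"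
      have "Push C V Z E m a' = Push C V Z E m b'"
        using h(1) unfolding h(2,4) F[OF V h(3)] F[OF V h(5)] .
      then show "a = b" unfolding h(2,4) using eq[OF V h(3,5)] by blast
    qed
    show "F V ` (\<lambda>b. ?W V +>\<^bsub>Ext C V Z\<^esub> b) ` carrier (Ext C V Z) = carrier (Ext C V E)"
      unfolding image_image im[OF V, symmetric] by (rule image_cong[OF refl F[OF V]])
  qed
  have Nm: "Module.module K (MOb ?N V)" if V: "V \<in> T" for V
    unfolding N(1)[OF V] by (rule quot_module_module[OF EM(1)[OF V] W[OF V]])
  \<comment> \<open>The isomorphism has to start at the extension module of E, so the inverse of
    \<open>F\<close> is taken.\<close>
  let ?\<eta> = "\<lambda>V. inv_into (carrier (MOb ?N V)) (F V)"
  have \<eta>: "?\<eta> V (Push C V Z E m b) = ?W V +>\<^bsub>Ext C V Z\<^esub> b" if V: "V \<in> T" and b: "b \<in> carrier (Ext C V Z)" for V b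
  proof -
    have "?W V +>\<^bsub>Ext C V Z\<^esub> b \<in> carrier (MOb ?N V)" unfolding Nc[OF V] using b by blast
    from inv_into_f_f[OF bij_betw_imp_inj_on[OF Fb[OF V]] this] show ?thesis unfolding F[OF V b] .
  qed
  have "catmod_iso K stable_T (ext_mod C E) ?N"
    unfolding catmod_iso_def catmod_hom_def
  proof (intro exI[of _ ?\<eta>] conjI ballI, unfold stable_sub_simps)
    fix V assume V: "V \<in> T"
    show "lin_map K (MOb (ext_mod C E) V) (MOb ?N V) (?\<eta> V)"
      unfolding ext_mod_simps by (rule lin_map_inv_into[OF Nm[OF V] Flin[OF V] Fb[OF V]])
    show "bij_betw (?\<eta> V) (carrier (MOb (ext_mod C E) V)) (carrier (MOb ?N V))"
      unfolding ext_mod_simps by (rule bij_betw_inv_into[OF Fb[OF V]])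
    fix V' f u assume V': "V' \<in> T" and f: "f \<in> Mor (stable C) V V'" and u: "u \<in> carrier (MOb (ext_mod C E) V')"
    note VO = T_Ob[OF V] T_Ob[OF V']
    obtain f0 where f0: "f0 \<in> Mor C V V'" "f = stable_mor V V' f0"
      using f unfolding stable_Mor[OF VO] by blast
    have "u \<in> Push C V' Z E m ` carrier (Ext C V' Z)" unfolding im[OF V'] using u by (simp add: ext_mod_simps)
    then obtain b where b: "b \<in> carrier (Ext C V' Z)" "u = Push C V' Z E m b" by blast
    have pl: "Pull (stable C) V V' Z f a = Pull C V V' Z f0 a" if "a \<in> carrier (Ext C V' Z)" for a
      unfolding f0(2) by (rule stable_Pull[OF VO f0(1) o(3) that])
    have pc: "Pull C V V' Z f0 a \<in> carrier (Ext C V Z)" if "a \<in> carrier (Ext C V' Z)" for a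
      by (rule Pull_closed[OF VO(2,1) o(3) f0(1) that])
    have pp: "Push C V Z E m (Pull C V V' Z f0 a) = Pull C V V' E f0 (Push C V' Z E m a)"
      if "a \<in> carrier (Ext C V' Z)" for a
      by (rule Push_Pull[OF VO(2,1) o(3) E(1) f0(1) E(2) that])
    have "MMor (ext_mod C E) V V' f u = Push C V Z E m (Pull C V V' Z f0 b)"
      unfolding pp[OF b(1)] b(2) f0(2) ext_mod_simps
      by (rule stable_Pull[OF VO f0(1) E(1) Push_closed[OF VO(2) o(3) E b(1)]])
    then have l: "?\<eta> V (MMor (ext_mod C E) V V' f u) = ?W V +>\<^bsub>Ext C V Z\<^esub> Pull C V V' Z f0 b"
      using \<eta>[OF V pc[OF b(1)]] by simp
    have "?W V +>\<^bsub>Ext C V Z\<^esub> Pull (stable C) V V' Z f a = ?W V +>\<^bsub>Ext C V Z\<^esub> Pull C V V' Z f0 b"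
      if a: "a \<in> ?W V' +>\<^bsub>Ext C V' Z\<^esub> b" for a
    proof -
      have a': "a \<in> carrier (Ext C V' Z)" "?W V' +>\<^bsub>Ext C V' Z\<^esub> a = ?W V' +>\<^bsub>Ext C V' Z\<^esub> b"
        using coset(6)[OF V' V' b(1) a] by blast+
      have "Push C V' Z E m a = Push C V' Z E m b" using eq[OF V' a'(1) b(1)] a'(2) by blast
      then have "Push C V Z E m (Pull C V V' Z f0 a) = Push C V Z E m (Pull C V V' Z f0 b)"
        unfolding pp[OF a'(1)] pp[OF b(1)] by simp
      then show ?thesis unfolding pl[OF a'(1)] using eq[OF V pc[OF a'(1)] pc[OF b(1)]] by blast
    qed
    moreover have "b \<in> ?W V' +>\<^bsub>Ext C V' Z\<^esub> b" by (rule coset(5)[OF V' V' b(1)])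
    ultimately have "MMor ?N V V' f (?W V' +>\<^bsub>Ext C V' Z\<^esub> b) = ?W V +>\<^bsub>Ext C V Z\<^esub> Pull C V V' Z f0 b"
      unfolding N(2)[OF V] by blast
    then show "?\<eta> V (MMor (ext_mod C E) V V' f u) = MMor ?N V V' f (?\<eta> V' u)"
      unfolding l unfolding b(2) \<eta>[OF V' b(1)] by simp
  qed
  then show thesis using that E(1) c by blast
qed

end

section \<open>The maps on Grothendieck groups\<close>

lemma hom_group_diff:
  assumes "h \<in> hom G H" "group G" "group H" "x \<in> carrier G" "y \<in> carrier G"
  shows "h (group_diff G x y) = group_diff H (h x) (h y)"
proof -
  interpret h: group_hom G H h
    using assms by (simp add: group_hom_def group_hom_axioms_def)
  show ?thesis using assms(4,5) by (simp add: group_diff_def)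
qed

lemma group_K0_mod: "group (K0_mod K A)"
proof -
  interpret P: group_presentation "fp_modules K A" "exact_relators K A"
    by (rule group_presentation_K0_mod)
  show ?thesis unfolding K0_mod_def by (rule P.P.group_axioms)
qed

context cluster_tilting_frobenius
begin

lemma group_K0_split: "group (K0_split (full_sub C T))"
  unfolding K0_split_eq by (rule G.P.group_axioms)

lemma cls_group_diff:
  "z \<in> G.frags \<Longrightarrow> w \<in> G.frags \<Longrightarrow>
    group_diff (K0_split (full_sub C T)) (G.cls z) (G.cls w) = G.cls (z - w)"
  unfolding K0_split_eq by (rule G.cls_diff)

text \<open>\<open>is_beta\<close> prescribes values on extension modules only. Since
  \<open>mod_class\<close> depends only on the isomorphism class, M can be traded for the extension
  module of E, and its value is then the coindex minus the index of E.\<close>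

lemma beta_value:
  assumes \<beta>: "is_beta K C T h" and E: "E \<in> Ob C" and M: "catmod_iso K stable_T (ext_mod C E) M"
    and w: "w \<in> G.frags" and c: "\<And>a b. \<lbrakk>is_coindex E a; is_index E b\<rbrakk> \<Longrightarrow> a - b \<simeq> w"
  shows "h (mod_class K stable_T M) = G.cls w" "mod_class K stable_T M \<in> carrier (K0_mod K stable_T)"
proof -
  have m: "mod_class K stable_T M = mod_class K stable_T (ext_mod C E)"
    using mod_class_cong[OF ext_mod_stable_T[OF E] M] by simp
  obtain a b where ab: "is_coindex E a" "is_index E b" using ex_coindex[OF E] ex_index[OF E] by blast
  note f = coindex_frags[OF ab(1)] index_frags[OF ab(2)]
  have "h (mod_class K stable_T M) = group_diff (K0_split (full_sub C T)) (coind C T E) (ind C T E)"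
    unfolding m using \<beta> E by (simp add: is_beta_def)
  also have "\<dots> = G.cls (a - b)"
    unfolding coind_eq[OF E ab(1)] ind_eq[OF E ab(2)] by (rule cls_group_diff[OF f])
  also have "\<dots> = G.cls w" by (rule G.cls_eqI[OF G.frags_diff[OF f] w c[OF ab]])
  finally show "h (mod_class K stable_T M) = G.cls w" .
  show "mod_class K stable_T M \<in> carrier (K0_mod K stable_T)" unfolding m by (rule mod_class_closed[OF E])
qed

lemma frags_add: "z \<in> G.frags \<Longrightarrow> w \<in> G.frags \<Longrightarrow> z + w \<in> G.frags"
  using keys_add[of z w] by auto

lemma beta_ker:
  assumes "is_beta K C T h" and XYZ: "conflation C X Y Z i p" and f: "is_index X x" "is_index Y y" "is_index Z z"
  shows "h (mod_class K stable_T (ker_catmod (ext_mod C X) (ext_mod C Y) (ext_map C X Y i))) = G.cls (y - x - z)"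
    and "mod_class K stable_T (ker_catmod (ext_mod C X) (ext_mod C Y) (ext_map C X Y i)) \<in> carrier (K0_mod K stable_T)"
proof -
  obtain \<delta> where \<delta>: "realizes C X Y Z i p \<delta>" using XYZ conflation_iff by metis
  obtain E where E: "E \<in> Ob C"
    "catmod_iso K stable_T (ext_mod C E) (ker_catmod (ext_mod C X) (ext_mod C Y) (ext_map C X Y i))"
    and c: "\<And>a b x y z. \<lbrakk>is_coindex E a; is_index E b; is_index X x; is_index Y y; is_index Z z\<rbrakk> \<Longrightarrow> a - b \<simeq> y - x - z"
    using ker_iso_ext_mod[OF \<delta>] by blast
  have w: "y - x - z \<in> G.frags" by (intro G.frags_diff index_frags[OF f(1)] index_frags[OF f(2)] index_frags[OF f(3)])
  note b = beta_value[OF assms(1) E w c[OF _ _ f]]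
  show "h (mod_class K stable_T (ker_catmod (ext_mod C X) (ext_mod C Y) (ext_map C X Y i))) = G.cls (y - x - z)"
    "mod_class K stable_T (ker_catmod (ext_mod C X) (ext_mod C Y) (ext_map C X Y i)) \<in> carrier (K0_mod K stable_T)"
    by (rule b; assumption)+
qed

lemma beta_coker:
  assumes "is_beta K C T h" and XYZ: "conflation C X Y Z i p" and f: "is_coindex X x" "is_coindex Y y" "is_coindex Z z"
  shows "h (mod_class K stable_T (coker_catmod (ext_mod C Y) (ext_mod C Z) (ext_map C Y Z p))) = G.cls (x + z - y)"
    and "mod_class K stable_T (coker_catmod (ext_mod C Y) (ext_mod C Z) (ext_map C Y Z p)) \<in> carrier (K0_mod K stable_T)"
proof -
  obtain \<delta> where \<delta>: "realizes C X Y Z i p \<delta>" using XYZ conflation_iff by metis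
  obtain E where E: "E \<in> Ob C"
    "catmod_iso K stable_T (ext_mod C E) (coker_catmod (ext_mod C Y) (ext_mod C Z) (ext_map C Y Z p))"
    and c: "\<And>a b x y z. \<lbrakk>is_coindex E a; is_index E b; is_coindex X x; is_coindex Y y; is_coindex Z z\<rbrakk> \<Longrightarrow> a - b \<simeq> x + z - y"
    using coker_iso_ext_mod[OF \<delta>] by blast
  have w: "x + z - y \<in> G.frags"
    by (intro G.frags_diff frags_add coindex_frags[OF f(1)] coindex_frags[OF f(2)] coindex_frags[OF f(3)])
  note b = beta_value[OF assms(1) E w c[OF _ _ f]]
  show "h (mod_class K stable_T (coker_catmod (ext_mod C Y) (ext_mod C Z) (ext_map C Y Z p))) = G.cls (x + z - y)"
    "mod_class K stable_T (coker_catmod (ext_mod C Y) (ext_mod C Z) (ext_map C Y Z p)) \<in> carrier (K0_mod K stable_T)"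
    by (rule b; assumption)+
qed

end

section \<open>Comparison of two cluster-tilting subcategories\<close>

locale two_cluster_tilting =
  T: cluster_tilting_frobenius K C T + U: cluster_tilting_frobenius K C U
  for K :: "'k ring" and C :: "('o,'m,'k,'e) extcat" and T U :: "'o set"
begin

text \<open>\<open>ind\<close>, \<open>coind\<close>, \<open>l1\<close>, \<open>l2\<close>,
  \<open>r1\<close> and \<open>r2\<close> all unfold to the same two choices for X, so the objects
  L, R, L', R' are shared by both sides of the identities to be proved.\<close>

lemma chosen_conflations:
  assumes "X \<in> Ob C"
  obtains L R i p L' R' i' p' where
    "coindex_conflation C U X = (L,R,i,p)" "L \<in> U" "R \<in> U" "conflation C X L R i p"
    "index_conflation C U X = (L',R',i',p')" "L' \<in> U" "R' \<in> U" "conflation C L' R' X i' p'"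
proof -
  obtain L R i p where 1: "coindex_conflation C U X = (L,R,i,p)" by (rule prod_cases4)
  obtain L' R' i' p' where 2: "index_conflation C U X = (L',R',i',p')" by (rule prod_cases4)
  have "\<exists>s. case s of (L,R,i,p) \<Rightarrow> L \<in> U \<and> R \<in> U \<and> conflation C X L R i p"
  proof -
    obtain L R i p where "L \<in> U" "R \<in> U" "conflation C X L R i p"
      using U.ex_coindex_conflation[OF assms] .
    then show ?thesis by (intro exI[of _ "(L,R,i,p)"]) simp
  qed
  from someI_ex[OF this] have "case coindex_conflation C U X of (L,R,i,p) \<Rightarrow> L \<in> U \<and> R \<in> U \<and> conflation C X L R i p"
    unfolding coindex_conflation_def .
  then have 3: "L \<in> U" "R \<in> U" "conflation C X L R i p" using 1 by simp_all
  have "\<exists>s. case s of (L,R,i,p) \<Rightarrow> L \<in> U \<and> R \<in> U \<and> conflation C L R X i p"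
  proof -
    obtain L R i p where "L \<in> U" "R \<in> U" "conflation C L R X i p"
      using U.ex_index_conflation[OF assms] .
    then show ?thesis by (intro exI[of _ "(L,R,i,p)"]) simp
  qed
  from someI_ex[OF this] have "case index_conflation C U X of (L,R,i,p) \<Rightarrow> L \<in> U \<and> R \<in> U \<and> conflation C L R X i p"
    unfolding index_conflation_def .
  then have 4: "L' \<in> U" "R' \<in> U" "conflation C L' R' X i' p'" using 2 by simp_all
  show thesis by (rule that[OF 1 3 2 4])
qed

text \<open>The value of \<beta> for \<open>U\<close> is ([L] - [R]) - ([R'] - [L']), to which
  \<open>h\<close> is applied term by term. Leaving \<open>h\<close> abstract serves the index and
  the coindex map alike.\<close>

lemma hom_beta_value:
  assumes h: "h \<in> hom (K0_split (full_sub C U)) (K0_split (full_sub C T))"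
    and c: "coindex_conflation C U X = (L,R,i,p)" "L \<in> U" "R \<in> U"
    and c': "index_conflation C U X = (L',R',i',p')" "L' \<in> U" "R' \<in> U"
    and \<beta>: "is_beta K C U b" and X: "X \<in> Ob C"
    and v: "h (obj_class (full_sub C U) L) = T.G.cls l" "h (obj_class (full_sub C U) R) = T.G.cls r"
      "h (obj_class (full_sub C U) L') = T.G.cls l'" "h (obj_class (full_sub C U) R') = T.G.cls r'"
    and f: "l \<in> T.G.frags" "r \<in> T.G.frags" "l' \<in> T.G.frags" "r' \<in> T.G.frags"
  shows "h (b (mod_class K U.stable_T (ext_mod C X))) = T.G.cls ((l - r) - (r' - l'))"
proof -
  let ?G = "K0_split (full_sub C U)"
  have o: "obj_class (full_sub C U) Y \<in> carrier ?G" if "Y \<in> U" for Y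
    unfolding U.K0_split_eq U.obj_class_eq by (rule U.G.cls_closed) (use that in simp)
  interpret G: group ?G by (rule U.group_K0_split)
  note d = hom_group_diff[OF h U.group_K0_split T.group_K0_split]
  have "b (mod_class K U.stable_T (ext_mod C X)) = group_diff ?G (coind C U X) (ind C U X)"
    using \<beta> X by (simp add: is_beta_def)
  also have "\<dots> = group_diff ?G (group_diff ?G (obj_class (full_sub C U) L) (obj_class (full_sub C U) R))
      (group_diff ?G (obj_class (full_sub C U) R') (obj_class (full_sub C U) L'))"
    by (simp add: coind_def ind_def c(1) c'(1))
  finally have 1: "b (mod_class K U.stable_T (ext_mod C X)) = \<dots>" .
  have cl: "group_diff ?G (obj_class (full_sub C U) Y) (obj_class (full_sub C U) Z) \<in> carrier ?G"
    if "Y \<in> U" "Z \<in> U" for Y Z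
    using o[OF that(1)] o[OF that(2)] by (simp add: group_diff_def)
  show ?thesis
    unfolding 1 d[OF cl[OF c(2,3)] cl[OF c'(3,2)]] d[OF o[OF c(2)] o[OF c(3)]] d[OF o[OF c'(3)] o[OF c'(2)]] v
    using f by (simp add: T.cls_group_diff T.G.frags_diff[simplified])
qed

lemma ind_beta:
  assumes i: "is_ind_map C U T ind_UT" and \<beta>T: "is_beta K C T beta_T" and \<beta>U: "is_beta K C U beta_U"
    and I: "is_Ind_bar K C U T Ind_bar" and X: "X \<in> Ob C"
  shows "ind_UT (beta_U (mod_class K U.stable_T (ext_mod C X))) = beta_T (Ind_bar (mod_class K U.stable_T (ext_mod C X)))"
proof -
  obtain L R i p L' R' i' p' where c: "coindex_conflation C U X = (L,R,i,p)" "L \<in> U" "R \<in> U" "conflation C X L R i p"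
    and c': "index_conflation C U X = (L',R',i',p')" "L' \<in> U" "R' \<in> U" "conflation C L' R' X i' p'"
    using chosen_conflations[OF X] .
  note o = c(2,3)[THEN U.T_Ob] c'(2,3)[THEN U.T_Ob]
  obtain x l r l' r' where x: "T.is_index X x" "T.is_index L l" "T.is_index R r" "T.is_index L' l'" "T.is_index R' r'"
    using T.ex_index X o by meson
  note f = x[THEN T.index_frags]
  have h: "ind_UT \<in> hom (K0_split (full_sub C U)) (K0_split (full_sub C T))"
    and v: "\<And>Y. Y \<in> U \<Longrightarrow> ind_UT (obj_class (full_sub C U) Y) = ind C T Y"
    using i by (simp_all add: is_ind_map_def)
  have lhs: "ind_UT (beta_U (mod_class K U.stable_T (ext_mod C X))) = T.G.cls ((l - r) - (r' - l'))"
    by (rule hom_beta_value[OF h c(1-3) c'(1-3) \<beta>U X _ _ _ _ f(2-5)])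
      (simp_all only: v c c' T.ind_eq[OF o(1) x(2)] T.ind_eq[OF o(2) x(3)] T.ind_eq[OF o(3) x(4)] T.ind_eq[OF o(4) x(5)])
  \<comment> \<open>X is the first term of one conflation and the last term of the other. The kernel
    formula y - x - z treats the two ends equally, so both values contain the index of X with the
    same sign.\<close>
  note b1 = T.beta_ker[OF \<beta>T c(4) x(1,2,3)] and b2 = T.beta_ker[OF \<beta>T c'(4) x(4,5,1)]
  have bh: "beta_T \<in> hom (K0_mod K T.stable_T) (K0_split (full_sub C T))"
    using \<beta>T by (simp add: is_beta_def)
  have "Ind_bar (mod_class K U.stable_T (ext_mod C X)) =
     group_diff (K0_mod K T.stable_T) (mod_class K T.stable_T (l1 C U X)) (mod_class K T.stable_T (r1 C U X))"
    using I X by (simp add: is_Ind_bar_def)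
  also have "\<dots> = group_diff (K0_mod K T.stable_T)
      (mod_class K T.stable_T (ker_catmod (ext_mod C X) (ext_mod C L) (ext_map C X L i)))
      (mod_class K T.stable_T (ker_catmod (ext_mod C L') (ext_mod C R') (ext_map C L' R' i')))"
    by (simp add: l1_def r1_def c(1) c'(1))
  finally have "beta_T (Ind_bar (mod_class K U.stable_T (ext_mod C X))) =
      group_diff (K0_split (full_sub C T)) (T.G.cls (l - x - r)) (T.G.cls (r' - l' - x))"
    using hom_group_diff[OF bh group_K0_mod T.group_K0_split b1(2) b2(2)] b1(1) b2(1) by simp
  also have "\<dots> = T.G.cls ((l - x - r) - (r' - l' - x))"
    by (intro T.cls_group_diff T.G.frags_diff f)
  also have "(l - x - r) - (r' - l' - x) = (l - r) - (r' - l')" by simp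
  finally show ?thesis using lhs by simp
qed

lemma coind_beta:
  assumes i: "is_coind_map C U T coind_UT" and \<beta>T: "is_beta K C T beta_T" and \<beta>U: "is_beta K C U beta_U"
    and I: "is_Coind_bar K C U T Coind_bar" and X: "X \<in> Ob C"
  shows "coind_UT (beta_U (mod_class K U.stable_T (ext_mod C X))) = beta_T (Coind_bar (mod_class K U.stable_T (ext_mod C X)))"
proof -
  obtain L R i p L' R' i' p' where c: "coindex_conflation C U X = (L,R,i,p)" "L \<in> U" "R \<in> U" "conflation C X L R i p"
    and c': "index_conflation C U X = (L',R',i',p')" "L' \<in> U" "R' \<in> U" "conflation C L' R' X i' p'"
    using chosen_conflations[OF X] .
  note o = c(2,3)[THEN U.T_Ob] c'(2,3)[THEN U.T_Ob]
  obtain x l r l' r' where x: "T.is_coindex X x" "T.is_coindex L l" "T.is_coindex R r" "T.is_coindex L' l'" "T.is_coindex R' r'"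
    using T.ex_coindex X o by meson
  note f = x[THEN T.coindex_frags]
  have h: "coind_UT \<in> hom (K0_split (full_sub C U)) (K0_split (full_sub C T))"
    and v: "\<And>Y. Y \<in> U \<Longrightarrow> coind_UT (obj_class (full_sub C U) Y) = coind C T Y"
    using i by (simp_all add: is_coind_map_def)
  have lhs: "coind_UT (beta_U (mod_class K U.stable_T (ext_mod C X))) = T.G.cls ((l - r) - (r' - l'))"
    by (rule hom_beta_value[OF h c(1-3) c'(1-3) \<beta>U X _ _ _ _ f(2-5)])
      (simp_all only: v c c' T.coind_eq[OF o(1) x(2)] T.coind_eq[OF o(2) x(3)] T.coind_eq[OF o(3) x(4)] T.coind_eq[OF o(4) x(5)])
  \<comment> \<open>Again the formula x + z - y is symmetric in the end terms, so the coindex of X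
    occurs once in each value and drops out of the difference.\<close>
  note b1 = T.beta_coker[OF \<beta>T c'(4) x(4,5,1)] and b2 = T.beta_coker[OF \<beta>T c(4) x(1,2,3)]
  have bh: "beta_T \<in> hom (K0_mod K T.stable_T) (K0_split (full_sub C T))"
    using \<beta>T by (simp add: is_beta_def)
  have "Coind_bar (mod_class K U.stable_T (ext_mod C X)) =
     group_diff (K0_mod K T.stable_T) (mod_class K T.stable_T (r2 C U X)) (mod_class K T.stable_T (l2 C U X))"
    using I X by (simp add: is_Coind_bar_def)
  also have "\<dots> = group_diff (K0_mod K T.stable_T)
      (mod_class K T.stable_T (coker_catmod (ext_mod C R') (ext_mod C X) (ext_map C R' X p')))
      (mod_class K T.stable_T (coker_catmod (ext_mod C L) (ext_mod C R) (ext_map C L R p)))"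
    by (simp add: l2_def r2_def c(1) c'(1))
  finally have "beta_T (Coind_bar (mod_class K U.stable_T (ext_mod C X))) =
      group_diff (K0_split (full_sub C T)) (T.G.cls (l' + x - r')) (T.G.cls (x + r - l))"
    using hom_group_diff[OF bh group_K0_mod T.group_K0_split b1(2) b2(2)] b1(1) b2(1) by simp
  also have "\<dots> = T.G.cls ((l' + x - r') - (x + r - l))"
    by (intro T.cls_group_diff T.G.frags_diff T.frags_add f)
  also have "(l' + x - r') - (x + r - l) = (l - r) - (r' - l')" by simp
  finally show ?thesis using lhs by simp
qed

lemma K0_mod_hom_eqI:
  assumes "h \<in> hom (K0_mod K U.stable_T) G" "h' \<in> hom (K0_mod K U.stable_T) G" "group G"
    and "\<And>X. X \<in> Ob C \<Longrightarrow> h (mod_class K U.stable_T (ext_mod C X)) = h' (mod_class K U.stable_T (ext_mod C X))"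
    and "x \<in> carrier (K0_mod K U.stable_T)"
  shows "h x = h' x"
proof -
  interpret P: group_presentation "fp_modules K U.stable_T" "exact_relators K U.stable_T"
    by (rule group_presentation_K0_mod)
  show ?thesis
    by (rule P.hom_eqI[OF assms(1,2)[unfolded K0_mod_def] assms(3) _ assms(5)[unfolded K0_mod_def]])
      (use U.presented_class_ext_mod assms(4) in metis)
qed

end

theorem theorem4p41:
  fixes K :: "'k ring" and C :: "('o,'m,'k,'e) extcat" and T U :: "'o set"
    and ind_UT coind_UT :: "('o \<Rightarrow>\<^sub>0 int) set \<Rightarrow> ('o \<Rightarrow>\<^sub>0 int) set"
    and beta_T beta_U ::
      "(('o,'m set,'k,'m set set) catmod \<Rightarrow>\<^sub>0 int) set \<Rightarrow> ('o \<Rightarrow>\<^sub>0 int) set"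
    and Ind_bar Coind_bar ::
      "(('o,'m set,'k,'m set set) catmod \<Rightarrow>\<^sub>0 int) set \<Rightarrow>
       (('o,'m set,'k,'m set set) catmod \<Rightarrow>\<^sub>0 int) set"
  assumes "perfect_field K"
    and "cluster_category TYPE('p \<times> 'n \<times> 'd) K C"
    and "compact_category K (stable C) \<or> skew_symmetric K (stable C)"
    and "cluster_tilting C T" and "cluster_tilting C U"
    and "is_ind_map C U T ind_UT" and "is_coind_map C U T coind_UT"
    and "is_beta K C T beta_T" and "is_beta K C U beta_U"
    and "is_Ind_bar K C U T Ind_bar" and "is_Coind_bar K C U T Coind_bar"
  shows "\<forall>x\<in>carrier (K0_mod K (stable_sub C U)).
           ind_UT (beta_U x) = beta_T (Ind_bar x) \<and> coind_UT (beta_U x) = beta_T (Coind_bar x)"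
proof -
  have C: "extriangulated_category K C" "frobenius C"
    using assms(2) by (simp_all add: cluster_category_def)
  have ctf: "cluster_tilting_frobenius K C V" if "cluster_tilting C V" for V
    using C that by (simp add: cluster_tilting_frobenius_def cluster_tilting_sub_def
      cluster_tilting_sub_axioms_def frobenius_category_def frobenius_category_axioms_def)
  interpret two_cluster_tilting K C T U
    by (intro two_cluster_tilting.intro ctf assms(4,5))
  have homs: "ind_UT \<in> hom (K0_split (full_sub C U)) (K0_split (full_sub C T))"
    "coind_UT \<in> hom (K0_split (full_sub C U)) (K0_split (full_sub C T))"
    "beta_U \<in> hom (K0_mod K U.stable_T) (K0_split (full_sub C U))"
    "beta_T \<in> hom (K0_mod K T.stable_T) (K0_split (full_sub C T))"
    "Ind_bar \<in> hom (K0_mod K U.stable_T) (K0_mod K T.stable_T)"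
    "Coind_bar \<in> hom (K0_mod K U.stable_T) (K0_mod K T.stable_T)"
    using assms(6-11)
    by (simp_all add: is_ind_map_def is_coind_map_def is_beta_def is_Ind_bar_def is_Coind_bar_def)
  show ?thesis
  proof (intro ballI conjI)
    fix x assume x: "x \<in> carrier (K0_mod K (stable_sub C U))"
    show "ind_UT (beta_U x) = beta_T (Ind_bar x)"
      using K0_mod_hom_eqI[OF hom_compose[OF homs(3,1)] hom_compose[OF homs(5,4)] T.group_K0_split _ x]
        ind_beta[OF assms(6,8,9,10)] by simp
    show "coind_UT (beta_U x) = beta_T (Coind_bar x)"
      using K0_mod_hom_eqI[OF hom_compose[OF homs(3,2)] hom_compose[OF homs(6,4)] T.group_K0_split _ x]
        coind_beta[OF assms(7,8,9,11)] by simp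
  qed
qed

end
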